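(* The triple $(\tilde{A},\tilde{\sigma},\widetilde{\mathbb{B}})$ constructed in the context is a complete local contact algebra, and it is LCA-isomorphic to the complete local contact algebra $(RC(\mathbb{R}),\rho_{\mathbb{R}},CR(\mathbb{R}))$, where $\mathbb{R}$ is the real line with its natural topology. Thus $(\tilde{A},\tilde{\sigma},\widetilde{\mathbb{B}})$ completely determines $\mathbb{R}$: every locally compact Hausdorff space $Y$ such that $(RC(Y),\rho_Y,CR(Y))$ is LCA-isomorphic to $(\tilde{A},\tilde{\sigma},\widetilde{\mathbb{B}})$ is homeomorphic to $\mathbb{R}$.
   Context: **Contact algebras.** A contact algebra $(B,C)$ is a Boolean algebra $B$ (complement $a^*$) with a binary relation $C$ such that: (C1) $a\neq 0\Rightarrow aCa$; (C2) $aCb\Rightarrow a\neq 0$ and $b\ne 0$; (C3) $aCb\Rightarrow bCa$; (C4) $aC(b\vee c)$ iff $aCb$ or $aCc$. Write $a(-C)b$ for "not $aCb$", and $a\ll_C b$ iff $a(-C)b^*$. **Local contact algebras.** A local contact algebra (LCA) $(B,\rho,\mathbb{B})$ is a contact algebra $(B,\rho)$ with an ideal $\mathbb{B}$ of $B$ (possibly $\mathbb B=B$) such that: (BC1) if $a\in\mathbb{B}$, $c\in B$, $a\ll_\rho c$, then $a\ll_\rho b\ll_\rho c$ for some $b\in\mathbb{B}$; (BC2) if $a\rho b$ then $a\rho(c\wedge b)$ for some $c\in\mathbb{B}$; (BC3) if $a\neq 0$ there is $b\in\mathbb{B}\setminus\{0\}$ with $b\ll_\rho a$. It is complete (CLCA)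 if $B$ is a complete Boolean algebra. $(B,\rho,\mathbb{B})$ and $(B_1,\rho_1,\mathbb{B}_1)$ are LCA-isomorphic if there is a Boolean isomorphism $\varphi:B\to B_1$ with $a\rho b\iff\varphi(a)\rho_1\varphi(b)$ and $a\in\mathbb{B}\iff\varphi(a)\in\mathbb{B}_1$. **Standard LCAs.** For a locally compact Hausdorff space $X$: $RC(X)$ is the complete Boolean algebra of regular closed subsets ($F=\mathrm{cl}(\mathrm{int}F)$), with $F\vee G=F\cup G$, $F\wedge G=\mathrm{cl}(\mathrm{int}(F\cap G))$, $F^*=\mathrm{cl}(X\setminus F)$; $F\rho_X G$ iff $F\cap G\neq\emptyset$; $CR(X)$ is the ideal of compact regular closed sets. **Construction of $(\tilde{A},\tilde{\sigma},\widetilde{\mathbb{B}})$.** Let $\mathbb{Z}_0=\mathbb{Z}\setminus\{0\}$ with the usual order; for $p\in\mathbb{Z}_0$ let $p^-,p^+$ be its immediate predecessor and successor in $\mathbb{Z}_0$ (so $1^-=-1$, $(-1)^+=1$), $succ(p)=\{q\in\mathbb{Z}_0: q>p\}$, $pred(p)=\{q\in\mathbb{Z}_0: q<p\}$. For $i\in\mathbb{N}^+$ let $A_i=P(\mathbb{Z}_0)$ (power set Boolean algebra). Let $(A,(\varphi_i)_{i\in\mathbb{N}^+})$ be the sum (coproduct, free product) of the Boolean algebras $A_i$, with canonical monomorphisms $\varphi_i:A_i\to A$, and let $\tilde{A}\supseteq A$ be the (MacNeille) completion of $A$. Let $B_0$ be the set of all elements $b=\varphi_1(\{n_1\})\wedge\dots\wedge\varphi_k(\{n_k\})$,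 $k\in\mathbb{N}^+$, $n_1,\dots,n_k\in\mathbb{Z}_0$. For such $b$ put $b_-=\varphi_1(\{n_1\})\wedge\dots\wedge\varphi_{k-1}(\{n_{k-1}\})\wedge\varphi_k(\{n_k^-\})$ and, for $r\in\mathbb{N}^+$, $q_{br}=(b_-\wedge\varphi_{k+1}(succ(r)))\vee(b\wedge\varphi_{k+1}(pred(-r)))$. Let $B_1=\{q_{br}: b\in B_0, r\in\mathbb{N}^+\}$ and let $\widetilde{\mathbb{B}}$ be the ideal of $\tilde{A}$ generated by $B_0\cup B_1$. The relation $\tilde{\sigma}$ on $\tilde{A}$ is symmetric and defined as follows. Let $b=\bigwedge_{i=1}^k\varphi_i(\{n_i\})$, $b'=\bigwedge_{i=1}^l\varphi_i(\{n'_i\})$ be in $B_0$ and $r,r'\in\mathbb{N}^+$. (i) If $k\le l$: $b\tilde{\sigma}b'$ iff $n_i=n'_i$ for all $i<k$ and [$n'_k\in\{n_k^-,n_k,n_k^+\}$ if $k=l$; $n'_k=n_k$ if $k<l$]. (ii) If $k\le l$: $q_{br}\tilde{\sigma}q_{b'r'}$ iff $n_i=n'_i$ for all $i<k$ and [$n'_k=n_k$ if $l=k$; ($n'_k=n_k$ and $n'_{k+1}\le -r$) or ($n'_k=n_k^-$ and $n'_{k+1}>r$) if $l=k+1$; ($n'_k=n_k$ and $n'_{k+1}<-r$) or ($n'_k=n_k^-$ and $n'_{k+1}>r$) if $l>k+1$]. (iii) If $k>l$: $q_{br}\tilde{\sigma}b'$ iff $n_i=n'_i$ for all $i\in\{1,\dots,l\}$.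 If $k\le l$: $q_{br}\tilde{\sigma}b'$ iff $n_i=n'_i$ for all $i<k$ and [$n'_k\in\{n_k^-,n_k\}$ if $l=k$; ($n'_{k+1}\ge r$ and $n'_k=n_k^-$) or ($n'_{k+1}\le -r$ and $n'_k=n_k$) if $l=k+1$; ($n'_{k+1}>r$ and $n'_k=n_k^-$) or ($n'_{k+1}<-r$ and $n'_k=n_k$) if $l>k+1$]. (iv) For $c,d\in\widetilde{\mathbb{B}}$: $c(-\tilde{\sigma})d$ iff there are $k,l\in\mathbb{N}^+$ and $c_1,\dots,c_k,d_1,\dots,d_l\in B_0\cup B_1$ with $c\le\bigvee_i c_i$, $d\le\bigvee_j d_j$ and $c_i(-\tilde{\sigma})d_j$ for all $i,j$. (v) For $a,b\in\tilde{A}$: $a\tilde{\sigma}b$ iff there are $c,d\in\widetilde{\mathbb{B}}$ with $c\le a$, $d\le b$, $c\tilde{\sigma}d$. *)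

theory Defs
  imports "HOL-Analysis.Analysis" "HOL-Algebra.Complete_Lattice"
begin

no_notation eq_closure_of (\<open>closure'_of\<index>\<close>)

section \<open>Boolean algebras\<close>

text \<open>
  Boolean algebras have explicit carriers and are given by their order, as in
  \<^theory>\<open>HOL-Algebra.Complete_Lattice\<close>. The type class for complete Boolean
  algebras in the library cannot be used here, because it demands complete distributivity, which
  regular closed sets do not satisfy.
\<close>

locale boolean_lattice = bounded_lattice L for L (structure) +
  assumes meet_join_distrib:
      "\<lbrakk>x \<in> carrier L; y \<in> carrier L; z \<in> carrier L\<rbrakk> \<Longrightarrow> x \<sqinter> (y \<squnion> z) = (x \<sqinter> y) \<squnion> (x \<sqinter> z)"
    and complemented:
      "x \<in> carrier L \<Longrightarrow> \<exists>y\<in>carrier L. x \<sqinter> y = \<bottom> \<and> x \<squnion> y = \<top>"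

definition bcompl :: "('a, 'm) gorder_scheme \<Rightarrow> 'a \<Rightarrow> 'a" where
  "bcompl L x = (THE y. y \<in> carrier L \<and> x \<sqinter>\<^bsub>L\<^esub> y = \<bottom>\<^bsub>L\<^esub> \<and> x \<squnion>\<^bsub>L\<^esub> y = \<top>\<^bsub>L\<^esub>)"

definition bool_hom :: "('a, 'm) gorder_scheme \<Rightarrow> ('b, 'n) gorder_scheme \<Rightarrow> ('a \<Rightarrow> 'b) \<Rightarrow> bool" where
  "bool_hom L M f \<longleftrightarrow> f \<in> carrier L \<rightarrow> carrier M
     \<and> (\<forall>x\<in>carrier L. \<forall>y\<in>carrier L.
          f (x \<sqinter>\<^bsub>L\<^esub> y) = f x \<sqinter>\<^bsub>M\<^esub> f y \<and> f (x \<squnion>\<^bsub>L\<^esub> y) = f x \<squnion>\<^bsub>M\<^esub> f y)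
     \<and> (\<forall>x\<in>carrier L. f (bcompl L x) = bcompl M (f x))
     \<and> f \<bottom>\<^bsub>L\<^esub> = \<bottom>\<^bsub>M\<^esub> \<and> f \<top>\<^bsub>L\<^esub> = \<top>\<^bsub>M\<^esub>"

definition bool_iso :: "('a, 'm) gorder_scheme \<Rightarrow> ('b, 'n) gorder_scheme \<Rightarrow> ('a \<Rightarrow> 'b) \<Rightarrow> bool" where
  "bool_iso L M f \<longleftrightarrow> bool_hom L M f \<and> bij_betw f (carrier L) (carrier M)"

definition lattice_ideal :: "('a, 'm) gorder_scheme \<Rightarrow> 'a set \<Rightarrow> bool" where
  "lattice_ideal L I \<longleftrightarrow> I \<subseteq> carrier L \<and> \<bottom>\<^bsub>L\<^esub> \<in> I
     \<and> (\<forall>x\<in>I. \<forall>y\<in>I. x \<squnion>\<^bsub>L\<^esub> y \<in> I)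
     \<and> (\<forall>x\<in>I. \<forall>y\<in>carrier L. y \<sqsubseteq>\<^bsub>L\<^esub> x \<longrightarrow> y \<in> I)"

definition generated_ideal :: "('a, 'm) gorder_scheme \<Rightarrow> 'a set \<Rightarrow> 'a set" where
  "generated_ideal L S = \<Inter>{I. lattice_ideal L I \<and> S \<subseteq> I}"

definition powerset_algebra :: "'a set \<Rightarrow> 'a set gorder" where
  "powerset_algebra Z = \<lparr>carrier = Pow Z, eq = (=), le = (\<subseteq>)\<rparr>"

text \<open>
  Sums (coproducts) by their universal property. HOL cannot quantify over all types inside a
  formula, so the test algebras \<open>D\<close> live on the type \<open>'a set\<close>. This is no restriction: that type
  carries the two-element algebra, for which the universal property already implies the one for
  algebras of every type. Uniqueness is required on the carrier only, which is what
  \<^const>\<open>extensional\<close> is for.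
\<close>

definition bool_sum ::
    "'i set \<Rightarrow> ('i \<Rightarrow> ('b, 'm) gorder_scheme) \<Rightarrow> ('a, 'n) gorder_scheme \<Rightarrow> ('i \<Rightarrow> 'b \<Rightarrow> 'a) \<Rightarrow> bool" where
  "bool_sum I B A \<phi> \<longleftrightarrow> boolean_lattice A \<and> (\<forall>i\<in>I. bool_hom (B i) A (\<phi> i))
     \<and> (\<forall>(D :: 'a set gorder) \<psi>. boolean_lattice D \<and> (\<forall>i\<in>I. bool_hom (B i) D (\<psi> i)) \<longrightarrow>
          (\<exists>!f. f \<in> extensional (carrier A) \<and> bool_hom A D f
               \<and> (\<forall>i\<in>I. \<forall>x\<in>carrier (B i). f (\<phi> i x) = \<psi> i x)))"

text \<open>
  The completion of \<open>A\<close>: a complete Boolean algebra that contains \<open>A\<close> as a dense subalgebra.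
\<close>

definition bool_completion :: "('a, 'm) gorder_scheme \<Rightarrow> ('a, 'n) gorder_scheme \<Rightarrow> bool" where
  "bool_completion A L \<longleftrightarrow> boolean_lattice A \<and> boolean_lattice L \<and> complete_lattice L
     \<and> carrier A \<subseteq> carrier L \<and> bool_hom A L (\<lambda>x. x)
     \<and> (\<forall>x\<in>carrier L. x \<noteq> \<bottom>\<^bsub>L\<^esub> \<longrightarrow> (\<exists>y\<in>carrier A. y \<noteq> \<bottom>\<^bsub>L\<^esub> \<and> y \<sqsubseteq>\<^bsub>L\<^esub> x))"


section \<open>Local contact algebras\<close>

record 'a contact_alg = "'a gorder" +
  contact :: "'a \<Rightarrow> 'a \<Rightarrow> bool"

record 'a lca = "'a contact_alg" +
  bdd :: "'a set"

definition strongly_below :: "('a, 'm) contact_alg_scheme \<Rightarrow> 'a \<Rightarrow> 'a \<Rightarrow> bool"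
    (infix \<open>\<lless>\<index>\<close> 50) where
  "a \<lless>\<^bsub>B\<^esub> b \<longleftrightarrow> \<not> contact B a (bcompl B b)"

locale contact_algebra = boolean_lattice B for B (structure) +
  assumes contact_refl: "\<lbrakk>a \<in> carrier B; a \<noteq> \<bottom>\<rbrakk> \<Longrightarrow> contact B a a"
    and contact_nonzero:
      "\<lbrakk>a \<in> carrier B; b \<in> carrier B; contact B a b\<rbrakk> \<Longrightarrow> a \<noteq> \<bottom> \<and> b \<noteq> \<bottom>"
    and contact_sym: "\<lbrakk>a \<in> carrier B; b \<in> carrier B; contact B a b\<rbrakk> \<Longrightarrow> contact B b a"
    and contact_join:
      "\<lbrakk>a \<in> carrier B; b \<in> carrier B; c \<in> carrier B\<rbrakk> \<Longrightarrow>
         contact B a (b \<squnion> c) \<longleftrightarrow> contact B a b \<or> contact B a c"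

locale local_contact_algebra = contact_algebra B for B (structure) +
  assumes bdd_ideal: "lattice_ideal B (bdd B)"
    and BC1: "\<lbrakk>a \<in> bdd B; c \<in> carrier B; a \<lless> c\<rbrakk> \<Longrightarrow> \<exists>b\<in>bdd B. a \<lless> b \<and> b \<lless> c"
    and BC2: "\<lbrakk>a \<in> carrier B; b \<in> carrier B; contact B a b\<rbrakk> \<Longrightarrow> \<exists>c\<in>bdd B. contact B a (c \<sqinter> b)"
    and BC3: "\<lbrakk>a \<in> carrier B; a \<noteq> \<bottom>\<rbrakk> \<Longrightarrow> \<exists>b\<in>bdd B. b \<noteq> \<bottom> \<and> b \<lless> a"

locale complete_local_contact_algebra = local_contact_algebra B + complete_lattice B
  for B (structure)

definition lca_isomorphic :: "('a, 'm) lca_scheme \<Rightarrow> ('b, 'n) lca_scheme \<Rightarrow> bool"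
    (infix \<open>\<cong>\<^sub>L\<^sub>C\<^sub>A\<close> 50) where
  "B \<cong>\<^sub>L\<^sub>C\<^sub>A B' \<longleftrightarrow> (\<exists>\<phi>. bool_iso B B' \<phi>
     \<and> (\<forall>a\<in>carrier B. \<forall>b\<in>carrier B. contact B a b \<longleftrightarrow> contact B' (\<phi> a) (\<phi> b))
     \<and> (\<forall>a\<in>carrier B. a \<in> bdd B \<longleftrightarrow> \<phi> a \<in> bdd B'))"

text \<open>
  Only the inclusion order is given; the lemma \<open>standard_lca_algebra\<close> below computes the resulting
  operations: \<open>F \<squnion> G = F \<union> G\<close>, \<open>F \<sqinter> G = cl (int (F \<inter> G))\<close>, and the complement of \<open>F\<close> is the closure
  of \<open>X - F\<close>.
\<close>

definition standard_lca :: "'x topology \<Rightarrow> 'x set lca" where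
  "standard_lca X =
     \<lparr>carrier = {F. F \<subseteq> topspace X \<and> F = X closure_of (X interior_of F)},
      eq = (=), le = (\<subseteq>),
      contact = (\<lambda>F G. F \<inter> G \<noteq> {}),
      bdd = {F. F \<subseteq> topspace X \<and> F = X closure_of (X interior_of F) \<and> compactin X F}\<rparr>"


section \<open>The construction\<close>

definition Z0 :: "int set" where
  "Z0 = - {0}"

definition zpred :: "int \<Rightarrow> int" where
  "zpred p = (if p = 1 then -1 else p - 1)"

definition zsucc :: "int \<Rightarrow> int" where
  "zsucc p = (if p = -1 then 1 else p + 1)"

definition Succs :: "int \<Rightarrow> int set" where
  "Succs p = {q \<in> Z0. q > p}"

definition Preds :: "int \<Rightarrow> int set" where
  "Preds p = {q \<in> Z0. q < p}"

text \<open>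
  A generator is described by its length \<open>k \<ge> 1\<close> and a sequence \<open>n\<close> of which only the entries
  \<open>n 1, \<dots>, n k\<close> matter.
\<close>

definition admissible :: "nat \<Rightarrow> (nat \<Rightarrow> int) \<Rightarrow> bool" where
  "admissible k n \<longleftrightarrow> 1 \<le> k \<and> (\<forall>i\<in>{1..k}. n i \<in> Z0)"

definition bel :: "('a, 'm) gorder_scheme \<Rightarrow> (nat \<Rightarrow> int set \<Rightarrow> 'a) \<Rightarrow> nat \<Rightarrow> (nat \<Rightarrow> int) \<Rightarrow> 'a" where
  "bel L \<phi> k n = \<Sqinter>\<^bsub>L\<^esub> ((\<lambda>i. \<phi> i {n i}) ` {1..k})"

definition qel ::
    "('a, 'm) gorder_scheme \<Rightarrow> (nat \<Rightarrow> int set \<Rightarrow> 'a) \<Rightarrow> nat \<Rightarrow> (nat \<Rightarrow> int) \<Rightarrow> nat \<Rightarrow> 'a" where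
  "qel L \<phi> k n r =
     (bel L \<phi> k (n(k := zpred (n k))) \<sqinter>\<^bsub>L\<^esub> \<phi> (k + 1) (Succs (int r)))
     \<squnion>\<^bsub>L\<^esub> (bel L \<phi> k n \<sqinter>\<^bsub>L\<^esub> \<phi> (k + 1) (Preds (- int r)))"

definition gens0 :: "('a, 'm) gorder_scheme \<Rightarrow> (nat \<Rightarrow> int set \<Rightarrow> 'a) \<Rightarrow> 'a set" where
  "gens0 L \<phi> = {bel L \<phi> k n | k n. admissible k n}"

definition gens1 :: "('a, 'm) gorder_scheme \<Rightarrow> (nat \<Rightarrow> int set \<Rightarrow> 'a) \<Rightarrow> 'a set" where
  "gens1 L \<phi> = {qel L \<phi> k n r | k n r. admissible k n \<and> 1 \<le> r}"

definition bdd_tilde :: "('a, 'm) gorder_scheme \<Rightarrow> (nat \<Rightarrow> int set \<Rightarrow> 'a) \<Rightarrow> 'a set" where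
  "bdd_tilde L \<phi> = generated_ideal L (gens0 L \<phi> \<union> gens1 L \<phi>)"

definition touch_bb :: "nat \<Rightarrow> (nat \<Rightarrow> int) \<Rightarrow> nat \<Rightarrow> (nat \<Rightarrow> int) \<Rightarrow> bool" where
  "touch_bb k n l n' \<longleftrightarrow> (\<forall>i\<in>{1..<k}. n i = n' i)
     \<and> (if k = l then n' k \<in> {zpred (n k), n k, zsucc (n k)} else n' k = n k)"

definition touch_qq :: "nat \<Rightarrow> (nat \<Rightarrow> int) \<Rightarrow> nat \<Rightarrow> nat \<Rightarrow> (nat \<Rightarrow> int) \<Rightarrow> bool" where
  "touch_qq k n r l n' \<longleftrightarrow> (\<forall>i\<in>{1..<k}. n i = n' i)
     \<and> (if l = k then n' k = n k
        else if l = k + 1 then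
          (n' k = n k \<and> n' (k + 1) \<le> - int r) \<or> (n' k = zpred (n k) \<and> n' (k + 1) > int r)
        else
          (n' k = n k \<and> n' (k + 1) < - int r) \<or> (n' k = zpred (n k) \<and> n' (k + 1) > int r))"

definition touch_qb :: "nat \<Rightarrow> (nat \<Rightarrow> int) \<Rightarrow> nat \<Rightarrow> nat \<Rightarrow> (nat \<Rightarrow> int) \<Rightarrow> bool" where
  "touch_qb k n r l n' \<longleftrightarrow>
     (if k > l then (\<forall>i\<in>{1..l}. n i = n' i)
      else (\<forall>i\<in>{1..<k}. n i = n' i)
        \<and> (if l = k then n' k \<in> {zpred (n k), n k}
           else if l = k + 1 then
             (n' (k + 1) \<ge> int r \<and> n' k = zpred (n k)) \<or> (n' (k + 1) \<le> - int r \<and> n' k = n k)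
           else
             (n' (k + 1) > int r \<and> n' k = zpred (n k)) \<or> (n' (k + 1) < - int r \<and> n' k = n k)))"

text \<open>
  The clauses that define the contact relation. They fix it on the carrier; its values elsewhere
  are irrelevant. That a relation with all these properties exists is not obvious, since
  \<open>clause_bounded\<close> also speaks about the generators.
\<close>

locale sigma_tilde =
  fixes L :: "('a, 'm) gorder_scheme" (structure)
    and \<phi> :: "nat \<Rightarrow> int set \<Rightarrow> 'a"
    and \<sigma> :: "'a \<Rightarrow> 'a \<Rightarrow> bool"
  assumes symmetric: "\<lbrakk>a \<in> carrier L; b \<in> carrier L\<rbrakk> \<Longrightarrow> \<sigma> a b \<longleftrightarrow> \<sigma> b a"
    and clause_bb: "\<lbrakk>admissible k n; admissible l n'; k \<le> l\<rbrakk> \<Longrightarrow>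
        \<sigma> (bel L \<phi> k n) (bel L \<phi> l n') \<longleftrightarrow> touch_bb k n l n'"
    and clause_qq: "\<lbrakk>admissible k n; admissible l n'; 1 \<le> r; 1 \<le> r'; k \<le> l\<rbrakk> \<Longrightarrow>
        \<sigma> (qel L \<phi> k n r) (qel L \<phi> l n' r') \<longleftrightarrow> touch_qq k n r l n'"
    and clause_qb: "\<lbrakk>admissible k n; admissible l n'; 1 \<le> r\<rbrakk> \<Longrightarrow>
        \<sigma> (qel L \<phi> k n r) (bel L \<phi> l n') \<longleftrightarrow> touch_qb k n r l n'"
    and clause_bounded: "\<lbrakk>c \<in> bdd_tilde L \<phi>; d \<in> bdd_tilde L \<phi>\<rbrakk> \<Longrightarrow>
        \<not> \<sigma> c d \<longleftrightarrow>
          (\<exists>C D. finite C \<and> C \<noteq> {} \<and> C \<subseteq> gens0 L \<phi> \<union> gens1 L \<phi>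
             \<and> finite D \<and> D \<noteq> {} \<and> D \<subseteq> gens0 L \<phi> \<union> gens1 L \<phi>
             \<and> c \<sqsubseteq> \<Squnion>C \<and> d \<sqsubseteq> \<Squnion>D \<and> (\<forall>x\<in>C. \<forall>y\<in>D. \<not> \<sigma> x y))"
    and clause_general: "\<lbrakk>a \<in> carrier L; b \<in> carrier L\<rbrakk> \<Longrightarrow>
        \<sigma> a b \<longleftrightarrow>
          (\<exists>c\<in>bdd_tilde L \<phi>. \<exists>d\<in>bdd_tilde L \<phi>. c \<sqsubseteq> a \<and> d \<sqsubseteq> b \<and> \<sigma> c d)"

definition lca_tilde ::
    "('a, 'm) gorder_scheme \<Rightarrow> (nat \<Rightarrow> int set \<Rightarrow> 'a) \<Rightarrow> ('a \<Rightarrow> 'a \<Rightarrow> bool) \<Rightarrow> 'a lca" where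
  "lca_tilde L \<phi> \<sigma> =
     \<lparr>carrier = carrier L, eq = (=), le = le L, contact = \<sigma>, bdd = bdd_tilde L \<phi>\<rparr>"


section \<open>Basic facts about the definitions\<close>

lemma zpred_immediate:
  assumes "p \<in> Z0"
  shows "zpred p \<in> Z0" "zpred p < p" "\<And>q. \<lbrakk>q \<in> Z0; q < p\<rbrakk> \<Longrightarrow> q \<le> zpred p"
  using assms by (auto simp: Z0_def zpred_def)

lemma zsucc_immediate:
  assumes "p \<in> Z0"
  shows "zsucc p \<in> Z0" "p < zsucc p" "\<And>q. \<lbrakk>q \<in> Z0; p < q\<rbrakk> \<Longrightarrow> zsucc p \<le> q"
  using assms by (auto simp: Z0_def zsucc_def)

context partial_order
begin

lemma join_eqI:
  assumes "s \<in> carrier L" "x \<in> carrier L" "y \<in> carrier L" "x \<sqsubseteq> s" "y \<sqsubseteq> s"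
    "\<And>z. \<lbrakk>z \<in> carrier L; x \<sqsubseteq> z; y \<sqsubseteq> z\<rbrakk> \<Longrightarrow> s \<sqsubseteq> z"
  shows "least L s (Upper L {x, y})" "x \<squnion> y = s"
proof -
  show 1: "least L s (Upper L {x, y})"
    using assms by (auto simp: least_def Upper_def)
  show "x \<squnion> y = s"
    unfolding join_def Lattice.sup_def
    using 1 by (rule some1_equality[rotated]) (metis 1 le_antisym least_def subset_iff)
qed

lemma meet_eqI:
  assumes "s \<in> carrier L" "x \<in> carrier L" "y \<in> carrier L" "s \<sqsubseteq> x" "s \<sqsubseteq> y"
    "\<And>z. \<lbrakk>z \<in> carrier L; z \<sqsubseteq> x; z \<sqsubseteq> y\<rbrakk> \<Longrightarrow> z \<sqsubseteq> s"
  shows "greatest L s (Lower L {x, y})" "x \<sqinter> y = s"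
proof -
  show 1: "greatest L s (Lower L {x, y})"
    using assms by (auto simp: greatest_def Lower_def)
  show "x \<sqinter> y = s"
    unfolding meet_def Lattice.inf_def
    using 1 by (rule some1_equality[rotated]) (metis 1 le_antisym greatest_def subset_iff)
qed

end

context boolean_lattice
begin

lemma bcompl_unique:
  assumes "x \<in> carrier L" "y \<in> carrier L" "x \<sqinter> y = \<bottom>" "x \<squnion> y = \<top>"
  shows "bcompl L x = y"
proof -
  have *: "z = z \<sqinter> y'" if "z \<in> carrier L" "x \<sqinter> z = \<bottom>" "y' \<in> carrier L" "x \<squnion> y' = \<top>" for z y'
  proof -
    have "z = z \<sqinter> (x \<squnion> y')"
      using that le_iff_join by auto
    also have "\<dots> = \<bottom> \<squnion> (z \<sqinter> y')"
      using that assms meet_join_distrib[of z x y'] by (metis meet_comm)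
    also have "\<dots> = z \<sqinter> y'"
      using that assms le_iff_meet[of \<bottom> "z \<sqinter> y'"] by simp
    finally show ?thesis .
  qed
  show ?thesis
    unfolding bcompl_def
  proof (rule the_equality)
    fix z assume z: "z \<in> carrier L \<and> x \<sqinter> z = \<bottom> \<and> x \<squnion> z = \<top>"
    show "z = y"
      using *[of z y] *[of y z] z assms by (metis meet_comm)
  qed (use assms in auto)
qed

lemma bcompl_closed [simp]: "x \<in> carrier L \<Longrightarrow> bcompl L x \<in> carrier L"
  and meet_bcompl [simp]: "x \<in> carrier L \<Longrightarrow> x \<sqinter> bcompl L x = \<bottom>"
  and join_bcompl [simp]: "x \<in> carrier L \<Longrightarrow> x \<squnion> bcompl L x = \<top>"
  using complemented bcompl_unique by metis+

end

lemma set_boolean_lattice: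
  fixes L (structure)
  assumes L: "carrier L = C" "eq L = (=)" "le L = (\<subseteq>)"
    and glb: "\<And>x y. \<lbrakk>x \<in> C; y \<in> C\<rbrakk> \<Longrightarrow> m x y \<in> C \<and> m x y \<subseteq> x \<and> m x y \<subseteq> y
                        \<and> (\<forall>z\<in>C. z \<subseteq> x \<longrightarrow> z \<subseteq> y \<longrightarrow> z \<subseteq> m x y)"
    and lub: "\<And>x y. \<lbrakk>x \<in> C; y \<in> C\<rbrakk> \<Longrightarrow> x \<union> y \<in> C"
    and bot: "{} \<in> C"
    and top: "t \<in> C" "\<And>x. x \<in> C \<Longrightarrow> x \<subseteq> t"
    and distrib: "\<And>x y z. \<lbrakk>x \<in> C; y \<in> C; z \<in> C\<rbrakk> \<Longrightarrow> m x (y \<union> z) \<subseteq> m x y \<union> m x z"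
    and compl: "\<And>x. x \<in> C \<Longrightarrow> k x \<in> C \<and> m x (k x) = {} \<and> x \<union> k x = t"
  shows "boolean_lattice L"
    "\<And>x y. \<lbrakk>x \<in> C; y \<in> C\<rbrakk> \<Longrightarrow> x \<sqinter> y = m x y"
    "\<And>x y. \<lbrakk>x \<in> C; y \<in> C\<rbrakk> \<Longrightarrow> x \<squnion> y = x \<union> y"
    "\<bottom> = {}" "\<top> = t"
    "\<And>x. x \<in> C \<Longrightarrow> bcompl L x = k x"
proof -
  interpret partial_order L
    by standard (use L in auto)
  have J: "least L (x \<union> y) (Upper L {x, y})" "x \<squnion> y = x \<union> y" if "x \<in> C" "y \<in> C" for x y
    using join_eqI[of "x \<union> y" x y] that L lub by auto
  have M: "greatest L (m x y) (Lower L {x, y})" "x \<sqinter> y = m x y" if "x \<in> C" "y \<in> C" for x y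
    using meet_eqI[of "m x y" x y] that L glb by auto
  have b: "least L {} (carrier L)" and t: "greatest L t (carrier L)"
    using bot top L by (auto simp: least_def greatest_def)
  interpret bounded_lattice L
  proof
    fix x y assume "x \<in> carrier L" "y \<in> carrier L"
    then have "x \<in> C" "y \<in> C" by (simp_all add: L)
    then show "\<exists>s. least L s (Upper L {x, y})" "\<exists>s. greatest L s (Lower L {x, y})"
      using J(1) M(1) by blast+
  next
    show "\<exists>x. least L x (carrier L)" "\<exists>x. greatest L x (carrier L)"
      using b t by blast+
  qed
  show B: "\<bottom> = {}" and T: "\<top> = t"
    using bottom_eq[of "{}"] top_eq[of t] bot top L by auto
  show "\<And>x y. \<lbrakk>x \<in> C; y \<in> C\<rbrakk> \<Longrightarrow> x \<sqinter> y = m x y"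
    and "\<And>x y. \<lbrakk>x \<in> C; y \<in> C\<rbrakk> \<Longrightarrow> x \<squnion> y = x \<union> y"
    by (simp_all only: J(2) M(2))
  interpret boolean_lattice L
  proof
    fix x y z assume "x \<in> carrier L" "y \<in> carrier L" "z \<in> carrier L"
    then have C: "x \<in> C" "y \<in> C" "z \<in> C" using L by auto
    have "m x y \<subseteq> m x (y \<union> z)" "m x z \<subseteq> m x (y \<union> z)"
      using glb[of x y] glb[of x z] glb[of x "y \<union> z"] lub[of y z] C by (meson le_supI1 le_supI2)+
    then show "x \<sqinter> (y \<squnion> z) = (x \<sqinter> y) \<squnion> (x \<sqinter> z)"
      using distrib[OF C] J(2) M(2) glb[of x y] glb[of x z] lub[of y z] C by (simp add: subset_antisym)
  next
    fix x assume "x \<in> carrier L"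
    then have x: "x \<in> C" by (simp add: L)
    then have "k x \<in> carrier L" "x \<sqinter> k x = \<bottom>" "x \<squnion> k x = \<top>"
      using compl[of x] J(2)[of x "k x"] M(2)[of x "k x"] by (simp_all add: B T L(1))
    then show "\<exists>y\<in>carrier L. x \<sqinter> y = \<bottom> \<and> x \<squnion> y = \<top>"
      by blast
  qed
  show "boolean_lattice L" by unfold_locales
  show "bcompl L x = k x" if "x \<in> C" for x
    using compl[OF that] J(2)[of x "k x"] M(2)[of x "k x"] that by (intro bcompl_unique) (simp_all add: B T L(1))
qed

lemma powerset_algebra:
  shows "boolean_lattice (powerset_algebra Z)"
    "\<And>x y. \<lbrakk>x \<subseteq> Z; y \<subseteq> Z\<rbrakk> \<Longrightarrow> x \<sqinter>\<^bsub>powerset_algebra Z\<^esub> y = x \<inter> y"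
    "\<And>x y. \<lbrakk>x \<subseteq> Z; y \<subseteq> Z\<rbrakk> \<Longrightarrow> x \<squnion>\<^bsub>powerset_algebra Z\<^esub> y = x \<union> y"
    "\<bottom>\<^bsub>powerset_algebra Z\<^esub> = {}" "\<top>\<^bsub>powerset_algebra Z\<^esub> = Z"
    "\<And>x. x \<subseteq> Z \<Longrightarrow> bcompl (powerset_algebra Z) x = Z - x"
proof -
  have L: "carrier (powerset_algebra Z) = Pow Z" "eq (powerset_algebra Z) = (=)"
    "le (powerset_algebra Z) = (\<subseteq>)"
    by (simp_all add: powerset_algebra_def)
  note * = set_boolean_lattice[OF L, of "(\<inter>)" Z "\<lambda>x. Z - x"]
  show "boolean_lattice (powerset_algebra Z)" by (rule *(1)) blast+
  show "x \<sqinter>\<^bsub>powerset_algebra Z\<^esub> y = x \<inter> y" if "x \<subseteq> Z" "y \<subseteq> Z" for x y by (rule *(2)) (use that in blast)+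
  show "x \<squnion>\<^bsub>powerset_algebra Z\<^esub> y = x \<union> y" if "x \<subseteq> Z" "y \<subseteq> Z" for x y by (rule *(3)) (use that in blast)+
  show "\<bottom>\<^bsub>powerset_algebra Z\<^esub> = {}" by (rule *(4)) blast+
  show "\<top>\<^bsub>powerset_algebra Z\<^esub> = Z" by (rule *(5)) blast+
  show "bcompl (powerset_algebra Z) x = Z - x" if "x \<subseteq> Z" for x by (rule *(6)) (use that in blast)+
qed

lemma closure_of_open_regular:
  assumes "openin X U"
  shows "X closure_of (X interior_of (X closure_of U)) = X closure_of U"
proof (rule subset_antisym)
  show "X closure_of (X interior_of (X closure_of U)) \<subseteq> X closure_of U"
    by (simp add: closure_of_minimal interior_of_subset)
  have "U \<subseteq> X interior_of (X closure_of U)"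
    using assms by (simp add: closure_of_subset interior_of_maximal openin_subset)
  then show "X closure_of U \<subseteq> X closure_of (X interior_of (X closure_of U))"
    by (rule closure_of_mono)
qed

context
  fixes X :: "'x topology" and L :: "('x set, 'm) gorder_scheme"
  assumes L: "carrier L = {F. F \<subseteq> topspace X \<and> F = X closure_of (X interior_of F)}"
    "eq L = (=)" "le L = (\<subseteq>)"
begin

lemma regular_closed_algebra:
  shows "boolean_lattice L"
    "\<And>F G. \<lbrakk>F \<in> carrier L; G \<in> carrier L\<rbrakk> \<Longrightarrow> F \<sqinter>\<^bsub>L\<^esub> G = X closure_of (X interior_of (F \<inter> G))"
    "\<And>F G. \<lbrakk>F \<in> carrier L; G \<in> carrier L\<rbrakk> \<Longrightarrow> F \<squnion>\<^bsub>L\<^esub> G = F \<union> G"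
    "\<bottom>\<^bsub>L\<^esub> = {}" "\<top>\<^bsub>L\<^esub> = topspace X"
    "\<And>F. F \<in> carrier L \<Longrightarrow> bcompl L F = X closure_of (topspace X - F)"
proof -
  define RC where "RC = carrier L"
  have RC: "F \<in> RC \<longleftrightarrow> F \<subseteq> topspace X \<and> F = X closure_of (X interior_of F)" for F
    unfolding RC_def L(1) by simp
  have reg: "X closure_of (X interior_of F) = F" and sub: "F \<subseteq> topspace X" if "F \<in> RC" for F
    using that RC by blast+
  have RCI: "F \<in> RC" if "X closure_of (X interior_of F) = F" for F
    using that RC closure_of_subset_topspace[of X] by metis
  have cl: "closedin X F" if "F \<in> RC" for F
    using reg[OF that] closedin_closure_of[of X "X interior_of F"] by simp
  have clint: "X closure_of (X interior_of F) \<subseteq> F" if "closedin X F" for F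
    by (meson closure_of_minimal interior_of_subset that)
  have clopen: "X closure_of U \<in> RC" if "openin X U" for U
    using closure_of_open_regular[OF that] by (rule RCI)
  have mono: "X closure_of (X interior_of F) \<subseteq> X closure_of (X interior_of G)" if "F \<subseteq> G" for F G
    by (simp add: closure_of_mono interior_of_mono that)
  have 1: "X closure_of X interior_of (x \<inter> y) \<in> RC \<and>
           X closure_of X interior_of (x \<inter> y) \<subseteq> x \<and>
           X closure_of X interior_of (x \<inter> y) \<subseteq> y \<and>
           (\<forall>z\<in>RC. z \<subseteq> x \<longrightarrow> z \<subseteq> y \<longrightarrow> z \<subseteq> X closure_of X interior_of (x \<inter> y))"
    if "x \<in> RC" "y \<in> RC" for x y
  proof -
    have "X closure_of X interior_of (x \<inter> y) \<subseteq> x \<inter> y"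
      by (intro clint closedin_Int cl that)
    moreover have "z \<subseteq> X closure_of X interior_of (x \<inter> y)" if "z \<in> RC" "z \<subseteq> x" "z \<subseteq> y" for z
      using mono[of z "x \<inter> y"] reg[OF that(1)] that by simp
    ultimately show ?thesis
      using clopen[OF openin_interior_of] by blast
  qed
  have 2: "x \<union> y \<in> RC" if "x \<in> RC" "y \<in> RC" for x y
  proof -
    have "x \<union> y \<subseteq> X closure_of X interior_of (x \<union> y)"
      using mono[of x "x \<union> y"] mono[of y "x \<union> y"] reg[OF that(1)] reg[OF that(2)] by simp
    then show ?thesis
      using clint[OF closedin_Un[OF cl cl], OF that] by (intro RCI subset_antisym)
  qed
  have 3: "X closure_of X interior_of (x \<inter> (y \<union> z))
           \<subseteq> X closure_of X interior_of (x \<inter> y) \<union> X closure_of X interior_of (x \<inter> z)"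
    if "x \<in> RC" "y \<in> RC" "z \<in> RC" for x y z
  proof -
    let ?W = "X interior_of (x \<inter> (y \<union> z))" and ?K = "X closure_of X interior_of (x \<inter> y)"
    let ?W' = "?W - ?K"
    have W': "openin X ?W'" by (simp add: openin_diff)
    have Wsub: "?W' \<subseteq> x \<inter> (y \<union> z)" using interior_of_subset[of X "x \<inter> (y \<union> z)"] by blast
    have "openin X (?W' - z)" using W' cl that by (simp add: openin_diff)
    then have "?W' - z \<subseteq> X interior_of (x \<inter> y)"
      using Wsub by (intro interior_of_maximal) auto
    also have "\<dots> \<subseteq> ?K"
      by (simp add: closure_of_subset interior_of_subset_topspace)
    finally have "?W' \<subseteq> z" by blast
    then have "?W' \<subseteq> X interior_of (x \<inter> z)"
      using Wsub W' by (intro interior_of_maximal) auto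
    also have "\<dots> \<subseteq> X closure_of X interior_of (x \<inter> z)"
      by (simp add: closure_of_subset interior_of_subset_topspace)
    finally have "?W \<subseteq> ?K \<union> X closure_of X interior_of (x \<inter> z)" by blast
    then show ?thesis
      by (metis closedin_Un closedin_closure_of closure_of_minimal)
  qed
  have 4: "X closure_of (topspace X - x) \<in> RC \<and>
           X closure_of X interior_of (x \<inter> X closure_of (topspace X - x)) = {} \<and>
           x \<union> X closure_of (topspace X - x) = topspace X" if "x \<in> RC" for x
  proof (intro conjI)
    have o: "openin X (topspace X - x)" using cl[OF that] by (rule openin_diff[OF openin_topspace])
    show "X closure_of (topspace X - x) \<in> RC" using clopen o by blast
    have s: "topspace X - x \<subseteq> X closure_of (topspace X - x)"
      by (simp add: closure_of_subset)
    show "x \<union> X closure_of (topspace X - x) = topspace X"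
      using s sub[OF that] closure_of_subset_topspace[of X "topspace X - x"] by blast
    let ?U = "X interior_of (x \<inter> X closure_of (topspace X - x))"
    have "?U \<subseteq> x" "?U \<subseteq> X closure_of (topspace X - x)"
      using interior_of_subset[of X "x \<inter> X closure_of (topspace X - x)"] by auto
    then have "?U = {}"
      by (metis Diff_disjoint inf.absorb_iff1 inf_assoc inf_bot_right openin_Int_closure_of_eq_empty openin_interior_of)
    then show "X closure_of ?U = {}" by simp
  qed
  have T: "topspace X \<in> RC" "{} \<in> RC" "\<And>x. x \<in> RC \<Longrightarrow> x \<subseteq> topspace X"
    by (rule RCI, simp, rule RCI, simp, rule sub)
  have L': "carrier L = RC" "eq L = (=)" "le L = (\<subseteq>)"
    by (simp_all only: RC_def L(2,3))
  note * = set_boolean_lattice[OF L' 1 2 T(2) T(1) T(3) 3 4]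
  show "boolean_lattice L" by (rule *(1))
  show "F \<sqinter>\<^bsub>L\<^esub> G = X closure_of (X interior_of (F \<inter> G))"
    if "F \<in> carrier L" "G \<in> carrier L" for F G by (rule *(2)) (assumption | use that L' in blast)+
  show "F \<squnion>\<^bsub>L\<^esub> G = F \<union> G" if "F \<in> carrier L" "G \<in> carrier L" for F G by (rule *(3)) (assumption | use that L' in blast)+
  show "\<bottom>\<^bsub>L\<^esub> = {}" by (rule *(4))
  show "\<top>\<^bsub>L\<^esub> = topspace X" by (rule *(5))
  show "bcompl L F = X closure_of (topspace X - F)" if "F \<in> carrier L" for F
    by (rule *(6)) (assumption | use that L' in blast)+
qed

lemma regular_closed_complete: "complete_lattice L"
proof -
  interpret boolean_lattice L by (rule regular_closed_algebra)
  show ?thesis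
  proof (rule complete_lattice_criterion1)
    show "\<exists>g. greatest L g (carrier L)" using top_exists .
    fix S assume S: "S \<subseteq> carrier L" "S \<noteq> {}"
    let ?G = "X closure_of X interior_of (\<Inter>S)"
    have "?G \<in> carrier L"
      unfolding L(1) using closure_of_open_regular[of X "X interior_of \<Inter>S"] closure_of_subset_topspace[of X] by simp
    moreover have "?G \<subseteq> F" if "F \<in> S" for F
    proof -
      have "?G \<subseteq> X closure_of X interior_of F"
        using that by (intro closure_of_mono interior_of_mono) auto
      also have "\<dots> = F" using S that unfolding L(1) by blast
      finally show ?thesis .
    qed
    moreover have "H \<subseteq> ?G" if "H \<in> carrier L" "\<forall>F\<in>S. H \<subseteq> F" for H
    proof -
      have "H = X closure_of X interior_of H" using that unfolding L(1) by blast
      also have "\<dots> \<subseteq> ?G"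
        using that by (intro closure_of_mono interior_of_mono) auto
      finally show ?thesis .
    qed
    ultimately have "greatest L ?G (Lower L S)"
      unfolding greatest_def Lower_def L(3) using S by blast
    then show "\<exists>i. greatest L i (Lower L S)" ..
  qed
qed

end

lemma standard_lca_algebra:
  shows "boolean_lattice (standard_lca X)" "complete_lattice (standard_lca X)"
    "\<And>F G. \<lbrakk>F \<in> carrier (standard_lca X); G \<in> carrier (standard_lca X)\<rbrakk> \<Longrightarrow>
        F \<sqinter>\<^bsub>standard_lca X\<^esub> G = X closure_of (X interior_of (F \<inter> G))"
    "\<And>F G. \<lbrakk>F \<in> carrier (standard_lca X); G \<in> carrier (standard_lca X)\<rbrakk> \<Longrightarrow>
        F \<squnion>\<^bsub>standard_lca X\<^esub> G = F \<union> G"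
    "\<bottom>\<^bsub>standard_lca X\<^esub> = {}" "\<top>\<^bsub>standard_lca X\<^esub> = topspace X"
    "\<And>F. F \<in> carrier (standard_lca X) \<Longrightarrow>
        bcompl (standard_lca X) F = X closure_of (topspace X - F)"
proof -
  have L: "carrier (standard_lca X) = {F. F \<subseteq> topspace X \<and> F = X closure_of (X interior_of F)}"
    "eq (standard_lca X) = (=)" "le (standard_lca X) = (\<subseteq>)"
    by (simp_all only: standard_lca_def partial_object.select_convs gorder.select_convs eq_object.select_convs)
  note * = regular_closed_algebra[OF L]
  show "boolean_lattice (standard_lca X)" by (rule *)
  show "complete_lattice (standard_lca X)" by (rule regular_closed_complete[OF L])
  show "F \<sqinter>\<^bsub>standard_lca X\<^esub> G = X closure_of (X interior_of (F \<inter> G))"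
    if "F \<in> carrier (standard_lca X)" "G \<in> carrier (standard_lca X)" for F G by (rule *) fact+
  show "F \<squnion>\<^bsub>standard_lca X\<^esub> G = F \<union> G"
    if "F \<in> carrier (standard_lca X)" "G \<in> carrier (standard_lca X)" for F G by (rule *) fact+
  show "\<bottom>\<^bsub>standard_lca X\<^esub> = {}" "\<top>\<^bsub>standard_lca X\<^esub> = topspace X" by (rule *)+
  show "bcompl (standard_lca X) F = X closure_of (topspace X - F)"
    if "F \<in> carrier (standard_lca X)" for F by (rule *) fact
qed


section \<open>Sums and completions exist\<close>

text \<open>
  A concrete sum of countably many copies of the power set of \<^const>\<open>Z0\<close> is the algebra of finite
  unions of boxes in the product space, and its completion is the algebra of regular closed sets of
  that space. The universal property is proved for target algebras on arbitrary types.
\<close>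

definition ultrafilter :: "('a, 'm) gorder_scheme \<Rightarrow> ('a \<Rightarrow> bool) \<Rightarrow> bool" where
  "ultrafilter L u \<longleftrightarrow> \<not> u \<bottom>\<^bsub>L\<^esub>
     \<and> (\<forall>x\<in>carrier L. u (bcompl L x) \<longleftrightarrow> \<not> u x)
     \<and> (\<forall>x\<in>carrier L. \<forall>y\<in>carrier L. (u (x \<sqinter>\<^bsub>L\<^esub> y) \<longleftrightarrow> u x \<and> u y) \<and> (u (x \<squnion>\<^bsub>L\<^esub> y) \<longleftrightarrow> u x \<or> u y))"

context boolean_lattice
begin

lemma meet_split:
  assumes "x \<in> carrier L" "y \<in> carrier L"
  shows "x = (x \<sqinter> y) \<squnion> (x \<sqinter> bcompl L y)"
proof -
  have "x = x \<sqinter> (y \<squnion> bcompl L y)"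
    using assms le_iff_join[of x \<top>] by simp
  then show ?thesis
    using meet_join_distrib[of x y "bcompl L y"] assms by simp
qed

lemma le_bcompl:
  assumes "x \<in> carrier L" "y \<in> carrier L" "x \<sqinter> y = \<bottom>"
  shows "x \<sqsubseteq> bcompl L y"
proof -
  have "x = x \<sqinter> bcompl L y"
    using meet_split[OF assms(1,2)] assms le_iff_meet[of \<bottom> "x \<sqinter> bcompl L y"] by simp
  then show ?thesis
    using le_iff_join[of x "bcompl L y"] assms by simp
qed

lemma ultrafilter_exists:
  assumes "d \<in> carrier L" "d \<noteq> \<bottom>"
  obtains u where "u d" "ultrafilter L u"
proof -
  define \<F> where "\<F> = {F. F \<subseteq> carrier L \<and> d \<in> F \<and> \<bottom> \<notin> F \<and> (\<forall>x\<in>F. \<forall>y\<in>F. x \<sqinter> y \<in> F)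
      \<and> (\<forall>x\<in>F. \<forall>y\<in>carrier L. x \<sqsubseteq> y \<longrightarrow> y \<in> F)}"
  have "\<exists>M\<in>\<F>. \<forall>F\<in>\<F>. M \<subseteq> F \<longrightarrow> F = M"
  proof (rule subset_Zorn_nonempty)
    define F where "F = {y. y \<in> carrier L \<and> d \<sqsubseteq> y}"
    have F: "y \<in> F \<longleftrightarrow> y \<in> carrier L \<and> d \<sqsubseteq> y" for y
      by (simp add: F_def)
    have "F \<in> \<F>"
      unfolding \<F>_def
    proof (intro CollectI conjI ballI impI)
      show "F \<subseteq> carrier L" "d \<in> F" using F assms by auto
      show "\<bottom> \<notin> F"
        using assms bottom_lower[of d] le_antisym[of d \<bottom>] F by blast
    next
      fix x y assume "x \<in> F" "y \<in> F"
      then show "x \<sqinter> y \<in> F"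
        using meet_le[of d x y] assms F by simp
    next
      fix x y assume "x \<in> F" "y \<in> carrier L" "x \<sqsubseteq> y"
      then show "y \<in> F"
        using le_trans[of d x y] assms F by simp
    qed
    then show "\<F> \<noteq> {}" by blast
  next
    fix C assume C: "C \<noteq> {}" "subset.chain \<F> C"
    have sub: "C \<subseteq> \<F>" and lin: "\<And>F G. \<lbrakk>F \<in> C; G \<in> C\<rbrakk> \<Longrightarrow> F \<subseteq> G \<or> G \<subseteq> F"
      using C(2) unfolding subset.chain_def by blast+
    show "\<Union>C \<in> \<F>"
      unfolding \<F>_def
    proof (intro CollectI conjI ballI impI)
      fix x y assume "x \<in> \<Union>C" "y \<in> \<Union>C"
      then obtain F G where FG: "F \<in> C" "G \<in> C" "x \<in> F" "y \<in> G" by blast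
      then obtain H where "H \<in> C" "x \<in> H" "y \<in> H" using lin[OF FG(1,2)] by blast
      then show "x \<sqinter> y \<in> \<Union>C" using sub unfolding \<F>_def by blast
    qed (use sub C(1) in \<open>unfold \<F>_def; blast\<close>)+
  qed
  then obtain M where M: "M \<in> \<F>" and max: "\<And>F. \<lbrakk>F \<in> \<F>; M \<subseteq> F\<rbrakk> \<Longrightarrow> F = M" by blast
  have Mc: "M \<subseteq> carrier L" and Md: "d \<in> M" and Mb: "\<bottom> \<notin> M"
    and Mm: "\<And>x y. \<lbrakk>x \<in> M; y \<in> M\<rbrakk> \<Longrightarrow> x \<sqinter> y \<in> M"
    and Mu: "\<And>x y. \<lbrakk>x \<in> M; y \<in> carrier L; x \<sqsubseteq> y\<rbrakk> \<Longrightarrow> y \<in> M"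
    using M unfolding \<F>_def by blast+
  have compl1: "bcompl L x \<in> M" if x: "x \<in> carrier L" "x \<notin> M" for x
  proof (rule ccontr)
    assume nc: "bcompl L x \<notin> M"
    define F where "F = {z \<in> carrier L. \<exists>m\<in>M. m \<sqinter> x \<sqsubseteq> z}"
    have "M \<subseteq> F"
      unfolding F_def using Mc x meet_left by blast
    have "F \<in> \<F>"
      unfolding \<F>_def
    proof (intro CollectI conjI ballI impI)
      show "F \<subseteq> carrier L" unfolding F_def by blast
      show "d \<in> F" using Md \<open>M \<subseteq> F\<close> by blast
      show "\<bottom> \<notin> F"
      proof
        assume "\<bottom> \<in> F"
        then obtain m where m: "m \<in> M" "m \<sqinter> x \<sqsubseteq> \<bottom>" unfolding F_def by blast
        then have "m \<in> carrier L" using Mc by blast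
        then have "m \<sqinter> x = \<bottom>"
          using m x le_antisym[of "m \<sqinter> x" \<bottom>] bottom_lower[of "m \<sqinter> x"] by simp
        then have "m \<sqsubseteq> bcompl L x" using le_bcompl x \<open>m \<in> carrier L\<close> by blast
        then show False using nc Mu[OF m(1)] x by simp
      qed
    next
      fix a b assume "a \<in> F" "b \<in> F"
      then obtain m n where mn: "m \<in> M" "n \<in> M" "m \<sqinter> x \<sqsubseteq> a" "n \<sqinter> x \<sqsubseteq> b"
        and ab: "a \<in> carrier L" "b \<in> carrier L"
        unfolding F_def by blast
      have c: "m \<in> carrier L" "n \<in> carrier L" using mn Mc by blast+
      let ?p = "(m \<sqinter> n) \<sqinter> x"
      have p: "?p \<in> carrier L" "?p \<sqsubseteq> m \<sqinter> n" "?p \<sqsubseteq> x" "m \<sqinter> n \<sqsubseteq> m" "m \<sqinter> n \<sqsubseteq> n" "m \<sqinter> n \<in> carrier L"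
        using c x meet_left meet_right by simp_all
      then have "?p \<sqsubseteq> m" "?p \<sqsubseteq> n"
        using le_trans[OF p(2) p(4) p(1) p(6) c(1)] le_trans[OF p(2) p(5) p(1) p(6) c(2)] by simp_all
      then have "?p \<sqsubseteq> m \<sqinter> x" "?p \<sqsubseteq> n \<sqinter> x" using meet_le p c x by simp_all
      then have "?p \<sqsubseteq> a" "?p \<sqsubseteq> b"
        using le_trans[OF _ mn(3) p(1) meet_closed[OF c(1) x(1)] ab(1)]
          le_trans[OF _ mn(4) p(1) meet_closed[OF c(2) x(1)] ab(2)] by simp_all
      then have "?p \<sqsubseteq> a \<sqinter> b" using meet_le p(1) ab by simp
      then show "a \<sqinter> b \<in> F" unfolding F_def using Mm[OF mn(1,2)] meet_closed[OF ab] by blast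
    next
      fix a b assume "a \<in> F" "b \<in> carrier L" "a \<sqsubseteq> b"
      then obtain m where m: "m \<in> M" "m \<sqinter> x \<sqsubseteq> a" "a \<in> carrier L" unfolding F_def by blast
      then have "m \<sqinter> x \<in> carrier L" using Mc x by auto
      then have "m \<sqinter> x \<sqsubseteq> b" using le_trans m \<open>b \<in> carrier L\<close> \<open>a \<sqsubseteq> b\<close> by blast
      then show "b \<in> F" unfolding F_def using m \<open>b \<in> carrier L\<close> by blast
    qed
    then have "F = M" using max \<open>M \<subseteq> F\<close> by blast
    moreover have "x \<in> F" unfolding F_def using Md Mc x meet_right by blast
    ultimately show False using x by blast
  qed
  have compl2: "x \<notin> M" if "x \<in> carrier L" "bcompl L x \<in> M" for x
    using Mm[of x "bcompl L x"] that Mb by auto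
  have compl: "bcompl L x \<in> M \<longleftrightarrow> x \<notin> M" if "x \<in> carrier L" for x
    using compl1 compl2 that by blast
  have meet: "x \<sqinter> y \<in> M \<longleftrightarrow> x \<in> M \<and> y \<in> M" if "x \<in> carrier L" "y \<in> carrier L" for x y
    using Mm[of x y] Mu[of "x \<sqinter> y" x] Mu[of "x \<sqinter> y" y] meet_left[OF that] meet_right[OF that] that by blast
  have join: "x \<squnion> y \<in> M \<longleftrightarrow> x \<in> M \<or> y \<in> M" if xy: "x \<in> carrier L" "y \<in> carrier L" for x y
  proof
    assume j: "x \<squnion> y \<in> M"
    show "x \<in> M \<or> y \<in> M"
    proof (rule ccontr)
      assume n: "\<not> (x \<in> M \<or> y \<in> M)"
      let ?c = "bcompl L y"
      have "(x \<squnion> y) \<sqinter> ?c \<in> M" using meet[of "x \<squnion> y" ?c] compl[of y] n j xy by simp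
      moreover have "(x \<squnion> y) \<sqinter> ?c = (?c \<sqinter> x) \<squnion> (?c \<sqinter> y)"
        using meet_join_distrib[of ?c x y] xy meet_comm[of L "x \<squnion> y" ?c] by simp
      moreover have "?c \<sqinter> y = \<bottom>" using meet_bcompl[of y] xy meet_comm[of L y ?c] by simp
      moreover have "(?c \<sqinter> x) \<squnion> \<bottom> = ?c \<sqinter> x"
        using le_iff_meet[of \<bottom> "?c \<sqinter> x"] xy join_comm[of L \<bottom> "?c \<sqinter> x"] by simp
      ultimately have "?c \<sqinter> x \<in> M" by simp
      then show False using meet[of ?c x] n xy by simp
    qed
  next
    assume "x \<in> M \<or> y \<in> M"
    then show "x \<squnion> y \<in> M"
      using Mu[of x "x \<squnion> y"] Mu[of y "x \<squnion> y"] join_left[OF xy] join_right[OF xy] join_closed[OF xy] by blast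
  qed
  show thesis
    by (rule that[of "\<lambda>x. x \<in> M", OF Md]) (simp add: ultrafilter_def Mb meet join compl)
qed

lemma ultrafilter_separates:
  assumes de: "d \<in> carrier L" "e \<in> carrier L" "d \<noteq> e"
  obtains u where "u d \<longleftrightarrow> \<not> u e" "ultrafilter L u"
proof -
  have le: "x \<sqsubseteq> y" if xy: "x \<in> carrier L" "y \<in> carrier L" "x \<sqinter> bcompl L y = \<bottom>" for x y
  proof -
    have "x \<sqinter> y \<squnion> \<bottom> = x \<sqinter> y"
      using xy le_iff_meet[of \<bottom> "x \<sqinter> y"] join_comm[of L \<bottom> "x \<sqinter> y"] by simp
    then have "x = x \<sqinter> y"
      using meet_split[OF xy(1,2)] xy(3) by metis
    then show ?thesis using le_iff_join[OF xy(1,2)] by blast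
  qed
  have "d \<sqinter> bcompl L e \<noteq> \<bottom> \<or> e \<sqinter> bcompl L d \<noteq> \<bottom>"
    using le[of d e] le[of e d] de le_antisym by blast
  then obtain x y where xy: "{x, y} = {d, e}" "x \<sqinter> bcompl L y \<noteq> \<bottom>" by blast
  then have c: "x \<in> carrier L" "y \<in> carrier L" using de by (metis insertCI insertE singletonD)+
  then have "x \<sqinter> bcompl L y \<in> carrier L" by simp
  from ultrafilter_exists[OF this xy(2)]
  obtain u where u: "u (x \<sqinter> bcompl L y)" "ultrafilter L u" .
  have "u x" "\<not> u y" using u c unfolding ultrafilter_def by auto
  then have "u d \<longleftrightarrow> \<not> u e" using xy(1) by (auto simp: doubleton_eq_iff)
  then show thesis by (rule that[OF _ u(2)])
qed

end

definition seqs :: "(nat \<Rightarrow> int) topology" where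
  "seqs = product_topology (\<lambda>_. discrete_topology Z0) {1..}"

definition cylinder :: "nat \<Rightarrow> int set \<Rightarrow> (nat \<Rightarrow> int) set" where
  "cylinder i S = {x \<in> topspace seqs. x i \<in> S}"

inductive_set cylinder_sets :: "(nat \<Rightarrow> int) set set" where
  cyl: "\<lbrakk>1 \<le> i; S \<subseteq> Z0\<rbrakk> \<Longrightarrow> cylinder i S \<in> cylinder_sets"
| un: "\<lbrakk>x \<in> cylinder_sets; y \<in> cylinder_sets\<rbrakk> \<Longrightarrow> x \<union> y \<in> cylinder_sets"
| int: "\<lbrakk>x \<in> cylinder_sets; y \<in> cylinder_sets\<rbrakk> \<Longrightarrow> x \<inter> y \<in> cylinder_sets"
| co: "x \<in> cylinder_sets \<Longrightarrow> topspace seqs - x \<in> cylinder_sets"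

definition cylinder_algebra :: "(nat \<Rightarrow> int) set gorder" where
  "cylinder_algebra = \<lparr>carrier = cylinder_sets, eq = (=), le = (\<subseteq>)\<rparr>"

lemma topspace_seqs: "topspace seqs = ({1..} \<rightarrow>\<^sub>E Z0)"
  by (simp add: seqs_def)

lemma cylinder_simps:
  assumes "1 \<le> i"
  shows "cylinder i {} = {}" "cylinder i Z0 = topspace seqs"
    "cylinder i (S \<union> T) = cylinder i S \<union> cylinder i T"
    "cylinder i (S \<inter> T) = cylinder i S \<inter> cylinder i T"
    "cylinder i (Z0 - S) = topspace seqs - cylinder i S"
  using assms by (auto simp: cylinder_def topspace_seqs)

lemma cylinder_sets_sub: "x \<in> cylinder_sets \<Longrightarrow> x \<subseteq> topspace seqs"
  by (induction rule: cylinder_sets.induct) (auto simp: cylinder_def)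

lemma cylinder_bot: "{} \<in> cylinder_sets" and cylinder_top: "topspace seqs \<in> cylinder_sets"
  using cylinder_sets.cyl[of 1 "{}"] cylinder_sets.cyl[of 1 Z0] cylinder_simps(1,2)[of 1] by simp_all

lemma cylinder_algebra_carrier: "carrier cylinder_algebra = cylinder_sets"
  "eq cylinder_algebra = (=)" "le cylinder_algebra = (\<subseteq>)"
  by (simp_all add: cylinder_algebra_def)

lemma cylinder_algebra:
  shows "boolean_lattice cylinder_algebra"
    "\<And>x y. \<lbrakk>x \<in> cylinder_sets; y \<in> cylinder_sets\<rbrakk> \<Longrightarrow> x \<sqinter>\<^bsub>cylinder_algebra\<^esub> y = x \<inter> y"
    "\<And>x y. \<lbrakk>x \<in> cylinder_sets; y \<in> cylinder_sets\<rbrakk> \<Longrightarrow> x \<squnion>\<^bsub>cylinder_algebra\<^esub> y = x \<union> y"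
    "\<bottom>\<^bsub>cylinder_algebra\<^esub> = {}" "\<top>\<^bsub>cylinder_algebra\<^esub> = topspace seqs"
    "\<And>x. x \<in> cylinder_sets \<Longrightarrow> bcompl cylinder_algebra x = topspace seqs - x"
proof -
  have glb: "x \<inter> y \<in> cylinder_sets \<and> x \<inter> y \<subseteq> x \<and> x \<inter> y \<subseteq> y
      \<and> (\<forall>z\<in>cylinder_sets. z \<subseteq> x \<longrightarrow> z \<subseteq> y \<longrightarrow> z \<subseteq> x \<inter> y)"
    if "x \<in> cylinder_sets" "y \<in> cylinder_sets" for x y
    using that cylinder_sets.int by blast
  have compl: "topspace seqs - x \<in> cylinder_sets \<and> x \<inter> (topspace seqs - x) = {}
      \<and> x \<union> (topspace seqs - x) = topspace seqs" if "x \<in> cylinder_sets" for x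
    using that cylinder_sets.co cylinder_sets_sub by blast
  have distrib: "x \<inter> (y \<union> z) \<subseteq> x \<inter> y \<union> x \<inter> z" for x y z :: "(nat \<Rightarrow> int) set"
    by blast
  note * = set_boolean_lattice[OF cylinder_algebra_carrier glb cylinder_sets.un cylinder_bot
      cylinder_top cylinder_sets_sub distrib compl]
  show "boolean_lattice cylinder_algebra" by (rule *(1))
  show "x \<sqinter>\<^bsub>cylinder_algebra\<^esub> y = x \<inter> y" if "x \<in> cylinder_sets" "y \<in> cylinder_sets" for x y
    by (rule *(2)) (assumption | fact)+
  show "x \<squnion>\<^bsub>cylinder_algebra\<^esub> y = x \<union> y" if "x \<in> cylinder_sets" "y \<in> cylinder_sets" for x y
    by (rule *(3)) (assumption | fact)+
  show "\<bottom>\<^bsub>cylinder_algebra\<^esub> = {}" by (rule *(4))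
  show "\<top>\<^bsub>cylinder_algebra\<^esub> = topspace seqs" by (rule *(5))
  show "bcompl cylinder_algebra x = topspace seqs - x" if "x \<in> cylinder_sets" for x
    by (rule *(6)) (assumption | fact)+
qed

lemma bool_hom_cylinder:
  assumes "1 \<le> i"
  shows "bool_hom (powerset_algebra Z0) cylinder_algebra (cylinder i)"
proof -
  have c: "carrier (powerset_algebra Z0) = Pow Z0" by (simp add: powerset_algebra_def)
  have m: "cylinder i S \<in> cylinder_sets" if "S \<subseteq> Z0" for S
    using cylinder_sets.cyl assms that by blast
  show ?thesis
    unfolding bool_hom_def c cylinder_algebra_carrier
    by (auto simp: m powerset_algebra cylinder_algebra cylinder_simps[OF assms])
qed

inductive extension ::
    "('d, 'm) gorder_scheme \<Rightarrow> (nat \<Rightarrow> int set \<Rightarrow> 'd) \<Rightarrow> (nat \<Rightarrow> int) set \<Rightarrow> 'd \<Rightarrow> bool"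
  for D :: "('d, 'm) gorder_scheme" and \<psi> where
  cyl: "\<lbrakk>1 \<le> i; S \<subseteq> Z0\<rbrakk> \<Longrightarrow> extension D \<psi> (cylinder i S) (\<psi> i S)"
| un: "\<lbrakk>extension D \<psi> x d; extension D \<psi> y e\<rbrakk> \<Longrightarrow> extension D \<psi> (x \<union> y) (d \<squnion>\<^bsub>D\<^esub> e)"
| int: "\<lbrakk>extension D \<psi> x d; extension D \<psi> y e\<rbrakk> \<Longrightarrow> extension D \<psi> (x \<inter> y) (d \<sqinter>\<^bsub>D\<^esub> e)"
| co: "extension D \<psi> x d \<Longrightarrow> extension D \<psi> (topspace seqs - x) (bcompl D d)"

lemma cylinder_algebra_universal:
  fixes D :: "('d, 'm) gorder_scheme"
  assumes D: "boolean_lattice D"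
    and \<psi>: "\<And>i. 1 \<le> i \<Longrightarrow> bool_hom (powerset_algebra Z0) D (\<psi> i)"
  shows "\<exists>!f. f \<in> extensional (carrier cylinder_algebra) \<and> bool_hom cylinder_algebra D f
    \<and> (\<forall>i\<in>{1..}. \<forall>S\<in>carrier (powerset_algebra Z0). f (cylinder i S) = \<psi> i S)"
proof -
  interpret D: boolean_lattice D by (rule D)
  let ?R = "extension D \<psi>"
  have c: "carrier (powerset_algebra Z0) = Pow Z0" by (simp add: powerset_algebra_def)
  have \<psi>c: "\<psi> i S \<in> carrier D" if "1 \<le> i" "S \<subseteq> Z0" for i S
    using \<psi>[OF that(1)] that(2) unfolding bool_hom_def c by blast
  have \<psi>b: "\<psi> i {} = \<bottom>\<^bsub>D\<^esub>" "\<psi> i Z0 = \<top>\<^bsub>D\<^esub>" if "1 \<le> i" for i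
    using \<psi>[OF that] unfolding bool_hom_def by (simp_all add: powerset_algebra)
  have \<psi>m: "\<psi> i (S \<inter> T) = \<psi> i S \<sqinter>\<^bsub>D\<^esub> \<psi> i T" if "1 \<le> i" "S \<subseteq> Z0" "T \<subseteq> Z0" for i S T
    using \<psi>[OF that(1)] that(2,3) unfolding bool_hom_def c by (simp add: powerset_algebra)
  have \<psi>k: "\<psi> i (Z0 - S) = bcompl D (\<psi> i S)" if "1 \<le> i" "S \<subseteq> Z0" for i S
    using \<psi>[OF that(1)] that(2) unfolding bool_hom_def c by (simp add: powerset_algebra)
  have Rc: "x \<in> cylinder_sets \<and> d \<in> carrier D" if "?R x d" for x d
    using that by induction (auto simp: \<psi>c intro: cylinder_sets.intros)
  have ex: "\<exists>d. ?R x d" if "x \<in> cylinder_sets" for x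
    using that by induction (blast intro: extension.intros)+
  have uniq: "d = e" if R: "?R x d" "?R x e" for x d e
  proof (rule ccontr)
    assume "d \<noteq> e"
    then obtain u where u: "u d \<longleftrightarrow> \<not> u e" "ultrafilter D u"
      using D.ultrafilter_separates Rc R by metis
    define G where "G a \<longleftrightarrow> (\<exists>S. (\<forall>i\<ge>1. S i \<subseteq> Z0 \<and> u (\<psi> i (S i)))
        \<and> {x \<in> topspace seqs. \<forall>i\<ge>1. x i \<in> S i} \<subseteq> a)" for a
    have ub: "\<not> u \<bottom>\<^bsub>D\<^esub>"
      and uk: "\<And>x. x \<in> carrier D \<Longrightarrow> u (bcompl D x) \<longleftrightarrow> \<not> u x"
      and um: "\<And>x y. \<lbrakk>x \<in> carrier D; y \<in> carrier D\<rbrakk> \<Longrightarrow> u (x \<sqinter>\<^bsub>D\<^esub> y) \<longleftrightarrow> u x \<and> u y"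
      and uj: "\<And>x y. \<lbrakk>x \<in> carrier D; y \<in> carrier D\<rbrakk> \<Longrightarrow> u (x \<squnion>\<^bsub>D\<^esub> y) \<longleftrightarrow> u x \<or> u y"
      using u(2) unfolding ultrafilter_def by blast+
    have ut: "u \<top>\<^bsub>D\<^esub>"
      using uk[of "\<bottom>\<^bsub>D\<^esub>"] D.join_bcompl[of "\<bottom>\<^bsub>D\<^esub>"] uj[of "\<bottom>\<^bsub>D\<^esub>" "bcompl D \<bottom>\<^bsub>D\<^esub>"] ub by simp
    have G0: "\<not> G {}"
    proof
      assume "G {}"
      then obtain S where S: "\<And>i. 1 \<le> i \<Longrightarrow> S i \<subseteq> Z0 \<and> u (\<psi> i (S i))"
        and e: "{x \<in> topspace seqs. \<forall>i\<ge>1. x i \<in> S i} \<subseteq> {}"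
        unfolding G_def by blast
      have "S i \<noteq> {}" if "1 \<le> i" for i
        using S[OF that] \<psi>b(1)[OF that] ub by force
      then have sel: "(SOME z. z \<in> S i) \<in> S i" if "1 \<le> i" for i
        using that some_in_eq by blast
      define y where "y = restrict (\<lambda>i. SOME z. z \<in> S i) {1..}"
      have yS: "y i \<in> S i" if "1 \<le> i" for i
        using sel[OF that] that unfolding y_def by simp
      have "y \<in> topspace seqs"
        unfolding topspace_seqs
      proof (rule PiE_I)
        show "y i \<in> Z0" if "i \<in> {1..}" for i
          using yS[of i] S[of i] that by auto
        show "y i = undefined" if "i \<notin> {1..}" for i
          using that unfolding y_def by simp
      qed
      then show False using e yS by blast
    qed
    have Gmono: "G b" if "G a" "a \<subseteq> b" for a b
      using that unfolding G_def by (meson subset_trans)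
    have Gint: "G (a \<inter> b)" if ab: "G a" "G b" for a b
    proof -
      from ab(1) obtain S where S: "\<And>i. 1 \<le> i \<Longrightarrow> S i \<subseteq> Z0 \<and> u (\<psi> i (S i))"
        "{x \<in> topspace seqs. \<forall>i\<ge>1. x i \<in> S i} \<subseteq> a" unfolding G_def by blast
      from ab(2) obtain T where T: "\<And>i. 1 \<le> i \<Longrightarrow> T i \<subseteq> Z0 \<and> u (\<psi> i (T i))"
        "{x \<in> topspace seqs. \<forall>i\<ge>1. x i \<in> T i} \<subseteq> b" unfolding G_def by blast
      show ?thesis
        unfolding G_def
      proof (intro exI[of _ "\<lambda>i. S i \<inter> T i"] conjI allI impI)
        fix i :: nat assume i: "1 \<le> i"
        show "S i \<inter> T i \<subseteq> Z0" using S(1)[OF i] by blast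
        show "u (\<psi> i (S i \<inter> T i))"
          using S(1)[OF i] T(1)[OF i] \<psi>m[OF i] um \<psi>c[OF i] by simp
      qed (use S(2) T(2) in blast)
    qed
    have key: "(u d \<longrightarrow> G x) \<and> (\<not> u d \<longrightarrow> G (topspace seqs - x))" if "?R x d" for x d
      using that
    proof induction
      case (cyl i S)
      have *: "G (cylinder i T)" if T: "T \<subseteq> Z0" "u (\<psi> i T)" for T
        unfolding G_def
      proof (intro exI[of _ "\<lambda>j. if j = i then T else Z0"] conjI allI impI)
        show "{x \<in> topspace seqs. \<forall>j\<ge>1. x j \<in> (if j = i then T else Z0)} \<subseteq> cylinder i T"
          using cyl(1) unfolding cylinder_def by force
      qed (use T \<psi>b ut in auto)
      show ?case
        using *[of S] *[of "Z0 - S"] \<psi>k[OF cyl] uk[OF \<psi>c[OF cyl]] cylinder_simps(5)[OF cyl(1), of S] cyl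
        by auto
    next
      case (un x d y e)
      have "u (d \<squnion>\<^bsub>D\<^esub> e) \<longleftrightarrow> u d \<or> u e" using uj Rc un.hyps by blast
      moreover have "topspace seqs - (x \<union> y) = (topspace seqs - x) \<inter> (topspace seqs - y)" by blast
      ultimately show ?case using un.IH Gint Gmono[of x "x \<union> y"] Gmono[of y "x \<union> y"] by auto
    next
      case (int x d y e)
      have "u (d \<sqinter>\<^bsub>D\<^esub> e) \<longleftrightarrow> u d \<and> u e" using um Rc int.hyps by blast
      moreover have "topspace seqs - x \<subseteq> topspace seqs - (x \<inter> y)"
        "topspace seqs - y \<subseteq> topspace seqs - (x \<inter> y)" by blast+
      ultimately show ?case using int.IH Gint[of x y] Gmono by blast
    next
      case (co x d)
      have "u (bcompl D d) \<longleftrightarrow> \<not> u d" using uk Rc co.hyps by blast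
      moreover have "topspace seqs - (topspace seqs - x) = x"
        using Rc[OF co.hyps] cylinder_sets_sub by blast
      ultimately show ?case using co.IH by auto
    qed
    have "\<not> (G x \<and> G (topspace seqs - x))"
      using Gint[of x "topspace seqs - x"] G0 by (metis Diff_disjoint)
    then show False using key[OF R(1)] key[OF R(2)] u(1) by blast
  qed
  define f where "f = restrict (\<lambda>x. THE d. ?R x d) cylinder_sets"
  have f: "?R x (f x)" if x: "x \<in> cylinder_sets" for x
  proof -
    obtain d where d: "?R x d" using ex x by blast
    then have "(THE d. ?R x d) = d" using uniq by blast
    then show ?thesis using d x unfolding f_def by simp
  qed
  have f_eq: "f x = d" if "?R x d" for x d
    using uniq f Rc that by blast
  have ho: "bool_hom cylinder_algebra D f"
    unfolding bool_hom_def cylinder_algebra_carrier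
  proof (intro conjI ballI)
    show "f \<in> cylinder_sets \<rightarrow> carrier D" using f Rc by blast
    show "f \<bottom>\<^bsub>cylinder_algebra\<^esub> = \<bottom>\<^bsub>D\<^esub>"
      using f_eq[OF extension.cyl[of 1 "{}" D \<psi>]] cylinder_simps(1)[of 1] \<psi>b[of 1] by (simp add: cylinder_algebra)
    show "f \<top>\<^bsub>cylinder_algebra\<^esub> = \<top>\<^bsub>D\<^esub>"
      using f_eq[OF extension.cyl[of 1 Z0 D \<psi>]] cylinder_simps(2)[of 1] \<psi>b[of 1] by (simp add: cylinder_algebra)
  next
    fix x y assume xy: "x \<in> cylinder_sets" "y \<in> cylinder_sets"
    show "f (x \<sqinter>\<^bsub>cylinder_algebra\<^esub> y) = f x \<sqinter>\<^bsub>D\<^esub> f y"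
      using f_eq[OF extension.int[OF f f]] xy by (simp add: cylinder_algebra)
    show "f (x \<squnion>\<^bsub>cylinder_algebra\<^esub> y) = f x \<squnion>\<^bsub>D\<^esub> f y"
      using f_eq[OF extension.un[OF f f]] xy by (simp add: cylinder_algebra)
  next
    fix x assume "x \<in> cylinder_sets"
    then show "f (bcompl cylinder_algebra x) = bcompl D (f x)"
      using f_eq[OF extension.co[OF f]] by (simp add: cylinder_algebra)
  qed
  show ?thesis
  proof (rule ex1I[of _ f])
    show "f \<in> extensional (carrier cylinder_algebra) \<and> bool_hom cylinder_algebra D f
      \<and> (\<forall>i\<in>{1..}. \<forall>S\<in>carrier (powerset_algebra Z0). f (cylinder i S) = \<psi> i S)"
      using ho f_eq[OF extension.cyl] by (simp add: f_def cylinder_algebra_carrier c)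
  next
    fix g assume g: "g \<in> extensional (carrier cylinder_algebra) \<and> bool_hom cylinder_algebra D g
      \<and> (\<forall>i\<in>{1..}. \<forall>S\<in>carrier (powerset_algebra Z0). g (cylinder i S) = \<psi> i S)"
    then have gh: "bool_hom cylinder_algebra D g"
      and gc: "\<And>i S. \<lbrakk>1 \<le> i; S \<subseteq> Z0\<rbrakk> \<Longrightarrow> g (cylinder i S) = \<psi> i S"
      and ge: "g \<in> extensional cylinder_sets"
      unfolding c cylinder_algebra_carrier by auto
    have "?R x (g x)" if "x \<in> cylinder_sets" for x
      using that
    proof induction
      case (cyl i S)
      then show ?case using gc extension.cyl by metis
    next
      case (un x y)
      have "g (x \<union> y) = g x \<squnion>\<^bsub>D\<^esub> g y"
        using gh un.hyps cylinder_algebra(3) unfolding bool_hom_def cylinder_algebra_carrier by metis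
      then show ?case using extension.un un.IH by metis
    next
      case (int x y)
      have "g (x \<inter> y) = g x \<sqinter>\<^bsub>D\<^esub> g y"
        using gh int.hyps cylinder_algebra(2) unfolding bool_hom_def cylinder_algebra_carrier by metis
      then show ?case using extension.int int.IH by metis
    next
      case (co x)
      have "g (topspace seqs - x) = bcompl D (g x)"
        using gh co.hyps cylinder_algebra(6) unfolding bool_hom_def cylinder_algebra_carrier by metis
      then show ?case using extension.co co.IH by metis
    qed
    then have "g x = f x" if "x \<in> cylinder_sets" for x using f_eq that by metis
    moreover have "f \<in> extensional cylinder_sets" unfolding f_def by simp
    ultimately show "g = f" using ge by (metis extensionalityI)
  qed
qed

lemma cylinder_algebra_sum:
  "bool_sum {1..} (\<lambda>i. powerset_algebra Z0) cylinder_algebra cylinder"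
  unfolding bool_sum_def
proof (intro conjI ballI allI impI)
  show "boolean_lattice cylinder_algebra" by (rule cylinder_algebra)
  show "bool_hom (powerset_algebra Z0) cylinder_algebra (cylinder i)" if "i \<in> {1..}" for i
    using bool_hom_cylinder that by simp
  fix D :: "(nat \<Rightarrow> int) set set gorder" and \<psi> :: "nat \<Rightarrow> int set \<Rightarrow> (nat \<Rightarrow> int) set set"
  assume D: "boolean_lattice D \<and> (\<forall>i\<in>{1..}. bool_hom (powerset_algebra Z0) D (\<psi> i))"
  show "\<exists>!f. f \<in> extensional (carrier cylinder_algebra) \<and> bool_hom cylinder_algebra D f
      \<and> (\<forall>i\<in>{1..}. \<forall>S\<in>carrier (powerset_algebra Z0). f (cylinder i S) = \<psi> i S)"
    by (rule cylinder_algebra_universal) (use D in auto)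
qed

definition regular_closed_sets :: "'x topology \<Rightarrow> 'x set gorder" where
  "regular_closed_sets X =
     \<lparr>carrier = {F. F \<subseteq> topspace X \<and> F = X closure_of (X interior_of F)}, eq = (=), le = (\<subseteq>)\<rparr>"

lemma cylinder_sets_clopen:
  assumes "x \<in> cylinder_sets"
  shows "openin seqs x" "closedin seqs x"
proof -
  have "openin seqs x \<and> closedin seqs x"
    using assms
  proof induction
    case (cyl i S)
    have "cylinder j T = {x \<in> topspace seqs. (\<lambda>x. x j) x \<in> T}" for j T
      by (simp add: cylinder_def)
    moreover have "openin seqs (cylinder i T)" if "T \<subseteq> Z0" for T
    proof -
      have "continuous_map seqs (discrete_topology Z0) (\<lambda>x. x i)"
        unfolding seqs_def using cyl by (intro continuous_map_product_projection) simp
      then show ?thesis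
        unfolding cylinder_def using that openin_continuous_map_preimage[of seqs "discrete_topology Z0" "\<lambda>x. x i" T]
        by simp
    qed
    from this[of S] this[of "Z0 - S"] show ?case
      using cyl cylinder_simps(5)[OF cyl(1), of S] by (auto simp: closedin_def cylinder_def)
  qed (auto simp: openin_diff closedin_diff)
  then show "openin seqs x" "closedin seqs x" by blast+
qed

lemma cylinder_algebra_completion:
  "bool_completion cylinder_algebra (regular_closed_sets seqs)"
proof -
  let ?L = "regular_closed_sets seqs"
  have L: "carrier ?L = {F. F \<subseteq> topspace seqs \<and> F = seqs closure_of (seqs interior_of F)}"
    "eq ?L = (=)" "le ?L = (\<subseteq>)"
    unfolding regular_closed_sets_def by simp_all
  have fixd: "seqs closure_of (seqs interior_of x) = x" "seqs closure_of x = x" if "x \<in> cylinder_sets" for x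
    using cylinder_sets_clopen[OF that] by (simp_all add: interior_of_openin closure_of_closedin)
  have sub: "cylinder_sets \<subseteq> carrier ?L"
    unfolding L(1) using fixd(1) cylinder_sets_sub by blast
  note L_ops = regular_closed_algebra[OF L]
  have ho: "bool_hom cylinder_algebra ?L (\<lambda>x. x)"
    unfolding bool_hom_def cylinder_algebra_carrier
  proof (intro conjI ballI)
    show "(\<lambda>x. x) \<in> cylinder_sets \<rightarrow> carrier ?L" using sub by blast
    show "\<bottom>\<^bsub>cylinder_algebra\<^esub> = \<bottom>\<^bsub>?L\<^esub>" "\<top>\<^bsub>cylinder_algebra\<^esub> = \<top>\<^bsub>?L\<^esub>"
      by (simp_all add: L_ops cylinder_algebra)
  next
    fix x y assume xy: "x \<in> cylinder_sets" "y \<in> cylinder_sets"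
    then have c: "x \<in> carrier ?L" "y \<in> carrier ?L" using sub by blast+
    show "x \<sqinter>\<^bsub>cylinder_algebra\<^esub> y = x \<sqinter>\<^bsub>?L\<^esub> y"
      using fixd(1)[OF cylinder_sets.int[OF xy]] by (simp add: L_ops(2)[OF c] cylinder_algebra(2)[OF xy])
    show "x \<squnion>\<^bsub>cylinder_algebra\<^esub> y = x \<squnion>\<^bsub>?L\<^esub> y"
      by (simp add: L_ops(3)[OF c] cylinder_algebra(3)[OF xy])
  next
    fix x assume x: "x \<in> cylinder_sets"
    then have c: "x \<in> carrier ?L" using sub by blast
    show "bcompl cylinder_algebra x = bcompl ?L x"
      using fixd(2)[OF cylinder_sets.co[OF x]] by (simp add: L_ops(6)[OF c] cylinder_algebra(6)[OF x])
  qed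
  have dense: "\<exists>y\<in>cylinder_sets. y \<noteq> {} \<and> y \<subseteq> F" if F: "F \<in> carrier ?L" "F \<noteq> {}" for F
  proof -
    have reg: "F = seqs closure_of (seqs interior_of F)" using F(1) unfolding L(1) by blast
    have "seqs interior_of F \<noteq> {}"
    proof
      assume "seqs interior_of F = {}"
      then have "F = {}" using reg by simp
      then show False using F(2) by blast
    qed
    then obtain x where x: "x \<in> seqs interior_of F" by blast
    moreover have "openin seqs (seqs interior_of F)" by simp
    ultimately obtain U where U: "finite {i \<in> {1..}. U i \<noteq> topspace (discrete_topology Z0)}"
      "\<And>i. i \<in> {1..} \<Longrightarrow> openin (discrete_topology Z0) (U i)" "x \<in> PiE {1..} U"
      "PiE {1..} U \<subseteq> seqs interior_of F"
      unfolding seqs_def openin_product_topology_alt by meson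
    have box: "{y \<in> topspace seqs. \<forall>i\<in>J. y i \<in> U i} \<in> cylinder_sets" if "finite J" "J \<subseteq> {1..}" for J
      using that
    proof (induction J)
      case empty
      then show ?case using cylinder_top by simp
    next
      case (insert j J)
      have "{y \<in> topspace seqs. \<forall>i\<in>insert j J. y i \<in> U i}
          = cylinder j (U j) \<inter> {y \<in> topspace seqs. \<forall>i\<in>J. y i \<in> U i}"
        by (auto simp: cylinder_def)
      moreover have "cylinder j (U j) \<in> cylinder_sets"
        using insert.prems U(2)[of j] by (intro cylinder_sets.cyl) auto
      moreover have "{y \<in> topspace seqs. \<forall>i\<in>J. y i \<in> U i} \<in> cylinder_sets"
        using insert.IH insert.prems by blast
      ultimately show ?case by (simp only: cylinder_sets.int)
    qed
    define J where "J = {i \<in> {1..}. U i \<noteq> Z0}"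
    have "PiE {1..} U = {y \<in> topspace seqs. \<forall>i\<in>J. y i \<in> U i}"
    proof (intro equalityI subsetI CollectI conjI)
      fix y assume y: "y \<in> PiE {1..} U"
      then show "y \<in> topspace seqs"
        using U(2) unfolding topspace_seqs PiE_iff openin_discrete_topology by blast
      show "\<forall>i\<in>J. y i \<in> U i" using y unfolding J_def by auto
    next
      fix y assume "y \<in> {y \<in> topspace seqs. \<forall>i\<in>J. y i \<in> U i}"
      then show "y \<in> PiE {1..} U"
        unfolding topspace_seqs J_def PiE_iff by blast
    qed
    moreover have "finite J" using U(1) unfolding J_def by simp
    moreover have "J \<subseteq> {1..}" unfolding J_def by blast
    ultimately have "PiE {1..} U \<in> cylinder_sets" using box[of J] by simp
    moreover have "PiE {1..} U \<subseteq> F"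
      by (rule subset_trans[OF U(4) interior_of_subset])
    moreover have "PiE {1..} U \<noteq> {}" using U(3) by force
    ultimately show ?thesis by (intro bexI[of _ "PiE {1..} U"] conjI)
  qed
  show ?thesis
    unfolding bool_completion_def cylinder_algebra_carrier L_ops(4) L(3)
    using cylinder_algebra(1) L_ops(1) regular_closed_complete[OF L] sub ho dense by blast
qed

lemma sum_and_completion_exist:
  "\<exists>(A :: (nat \<Rightarrow> int) set gorder) (L :: (nat \<Rightarrow> int) set gorder) (\<phi> :: nat \<Rightarrow> _).
     bool_sum {1..} (\<lambda>i. powerset_algebra Z0) A \<phi> \<and> bool_completion A L"
  using cylinder_algebra_sum cylinder_algebra_completion by blast

end

theory Submission
  imports Defs
begin

text \<open>
  The real line is cut at the integers into intervals labelled by \<^const>\<open>Z0\<close>, and each interval is cut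
  again, by a sequence of points of order type of the integers that accumulates at both of its ends,
  and so on. A finite sequence \<open>n 1, \<dots>, n k\<close> of labels names a compact interval, its cell. The generator
  \<open>bel At \<phi> k n\<close> is the algebraic name of that cell, and \<open>qel At \<phi> k n r\<close> that of a small interval around
  its left endpoint, here called a collar. The clauses for the contact relation on generators say
  exactly when cells and collars intersect (\<open>cells_meet_iff\<close>, \<open>collars_meet_iff\<close>,
  \<open>collar_meets_cell_iff\<close>).

  The algebras agree because both have a dense family indexed by the label sequences: the generators
  \<open>bel\<close> are dense in the sum, hence in its completion (\<open>bel_dense\<close>), and every nonempty open set of
  the line contains a cell (\<open>deep_cell_in_open\<close>). In both algebras two members are disjoint if and only
  if their labels differ at a common position, and complete Boolean algebras with dense families of
  the same disjointness pattern are isomorphic (\<open>dense_families_bool_iso\<close>).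

  Under this isomorphism \<open>h\<close> the ideal becomes the compact regular closed sets. The relation "\<open>h a\<close> and \<open>h b\<close>
  intersect" satisfies all clauses (\<open>sigma_tilde_real_contact\<close>); the one for bounded elements
  holds since cells and collars form a neighbourhood base of the line, so that disjoint compact sets
  have disjoint finite covers by such intervals. As the clauses leave no choice
  (\<open>sigma_tilde_unique\<close>), every relation that satisfies them is this one on the algebra, and the axioms
  transfer from the regular closed sets of the line (\<open>standard_lca_complete\<close>).

  Finally, a locally compact Hausdorff space is determined by its local contact algebra
  (\<open>standard_lca_determines_space\<close>): its points can be recovered from their compact regular closed
  neighbourhoods.
\<close>

section \<open>Isomorphisms of Boolean algebras from dense families\<close>

context boolean_lattice
begin

lemma meet_eq_bottom_mono:
  assumes "x \<sqsubseteq> x'" "x' \<sqinter> y = \<bottom>" "x \<in> carrier L" "x' \<in> carrier L" "y \<in> carrier L"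
  shows "x \<sqinter> y = \<bottom>"
proof -
  have "x \<sqinter> y \<sqsubseteq> x' \<sqinter> y"
    using assms meet_le[of "x \<sqinter> y" x' y] le_trans[of "x \<sqinter> y" x x'] meet_left[of x y] meet_right[of x y] by simp
  then show ?thesis
    using assms le_antisym[of "x \<sqinter> y" \<bottom>] by simp
qed

lemma le_iff_meet_bcompl:
  assumes "x \<in> carrier L" "y \<in> carrier L"
  shows "x \<sqsubseteq> y \<longleftrightarrow> x \<sqinter> bcompl L y = \<bottom>"
proof
  assume "x \<sqsubseteq> y"
  then show "x \<sqinter> bcompl L y = \<bottom>"
    using meet_eq_bottom_mono[of x y "bcompl L y"] assms by simp
next
  assume b: "x \<sqinter> bcompl L y = \<bottom>"
  have "x \<sqinter> y \<squnion> \<bottom> = x \<sqinter> y"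
    using assms le_iff_meet[of \<bottom> "x \<sqinter> y"] join_comm[of L \<bottom> "x \<sqinter> y"] by simp
  then have "x = x \<sqinter> y"
    using meet_split[OF assms] b by metis
  then show "x \<sqsubseteq> y" using le_iff_join[OF assms] by blast
qed

lemma bottom_join_eq: "x \<in> carrier L \<Longrightarrow> \<bottom> \<squnion> x = x"
  using le_iff_meet[of \<bottom> x] by simp

lemma le_bottom_iff: "x \<in> carrier L \<Longrightarrow> x \<sqsubseteq> \<bottom> \<longleftrightarrow> x = \<bottom>"
  using le_antisym[of x \<bottom>] by auto

end

lemma bool_iso_order_iso:
  assumes "boolean_lattice L" "boolean_lattice M" "bool_iso L M h" "x \<in> carrier L" "y \<in> carrier L"
  shows "h x \<sqsubseteq>\<^bsub>M\<^esub> h y \<longleftrightarrow> x \<sqsubseteq>\<^bsub>L\<^esub> y"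
proof -
  interpret L: boolean_lattice L by fact
  interpret M: boolean_lattice M by fact
  have h: "h x \<in> carrier M" "h y \<in> carrier M" "h (x \<sqinter>\<^bsub>L\<^esub> y) = h x \<sqinter>\<^bsub>M\<^esub> h y" "inj_on h (carrier L)"
    using assms(3-5) by (auto simp: bool_iso_def bool_hom_def bij_betw_def)
  have "h x \<sqsubseteq>\<^bsub>M\<^esub> h y \<longleftrightarrow> h x = h (x \<sqinter>\<^bsub>L\<^esub> y)"
    using M.le_iff_join[OF h(1,2)] h(3) by metis
  also have "\<dots> \<longleftrightarrow> x = x \<sqinter>\<^bsub>L\<^esub> y"
    using inj_on_eq_iff[OF h(4), of x "x \<sqinter>\<^bsub>L\<^esub> y"] assms(4,5) by simp
  also have "\<dots> \<longleftrightarrow> x \<sqsubseteq>\<^bsub>L\<^esub> y"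
    using L.le_iff_join[OF assms(4,5)] by metis
  finally show ?thesis .
qed

lemma order_iso_bool_iso:
  assumes "boolean_lattice L" "boolean_lattice M" and bij: "bij_betw h (carrier L) (carrier M)"
    and ord: "\<And>x y. \<lbrakk>x \<in> carrier L; y \<in> carrier L\<rbrakk> \<Longrightarrow> h x \<sqsubseteq>\<^bsub>M\<^esub> h y \<longleftrightarrow> x \<sqsubseteq>\<^bsub>L\<^esub> y"
  shows "bool_iso L M h"
proof -
  interpret L: boolean_lattice L by fact
  interpret M: boolean_lattice M by fact
  have h: "h x \<in> carrier M" if "x \<in> carrier L" for x
    using bij that by (auto simp: bij_betw_def)
  have surj: "\<exists>x\<in>carrier L. z = h x" if "z \<in> carrier M" for z
    using bij that by (auto simp: bij_betw_def)
  have meet: "h (x \<sqinter>\<^bsub>L\<^esub> y) = h x \<sqinter>\<^bsub>M\<^esub> h y" if xy: "x \<in> carrier L" "y \<in> carrier L" for x y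
  proof (rule sym, rule M.meet_eqI(2))
    fix z assume z: "z \<in> carrier M" "z \<sqsubseteq>\<^bsub>M\<^esub> h x" "z \<sqsubseteq>\<^bsub>M\<^esub> h y"
    then obtain w where w: "w \<in> carrier L" "z = h w" using surj by blast
    then show "z \<sqsubseteq>\<^bsub>M\<^esub> h (x \<sqinter>\<^bsub>L\<^esub> y)"
      using z ord L.meet_le[of w x y] xy by simp
  qed (use xy h ord L.meet_left L.meet_right in auto)
  have join: "h (x \<squnion>\<^bsub>L\<^esub> y) = h x \<squnion>\<^bsub>M\<^esub> h y" if xy: "x \<in> carrier L" "y \<in> carrier L" for x y
  proof (rule sym, rule M.join_eqI(2))
    fix z assume z: "z \<in> carrier M" "h x \<sqsubseteq>\<^bsub>M\<^esub> z" "h y \<sqsubseteq>\<^bsub>M\<^esub> z"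
    then obtain w where w: "w \<in> carrier L" "z = h w" using surj by blast
    then show "h (x \<squnion>\<^bsub>L\<^esub> y) \<sqsubseteq>\<^bsub>M\<^esub> z"
      using z ord L.join_le[of x w y] xy by simp
  qed (use xy h ord L.join_left L.join_right in auto)
  have bot: "h \<bottom>\<^bsub>L\<^esub> = \<bottom>\<^bsub>M\<^esub>"
    by (rule M.bottom_eq) (metis surj ord L.bottom_lower L.bottom_closed h)+
  have top: "h \<top>\<^bsub>L\<^esub> = \<top>\<^bsub>M\<^esub>"
    by (rule M.top_eq) (metis surj ord L.top_higher L.top_closed h)+
  have compl: "h (bcompl L x) = bcompl M (h x)" if x: "x \<in> carrier L" for x
    using x h meet[of x "bcompl L x"] join[of x "bcompl L x"] bot top
    by (intro sym[OF M.bcompl_unique]) simp_all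
  show ?thesis
    unfolding bool_iso_def bool_hom_def using h meet join bot top compl bij by blast
qed

definition dense_family :: "('a, 'm) gorder_scheme \<Rightarrow> 't set \<Rightarrow> ('t \<Rightarrow> 'a) \<Rightarrow> bool" where
  "dense_family L T d \<longleftrightarrow> (\<forall>t\<in>T. d t \<in> carrier L \<and> d t \<noteq> \<bottom>\<^bsub>L\<^esub>)
     \<and> (\<forall>x\<in>carrier L. x \<noteq> \<bottom>\<^bsub>L\<^esub> \<longrightarrow> (\<exists>t\<in>T. d t \<sqsubseteq>\<^bsub>L\<^esub> x))"

text \<open>
  If \<open>x\<close> is not below \<open>y\<close>, some member of the family lies below \<open>x\<close> minus \<open>y\<close>. So an element is
  determined by the members of the family that it misses.
\<close>

lemma (in boolean_lattice) le_iff_dense_family: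
  assumes d: "dense_family L T d" and xy: "x \<in> carrier L" "y \<in> carrier L"
  shows "x \<sqsubseteq> y \<longleftrightarrow> (\<forall>t\<in>T. d t \<sqinter> y = \<bottom> \<longrightarrow> d t \<sqinter> x = \<bottom>)"
proof
  assume "x \<sqsubseteq> y"
  then show "\<forall>t\<in>T. d t \<sqinter> y = \<bottom> \<longrightarrow> d t \<sqinter> x = \<bottom>"
    using meet_eq_bottom_mono[of x y] xy d meet_comm[of L] unfolding dense_family_def by metis
next
  assume miss: "\<forall>t\<in>T. d t \<sqinter> y = \<bottom> \<longrightarrow> d t \<sqinter> x = \<bottom>"
  show "x \<sqsubseteq> y"
  proof (rule ccontr)
    let ?z = "x \<sqinter> bcompl L y"
    assume "\<not> x \<sqsubseteq> y"
    then have "?z \<noteq> \<bottom>" using le_iff_meet_bcompl[OF xy] by blast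
    then obtain t where t: "t \<in> T" "d t \<sqsubseteq> ?z" "d t \<in> carrier L" "d t \<noteq> \<bottom>"
      using d xy unfolding dense_family_def by (metis bcompl_closed meet_closed)
    have "d t \<sqsubseteq> x" "d t \<sqsubseteq> bcompl L y"
      using t xy le_trans[of "d t" ?z] meet_left[of x "bcompl L y"] meet_right[of x "bcompl L y"] by simp_all
    then have "d t \<sqinter> x = d t" "d t \<sqinter> y = \<bottom>"
      using t xy le_iff_join[of "d t" x] meet_eq_bottom_mono[of "d t" "bcompl L y" y] meet_comm[of L y "bcompl L y"]
      by auto
    then show False using miss t by auto
  qed
qed

text \<open>
  The partner of \<open>a\<close> is the complement of the join of all \<open>e t\<close> that it has to miss. That it
  misses no others uses density twice: a member \<open>d u\<close> below both \<open>d s\<close> and \<open>a\<close> makes \<open>e u\<close> disjoint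
  from that join.
\<close>

lemma dense_families_partner:
  assumes "boolean_lattice L" "boolean_lattice M" "complete_lattice M"
    and d: "dense_family L T d" and e: "dense_family M T e"
    and de: "\<And>s t. \<lbrakk>s \<in> T; t \<in> T\<rbrakk> \<Longrightarrow> d s \<sqinter>\<^bsub>L\<^esub> d t = \<bottom>\<^bsub>L\<^esub> \<longleftrightarrow> e s \<sqinter>\<^bsub>M\<^esub> e t = \<bottom>\<^bsub>M\<^esub>"
    and a: "a \<in> carrier L"
  shows "\<exists>b\<in>carrier M. \<forall>t\<in>T. d t \<sqinter>\<^bsub>L\<^esub> a = \<bottom>\<^bsub>L\<^esub> \<longleftrightarrow> e t \<sqinter>\<^bsub>M\<^esub> b = \<bottom>\<^bsub>M\<^esub>"
proof -
  interpret L: boolean_lattice L by fact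
  interpret M: boolean_lattice M by fact
  interpret Mc: complete_lattice M by fact
  have dc: "d t \<in> carrier L" "d t \<noteq> \<bottom>\<^bsub>L\<^esub>" and ec: "e t \<in> carrier M" "e t \<noteq> \<bottom>\<^bsub>M\<^esub>" if "t \<in> T" for t
    using d e that unfolding dense_family_def by blast+
  define E where "E = {e t | t. t \<in> T \<and> d t \<sqinter>\<^bsub>L\<^esub> a = \<bottom>\<^bsub>L\<^esub>}"
  have E: "E \<subseteq> carrier M" using ec unfolding E_def by blast
  let ?j = "\<Squnion>\<^bsub>M\<^esub> E"
  have j: "?j \<in> carrier M" using E by simp
  have "d s \<sqinter>\<^bsub>L\<^esub> a = \<bottom>\<^bsub>L\<^esub> \<longleftrightarrow> e s \<sqsubseteq>\<^bsub>M\<^esub> ?j" if s: "s \<in> T" for s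
  proof
    assume "d s \<sqinter>\<^bsub>L\<^esub> a = \<bottom>\<^bsub>L\<^esub>"
    then have "e s \<in> E" using s unfolding E_def by blast
    then show "e s \<sqsubseteq>\<^bsub>M\<^esub> ?j" using E Mc.sup_upper by blast
  next
    assume le: "e s \<sqsubseteq>\<^bsub>M\<^esub> ?j"
    show "d s \<sqinter>\<^bsub>L\<^esub> a = \<bottom>\<^bsub>L\<^esub>"
    proof (rule ccontr)
      assume "d s \<sqinter>\<^bsub>L\<^esub> a \<noteq> \<bottom>\<^bsub>L\<^esub>"
      moreover have "d s \<sqinter>\<^bsub>L\<^esub> a \<in> carrier L" using dc s a by simp
      ultimately obtain u where u: "u \<in> T" "d u \<sqsubseteq>\<^bsub>L\<^esub> d s \<sqinter>\<^bsub>L\<^esub> a"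
        using d unfolding dense_family_def by blast
      have us: "d u \<sqsubseteq>\<^bsub>L\<^esub> d s" and ua: "d u \<sqsubseteq>\<^bsub>L\<^esub> a"
        using u dc s a L.le_trans[of "d u" "d s \<sqinter>\<^bsub>L\<^esub> a"] L.meet_left[of "d s" a] L.meet_right[of "d s" a]
        by simp_all
      have "e t \<sqinter>\<^bsub>M\<^esub> e u = \<bottom>\<^bsub>M\<^esub>" if "t \<in> T" "e t \<sqinter>\<^bsub>M\<^esub> e s = \<bottom>\<^bsub>M\<^esub>" for t
      proof -
        have "d s \<sqinter>\<^bsub>L\<^esub> d t = \<bottom>\<^bsub>L\<^esub>" using de[OF s that(1)] that(2) meet_comm[of M "e t" "e s"] by simp
        then have "d u \<sqinter>\<^bsub>L\<^esub> d t = \<bottom>\<^bsub>L\<^esub>"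
          using L.meet_eq_bottom_mono[OF us _ dc(1)[OF u(1)] dc(1)[OF s] dc(1)[OF that(1)]] by blast
        then show ?thesis using de[OF u(1) that(1)] meet_comm[of M "e t" "e u"] by simp
      qed
      then have "e u \<sqsubseteq>\<^bsub>M\<^esub> e s"
        unfolding M.le_iff_dense_family[OF e ec(1)[OF u(1)] ec(1)[OF s]] by simp
      then have uj: "e u \<sqsubseteq>\<^bsub>M\<^esub> ?j"
        using M.le_trans[OF _ le ec(1)[OF u(1)] ec(1)[OF s] j] by simp
      have "x \<sqsubseteq>\<^bsub>M\<^esub> bcompl M (e u)" if "x \<in> E" for x
      proof -
        obtain t where t: "t \<in> T" "x = e t" "d t \<sqinter>\<^bsub>L\<^esub> a = \<bottom>\<^bsub>L\<^esub>" using \<open>x \<in> E\<close> E_def by blast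
        then have "d u \<sqinter>\<^bsub>L\<^esub> d t = \<bottom>\<^bsub>L\<^esub>"
          using L.meet_eq_bottom_mono[OF ua, of "d t"] meet_comm[of L] dc u a by metis
        then have "e t \<sqinter>\<^bsub>M\<^esub> e u = \<bottom>\<^bsub>M\<^esub>" using de u t meet_comm[of M] by metis
        then show ?thesis using M.le_bcompl ec t u by simp
      qed
      then have "?j \<sqsubseteq>\<^bsub>M\<^esub> bcompl M (e u)"
        using ec u by (intro Mc.sup_least[OF E]) simp_all
      then have "?j \<sqinter>\<^bsub>M\<^esub> e u = \<bottom>\<^bsub>M\<^esub>"
        using M.meet_eq_bottom_mono[of ?j "bcompl M (e u)" "e u"] j ec u meet_comm[of M "e u" "bcompl M (e u)"] by simp
      then have "e u \<sqinter>\<^bsub>M\<^esub> e u = \<bottom>\<^bsub>M\<^esub>"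
        using M.meet_eq_bottom_mono[OF uj, of "e u"] j ec u by simp
      then show False
        using M.le_iff_join[of "e u" "e u"] ec u by simp
    qed
  qed
  moreover have "e s \<sqsubseteq>\<^bsub>M\<^esub> ?j \<longleftrightarrow> e s \<sqinter>\<^bsub>M\<^esub> bcompl M ?j = \<bottom>\<^bsub>M\<^esub>" if "s \<in> T" for s
    using M.le_iff_meet_bcompl[OF ec(1)[OF that] j] .
  ultimately show ?thesis
    using j by (intro bexI[of _ "bcompl M ?j"]) auto
qed

text \<open>
  Missing corresponding members is a relation between the two algebras. It is total on both sides
  and carries the order over, so it is the graph of an isomorphism.
\<close>

theorem dense_families_bool_iso:
  assumes "boolean_lattice L" "complete_lattice L" "boolean_lattice M" "complete_lattice M"
    and d: "dense_family L T d" and e: "dense_family M T e"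
    and de: "\<And>s t. \<lbrakk>s \<in> T; t \<in> T\<rbrakk> \<Longrightarrow> d s \<sqinter>\<^bsub>L\<^esub> d t = \<bottom>\<^bsub>L\<^esub> \<longleftrightarrow> e s \<sqinter>\<^bsub>M\<^esub> e t = \<bottom>\<^bsub>M\<^esub>"
  obtains h where "bool_iso L M h" "\<And>t. t \<in> T \<Longrightarrow> h (d t) = e t"
proof -
  interpret L: boolean_lattice L by fact
  interpret M: boolean_lattice M by fact
  define R where "R a b \<longleftrightarrow> (\<forall>t\<in>T. d t \<sqinter>\<^bsub>L\<^esub> a = \<bottom>\<^bsub>L\<^esub> \<longleftrightarrow> e t \<sqinter>\<^bsub>M\<^esub> b = \<bottom>\<^bsub>M\<^esub>)" for a b
  have ex: "\<exists>b\<in>carrier M. R a b" if "a \<in> carrier L" for a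
    unfolding R_def using dense_families_partner[OF assms(1,3,4) d e de that] by blast
  have ex': "\<exists>a\<in>carrier L. R a b" if "b \<in> carrier M" for b
    unfolding R_def using dense_families_partner[OF assms(3,1,2) e d de[symmetric] that] by blast
  have ord: "b \<sqsubseteq>\<^bsub>M\<^esub> b' \<longleftrightarrow> a \<sqsubseteq>\<^bsub>L\<^esub> a'"
    if "R a b" "R a' b'" "a \<in> carrier L" "a' \<in> carrier L" "b \<in> carrier M" "b' \<in> carrier M" for a a' b b'
    unfolding M.le_iff_dense_family[OF e that(5,6)] L.le_iff_dense_family[OF d that(3,4)]
    using that(1,2) unfolding R_def by blast
  define h where "h a = (SOME b. b \<in> carrier M \<and> R a b)" for a
  have h: "h a \<in> carrier M" "R a (h a)" if "a \<in> carrier L" for a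
    using someI_ex[of "\<lambda>b. b \<in> carrier M \<and> R a b"] ex[OF that] unfolding h_def by blast+
  have hR: "h a = b" if "a \<in> carrier L" "b \<in> carrier M" "R a b" for a b
    using ord[of a b a "h a"] ord[of a "h a" a b] h[OF that(1)] that M.le_antisym L.le_refl by metis
  have "bij_betw h (carrier L) (carrier M)"
    unfolding bij_betw_def
  proof
    show "inj_on h (carrier L)"
    proof (rule inj_onI)
      fix x y assume xy: "x \<in> carrier L" "y \<in> carrier L" "h x = h y"
      then show "x = y"
        using ord[of x "h x" y "h y"] ord[of y "h y" x "h x"] h L.le_antisym M.le_refl by metis
    qed
    show "h ` carrier L = carrier M"
    proof (intro equalityI subsetI)
      fix b assume b: "b \<in> carrier M"
      then obtain a where "a \<in> carrier L" "R a b" using ex' by blast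
      then show "b \<in> h ` carrier L" using hR b by (metis imageI)
    qed (use h in blast)
  qed
  then have "bool_iso L M h"
  proof (rule order_iso_bool_iso[OF assms(1,3)])
    fix x y assume "x \<in> carrier L" "y \<in> carrier L"
    then show "h x \<sqsubseteq>\<^bsub>M\<^esub> h y \<longleftrightarrow> x \<sqsubseteq>\<^bsub>L\<^esub> y"
      using ord[of x "h x" y "h y"] h by simp
  qed
  moreover have "h (d t) = e t" if "t \<in> T" for t
  proof (rule hR)
    show "d t \<in> carrier L" "e t \<in> carrier M" using d e that unfolding dense_family_def by blast+
    show "R (d t) (e t)" unfolding R_def using de that by blast
  qed
  ultimately show thesis using that by blast
qed

section \<open>Sums of Boolean algebras\<close>

definition bool_subalgebra :: "('a, 'm) gorder_scheme \<Rightarrow> 'a set \<Rightarrow> bool" where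
  "bool_subalgebra L S \<longleftrightarrow> S \<subseteq> carrier L \<and> \<bottom>\<^bsub>L\<^esub> \<in> S \<and> \<top>\<^bsub>L\<^esub> \<in> S \<and> (\<forall>x\<in>S. bcompl L x \<in> S)
     \<and> (\<forall>x\<in>S. \<forall>y\<in>S. x \<sqinter>\<^bsub>L\<^esub> y \<in> S \<and> x \<squnion>\<^bsub>L\<^esub> y \<in> S)"

text \<open>
  The universal property \<^const>\<open>bool_sum\<close> has test algebras whose elements are sets. A subalgebra
  becomes one of them when each of its elements \<open>x\<close> is replaced by \<open>{x}\<close>.
\<close>

definition singleton_copy :: "('a, 'm) gorder_scheme \<Rightarrow> 'a set \<Rightarrow> 'a set gorder" where
  "singleton_copy L S =
     \<lparr>carrier = (\<lambda>x. {x}) ` S, eq = (=), le = (\<lambda>X Y. the_elem X \<sqsubseteq>\<^bsub>L\<^esub> the_elem Y)\<rparr>"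

lemma singleton_copy:
  fixes L (structure)
  assumes "boolean_lattice L" "bool_subalgebra L S"
  shows "carrier (singleton_copy L S) = (\<lambda>x. {x}) ` S"
    "boolean_lattice (singleton_copy L S)"
    "\<And>x y. \<lbrakk>x \<in> S; y \<in> S\<rbrakk> \<Longrightarrow> {x} \<sqinter>\<^bsub>singleton_copy L S\<^esub> {y} = {x \<sqinter> y}"
    "\<And>x y. \<lbrakk>x \<in> S; y \<in> S\<rbrakk> \<Longrightarrow> {x} \<squnion>\<^bsub>singleton_copy L S\<^esub> {y} = {x \<squnion> y}"
    "\<And>x. x \<in> S \<Longrightarrow> bcompl (singleton_copy L S) {x} = {bcompl L x}"
    "\<bottom>\<^bsub>singleton_copy L S\<^esub> = {\<bottom>}" "\<top>\<^bsub>singleton_copy L S\<^esub> = {\<top>}"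
proof -
  interpret boolean_lattice L by fact
  let ?D = "singleton_copy L S"
  show c: "carrier ?D = (\<lambda>x. {x}) ` S" by (simp add: singleton_copy_def)
  have eq: "eq ?D = (=)" and le: "{x} \<sqsubseteq>\<^bsub>?D\<^esub> {y} \<longleftrightarrow> x \<sqsubseteq> y" for x y
    by (simp_all add: singleton_copy_def)
  have S: "x \<in> carrier L" if "x \<in> S" for x using assms(2) that by (auto simp: bool_subalgebra_def)
  have cl: "\<bottom> \<in> S" "\<top> \<in> S" "\<And>x. x \<in> S \<Longrightarrow> bcompl L x \<in> S"
    "\<And>x y. \<lbrakk>x \<in> S; y \<in> S\<rbrakk> \<Longrightarrow> x \<sqinter> y \<in> S" "\<And>x y. \<lbrakk>x \<in> S; y \<in> S\<rbrakk> \<Longrightarrow> x \<squnion> y \<in> S"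
    using assms(2) by (auto simp: bool_subalgebra_def)
  interpret D: partial_order ?D
    by standard (auto simp: c eq le S intro: le_antisym, meson S le_trans)
  have M: "greatest ?D {x \<sqinter> y} (Lower ?D {{x}, {y}})" "{x} \<sqinter>\<^bsub>?D\<^esub> {y} = {x \<sqinter> y}"
    if xy: "x \<in> S" "y \<in> S" for x y
  proof -
    have *: "z \<sqsubseteq>\<^bsub>?D\<^esub> {x \<sqinter> y}" if "z \<in> carrier ?D" "z \<sqsubseteq>\<^bsub>?D\<^esub> {x}" "z \<sqsubseteq>\<^bsub>?D\<^esub> {y}" for z
      using that meet_le xy S unfolding c by (auto simp: le)
    show "greatest ?D {x \<sqinter> y} (Lower ?D {{x}, {y}})" "{x} \<sqinter>\<^bsub>?D\<^esub> {y} = {x \<sqinter> y}"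
      by (rule D.meet_eqI; use xy cl S * meet_left[of x y] meet_right[of x y] in \<open>auto simp: c le\<close>)+
  qed
  have J: "least ?D {x \<squnion> y} (Upper ?D {{x}, {y}})" "{x} \<squnion>\<^bsub>?D\<^esub> {y} = {x \<squnion> y}"
    if xy: "x \<in> S" "y \<in> S" for x y
  proof -
    have *: "{x \<squnion> y} \<sqsubseteq>\<^bsub>?D\<^esub> z" if "z \<in> carrier ?D" "{x} \<sqsubseteq>\<^bsub>?D\<^esub> z" "{y} \<sqsubseteq>\<^bsub>?D\<^esub> z" for z
      using that join_le xy S unfolding c by (auto simp: le)
    show "least ?D {x \<squnion> y} (Upper ?D {{x}, {y}})" "{x} \<squnion>\<^bsub>?D\<^esub> {y} = {x \<squnion> y}"
      by (rule D.join_eqI; use xy cl S * join_left[of x y] join_right[of x y] in \<open>auto simp: c le\<close>)+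
  qed
  show "{x} \<sqinter>\<^bsub>?D\<^esub> {y} = {x \<sqinter> y}" "{x} \<squnion>\<^bsub>?D\<^esub> {y} = {x \<squnion> y}" if "x \<in> S" "y \<in> S" for x y
    using M J that by blast+
  have b: "least ?D {\<bottom>} (carrier ?D)" and t: "greatest ?D {\<top>} (carrier ?D)"
    unfolding least_def greatest_def using cl S by (auto simp: c le)
  interpret D: bounded_lattice ?D
  proof
    fix x y assume xy: "x \<in> carrier ?D" "y \<in> carrier ?D"
    then show "\<exists>s. least ?D s (Upper ?D {x, y})" "\<exists>s. greatest ?D s (Lower ?D {x, y})"
      unfolding c using J(1) M(1) by blast+
  next
    show "\<exists>x. least ?D x (carrier ?D)" "\<exists>x. greatest ?D x (carrier ?D)" using b t by blast+
  qed
  have "{\<bottom>} = \<bottom>\<^bsub>?D\<^esub>" by (rule D.bottom_eq) (use cl S in \<open>auto simp: c le\<close>)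
  moreover have "{\<top>} = \<top>\<^bsub>?D\<^esub>" by (rule D.top_eq) (use cl S in \<open>auto simp: c le\<close>)
  ultimately show B: "\<bottom>\<^bsub>?D\<^esub> = {\<bottom>}" and T: "\<top>\<^bsub>?D\<^esub> = {\<top>}" by simp_all
  have K: "{bcompl L x} \<in> carrier ?D \<and> {x} \<sqinter>\<^bsub>?D\<^esub> {bcompl L x} = \<bottom>\<^bsub>?D\<^esub> \<and> {x} \<squnion>\<^bsub>?D\<^esub> {bcompl L x} = \<top>\<^bsub>?D\<^esub>"
    if "x \<in> S" for x
    using that cl S by (simp add: B T M(2) J(2) c)
  interpret D: boolean_lattice ?D
  proof
    fix x y z assume "x \<in> carrier ?D" "y \<in> carrier ?D" "z \<in> carrier ?D"
    then obtain x' y' z' where xyz: "x = {x'}" "y = {y'}" "z = {z'}" "x' \<in> S" "y' \<in> S" "z' \<in> S"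
      unfolding c by blast
    then show "x \<sqinter>\<^bsub>?D\<^esub> (y \<squnion>\<^bsub>?D\<^esub> z) = (x \<sqinter>\<^bsub>?D\<^esub> y) \<squnion>\<^bsub>?D\<^esub> (x \<sqinter>\<^bsub>?D\<^esub> z)"
      using meet_join_distrib[of x' y' z'] cl S by (simp add: M(2) J(2))
  next
    fix x assume "x \<in> carrier ?D"
    then show "\<exists>y\<in>carrier ?D. x \<sqinter>\<^bsub>?D\<^esub> y = \<bottom>\<^bsub>?D\<^esub> \<and> x \<squnion>\<^bsub>?D\<^esub> y = \<top>\<^bsub>?D\<^esub>"
      unfolding c using K unfolding c by blast
  qed
  show "boolean_lattice ?D" by unfold_locales
  show "bcompl ?D {x} = {bcompl L x}" if "x \<in> S" for x
    using K[OF that] that by (intro D.bcompl_unique) (auto simp: c)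
qed

text \<open>
  A sum has no proper subalgebra that contains all summands: a homomorphism that retracts the sum
  onto such a subalgebra exists by the universal property, and by uniqueness it is the identity.
\<close>

lemma bool_sum_generated:
  fixes A :: "('a, 'n) gorder_scheme" and B :: "'i \<Rightarrow> ('b, 'm) gorder_scheme"
  assumes sum: "bool_sum I B A \<phi>" and S: "bool_subalgebra A S"
    and \<phi>S: "\<And>i x. \<lbrakk>i \<in> I; x \<in> carrier (B i)\<rbrakk> \<Longrightarrow> \<phi> i x \<in> S"
  shows "S = carrier A"
proof -
  have A: "boolean_lattice A" and \<phi>: "\<And>i. i \<in> I \<Longrightarrow> bool_hom (B i) A (\<phi> i)"
    using sum unfolding bool_sum_def by (simp, blast)
  have univ: "\<exists>!f. f \<in> extensional (carrier A) \<and> bool_hom A D f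
               \<and> (\<forall>i\<in>I. \<forall>x\<in>carrier (B i). f (\<phi> i x) = \<psi> i x)"
    if "boolean_lattice D" "\<And>i. i \<in> I \<Longrightarrow> bool_hom (B i) D (\<psi> i)" for D :: "'a set gorder" and \<psi>
    by (rule sum[unfolded bool_sum_def, THEN conjunct2, THEN conjunct2, THEN spec, THEN spec, THEN mp])
      (use that in blast)
  interpret A: boolean_lattice A by fact
  have full: "bool_subalgebra A (carrier A)" by (simp add: bool_subalgebra_def)
  let ?D = "singleton_copy A (carrier A)" and ?D' = "singleton_copy A S"
  note D = singleton_copy[OF A full] and D' = singleton_copy[OF A S]
  have Sc: "S \<subseteq> carrier A" using S by (simp add: bool_subalgebra_def)
  have \<phi>D: "bool_hom (B i) ?D (\<lambda>x. {\<phi> i x})" if "i \<in> I" for i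
    using \<phi>[OF that] unfolding bool_hom_def by (auto simp: D Pi_iff)
  have \<phi>D': "bool_hom (B i) ?D' (\<lambda>x. {\<phi> i x})" if "i \<in> I" for i
    using \<phi>[OF that] \<phi>S[OF that] unfolding bool_hom_def by (auto simp: D' Pi_iff)
  obtain f where f: "f \<in> extensional (carrier A)" "bool_hom A ?D' f"
    "\<And>i x. \<lbrakk>i \<in> I; x \<in> carrier (B i)\<rbrakk> \<Longrightarrow> f (\<phi> i x) = {\<phi> i x}"
    using univ[OF D'(2) \<phi>D'] by blast
  have fS: "\<exists>y\<in>S. f x = {y}" if "x \<in> carrier A" for x
    using f(2) that unfolding bool_hom_def D'(1) by blast
  have fD: "bool_hom A ?D f"
  proof -
    have "f (x \<sqinter>\<^bsub>A\<^esub> y) = f x \<sqinter>\<^bsub>?D\<^esub> f y" "f (x \<squnion>\<^bsub>A\<^esub> y) = f x \<squnion>\<^bsub>?D\<^esub> f y"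
      if xy: "x \<in> carrier A" "y \<in> carrier A" for x y
    proof -
      obtain x' y' where "x' \<in> S" "y' \<in> S" "f x = {x'}" "f y = {y'}" using fS xy by meson
      then show "f (x \<sqinter>\<^bsub>A\<^esub> y) = f x \<sqinter>\<^bsub>?D\<^esub> f y" "f (x \<squnion>\<^bsub>A\<^esub> y) = f x \<squnion>\<^bsub>?D\<^esub> f y"
        using f(2) xy Sc subsetD[OF Sc] unfolding bool_hom_def by (simp_all add: D D')
    qed
    moreover have "f (bcompl A x) = bcompl ?D (f x)" if x: "x \<in> carrier A" for x
    proof -
      obtain x' where "x' \<in> S" "f x = {x'}" using fS x by meson
      then show ?thesis using f(2) x subsetD[OF Sc] unfolding bool_hom_def by (simp add: D D')
    qed
    moreover have "f \<in> carrier A \<rightarrow> carrier ?D" using fS Sc unfolding D(1) by fastforce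
    moreover have "f \<bottom>\<^bsub>A\<^esub> = \<bottom>\<^bsub>?D\<^esub>" "f \<top>\<^bsub>A\<^esub> = \<top>\<^bsub>?D\<^esub>"
      using f(2) unfolding bool_hom_def by (simp_all add: D D')
    ultimately show ?thesis unfolding bool_hom_def by blast
  qed
  define e where "e = restrict (\<lambda>x. {x}) (carrier A)"
  have eD: "bool_hom A ?D e"
    unfolding bool_hom_def e_def by (auto simp: D)
  have "\<phi> i x \<in> carrier A" if "i \<in> I" "x \<in> carrier (B i)" for i x
    using \<phi>S Sc that by blast
  then have e\<phi>: "e (\<phi> i x) = {\<phi> i x}" if "i \<in> I" "x \<in> carrier (B i)" for i x
    using that by (simp add: e_def)
  have "e = f"
    using univ[OF D(2) \<phi>D] f(1,3) fD eD e\<phi> by (metis (lifting) e_def restrict_extensional)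
  have "x \<in> S" if "x \<in> carrier A" for x
  proof -
    have "f x = {x}" unfolding \<open>e = f\<close>[symmetric] e_def using that by simp
    then show ?thesis using fS[OF that] by auto
  qed
  then show ?thesis using Sc by blast
qed

section \<open>The generators as a dense family\<close>

lemma carrier_powerset_algebra: "carrier (powerset_algebra Z) = Pow Z"
  by (simp add: powerset_algebra_def)

context boolean_lattice
begin

lemma bel_greatest:
  assumes "\<And>i. i \<in> {1..k} \<Longrightarrow> \<phi> i {n i} \<in> carrier L" "1 \<le> k"
  shows "bel L \<phi> k n \<in> carrier L"
    "\<And>i. i \<in> {1..k} \<Longrightarrow> bel L \<phi> k n \<sqsubseteq> \<phi> i {n i}"
    "\<And>x. \<lbrakk>x \<in> carrier L; \<And>i. i \<in> {1..k} \<Longrightarrow> x \<sqsubseteq> \<phi> i {n i}\<rbrakk> \<Longrightarrow> x \<sqsubseteq> bel L \<phi> k n"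
proof -
  let ?S = "(\<lambda>i. \<phi> i {n i}) ` {1..k}"
  have S: "?S \<subseteq> carrier L" using assms(1) by blast
  have g: "greatest L (bel L \<phi> k n) (Lower L ?S)"
    unfolding bel_def using assms(2) S by (intro finite_inf_greatest) auto
  then show c: "bel L \<phi> k n \<in> carrier L" by (rule greatest_closed)
  show "bel L \<phi> k n \<sqsubseteq> \<phi> i {n i}" if "i \<in> {1..k}" for i
    using greatest_Lower_below[OF g _ S] that by blast
  show "x \<sqsubseteq> bel L \<phi> k n" if "x \<in> carrier L" "\<And>i. i \<in> {1..k} \<Longrightarrow> x \<sqsubseteq> \<phi> i {n i}" for x
    by (rule greatest_le[OF g]) (use that in \<open>auto simp: Lower_def\<close>)
qed

lemma bel_Suc:
  assumes "\<And>i. i \<in> {1..Suc k} \<Longrightarrow> \<phi> i {n i} \<in> carrier L" "1 \<le> k"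
  shows "bel L \<phi> (Suc k) n = bel L \<phi> k n \<sqinter> \<phi> (Suc k) {n (Suc k)}"
proof (rule le_antisym)
  have k: "\<And>i. i \<in> {1..k} \<Longrightarrow> \<phi> i {n i} \<in> carrier L" using assms(1) by simp
  note K = bel_greatest[where \<phi> = \<phi> and n = n, OF k assms(2), simplified]
    and K' = bel_greatest[where \<phi> = \<phi> and n = n and k = "Suc k", OF assms(1), simplified]
  have c: "\<phi> (Suc k) {n (Suc k)} \<in> carrier L" using assms(1) by simp
  show 1: "bel L \<phi> (Suc k) n \<in> carrier L" "bel L \<phi> k n \<sqinter> \<phi> (Suc k) {n (Suc k)} \<in> carrier L"
    using K(1) K'(1) c by simp_all
  show "bel L \<phi> (Suc k) n \<sqsubseteq> bel L \<phi> k n \<sqinter> \<phi> (Suc k) {n (Suc k)}"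
    using K K' 1 c by (intro meet_le) auto
  show "bel L \<phi> k n \<sqinter> \<phi> (Suc k) {n (Suc k)} \<sqsubseteq> bel L \<phi> (Suc k) n"
  proof (rule K'(3)[OF 1(2)])
    fix i assume i: "Suc 0 \<le> i \<and> i \<le> Suc k"
    show "bel L \<phi> k n \<sqinter> \<phi> (Suc k) {n (Suc k)} \<sqsubseteq> \<phi> i {n i}"
    proof (cases "i = Suc k")
      case False
      then have "bel L \<phi> k n \<sqsubseteq> \<phi> i {n i}" "\<phi> i {n i} \<in> carrier L" using i K(2) k by simp_all
      then show ?thesis using le_trans[OF meet_left] K(1) c 1(2) by blast
    qed (use meet_right K(1) c in simp)
  qed
qed

end

lemma bool_hom_bel:
  assumes "boolean_lattice L" "boolean_lattice M" "bool_hom L M f"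
    and \<phi>: "\<And>i. i \<in> {1..k} \<Longrightarrow> \<phi> i {n i} \<in> carrier L" and "1 \<le> k"
  shows "f (bel L \<phi> k n) = bel M (\<lambda>i S. f (\<phi> i S)) k n"
  using \<open>1 \<le> k\<close> \<phi>
proof (induction rule: dec_induct)
  case base
  interpret L: boolean_lattice L by fact
  interpret M: boolean_lattice M by fact
  have "\<phi> 1 {n 1} \<in> carrier L" "f (\<phi> 1 {n 1}) \<in> carrier M"
    using base assms(3) by (auto simp: bool_hom_def)
  then show ?case by (simp add: bel_def)
next
  case (step j)
  interpret L: boolean_lattice L by fact
  interpret M: boolean_lattice M by fact
  have c: "f (\<phi> i {n i}) \<in> carrier M" if "i \<in> {1..Suc j}" for i
    using step.prems[OF that] assms(3) by (auto simp: bool_hom_def)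
  have "bel L \<phi> j n \<in> carrier L" using step by (intro L.bel_greatest(1)) auto
  then show ?case
    using L.bel_Suc[where \<phi> = \<phi> and n = n and k = j, OF step.prems step(1)] M.bel_Suc[where \<phi> = "\<lambda>i S. f (\<phi> i S)" and n = n and k = j, OF c step(1)] step assms(3)
    unfolding bool_hom_def by simp
qed

lemma cylinder_sets_finite_dependence:
  assumes "y \<in> cylinder_sets"
  obtains k where "1 \<le> k"
    "\<forall>z\<in>topspace seqs. \<forall>w\<in>topspace seqs. (\<forall>i\<in>{1..k}. z i = w i) \<longrightarrow> (z \<in> y \<longleftrightarrow> w \<in> y)"
proof -
  define dep where "dep k x \<longleftrightarrow> 1 \<le> k \<and> (\<forall>z\<in>topspace seqs. \<forall>w\<in>topspace seqs.
      (\<forall>i\<in>{1..k}. z i = w i) \<longrightarrow> (z \<in> x \<longleftrightarrow> w \<in> x))" for k and x :: "(nat \<Rightarrow> int) set"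
  have mono: "dep m x" if "dep k x" "k \<le> m" for k m x
  proof -
    have "\<forall>i\<in>{1..k}. z i = w i" if "\<forall>i\<in>{1..m}. z i = w i" for z w :: "nat \<Rightarrow> int"
      using that \<open>k \<le> m\<close> by simp
    then show ?thesis using that unfolding dep_def by (meson order_trans)
  qed
  have "\<exists>k. dep k y"
    using assms
  proof induction
    case (cyl i S)
    then show ?case by (intro exI[of _ i]) (auto simp: cylinder_def dep_def)
  next
    case (un x y)
    then obtain k l where "dep k x" "dep l y" by blast
    then have "dep (max k l) x" "dep (max k l) y" by (auto intro: mono)
    then show ?case unfolding dep_def by (intro exI[of _ "max k l"]) (simp only: Un_iff, blast)
  next
    case (int x y)
    then obtain k l where "dep k x" "dep l y" by blast
    then have "dep (max k l) x" "dep (max k l) y" by (auto intro: mono)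
    then show ?case unfolding dep_def by (intro exI[of _ "max k l"]) (simp only: Int_iff, blast)
  next
    case (co x)
    then show ?case unfolding dep_def by (simp only: Diff_iff) blast
  qed
  then obtain k where "dep k y" by blast
  then show thesis using that[of k] unfolding dep_def by blast
qed

lemma admissible_upd: "admissible k n \<Longrightarrow> m \<in> Z0 \<Longrightarrow> admissible k (n(i := m))"
  by (auto simp: admissible_def)

locale sum_completion =
  fixes A At :: "'a gorder" and \<phi> :: "nat \<Rightarrow> int set \<Rightarrow> 'a"
  assumes sum: "bool_sum {1..} (\<lambda>i. powerset_algebra Z0) A \<phi>"
    and completion: "bool_completion A At"
begin

lemma At: "boolean_lattice At" "complete_lattice At" "boolean_lattice A"
  using completion by (simp_all add: bool_completion_def)

sublocale boolean_lattice At by (rule At)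

lemma incl: "bool_hom A At (\<lambda>x. x)"
  using completion by (simp add: bool_completion_def)

lemma \<phi>_hom: "1 \<le> i \<Longrightarrow> bool_hom (powerset_algebra Z0) A (\<phi> i)"
  using sum by (simp add: bool_sum_def)

lemma \<phi>_in_sum: "\<lbrakk>1 \<le> i; S \<subseteq> Z0\<rbrakk> \<Longrightarrow> \<phi> i S \<in> carrier A"
  using \<phi>_hom[of i] unfolding bool_hom_def carrier_powerset_algebra by blast

lemma \<phi>_closed [simp]: "\<lbrakk>1 \<le> i; S \<subseteq> Z0\<rbrakk> \<Longrightarrow> \<phi> i S \<in> carrier At"
  using \<phi>_in_sum completion by (auto simp: bool_completion_def)

lemma \<phi>_meet:
  assumes "1 \<le> i" "S \<subseteq> Z0" "T \<subseteq> Z0"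
  shows "\<phi> i S \<sqinter>\<^bsub>At\<^esub> \<phi> i T = \<phi> i (S \<inter> T)"
proof -
  have "\<phi> i (S \<sqinter>\<^bsub>powerset_algebra Z0\<^esub> T) = \<phi> i S \<sqinter>\<^bsub>A\<^esub> \<phi> i T"
    using \<phi>_hom[OF assms(1)] assms(2,3) unfolding bool_hom_def carrier_powerset_algebra by blast
  then show ?thesis
    using incl \<phi>_in_sum assms unfolding bool_hom_def by (simp add: powerset_algebra)
qed

lemma \<phi>_empty: "1 \<le> i \<Longrightarrow> \<phi> i {} = \<bottom>\<^bsub>At\<^esub>"
  using \<phi>_hom[of i] incl unfolding bool_hom_def by (simp add: powerset_algebra)

lemma \<phi>_disjoint: "\<lbrakk>1 \<le> i; S \<subseteq> Z0; T \<subseteq> Z0; S \<inter> T = {}\<rbrakk> \<Longrightarrow> \<phi> i S \<sqinter>\<^bsub>At\<^esub> \<phi> i T = \<bottom>\<^bsub>At\<^esub>"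
  by (simp add: \<phi>_meet \<phi>_empty)

lemma \<phi>_mono: "\<lbrakk>1 \<le> i; S \<subseteq> T; T \<subseteq> Z0\<rbrakk> \<Longrightarrow> \<phi> i S \<sqsubseteq>\<^bsub>At\<^esub> \<phi> i T"
  using \<phi>_meet[of i S T] le_iff_join[of "\<phi> i S" "\<phi> i T"] by (simp add: Int_absorb2 subset_trans)

lemma bel_in_sum:
  assumes "admissible k n"
  shows "bel A \<phi> k n \<in> carrier A" "bel A \<phi> k n = bel At \<phi> k n"
proof -
  interpret A: boolean_lattice A by (rule At)
  have k: "\<phi> i {n i} \<in> carrier A" if "i \<in> {1..k}" for i
    using assms \<phi>_in_sum that by (simp add: admissible_def)
  have 1: "1 \<le> k" using assms by (simp add: admissible_def)
  show "bel A \<phi> k n \<in> carrier A" using A.bel_greatest(1)[where \<phi> = \<phi> and n = n and k = k, OF k 1] .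
  show "bel A \<phi> k n = bel At \<phi> k n" using bool_hom_bel[where \<phi> = \<phi> and n = n and k = k, OF At(3,1) incl k 1] .
qed

lemma
  assumes "admissible k n"
  shows bel_closed: "bel At \<phi> k n \<in> carrier At"
    and bel_lower: "\<And>i. i \<in> {1..k} \<Longrightarrow> bel At \<phi> k n \<sqsubseteq>\<^bsub>At\<^esub> \<phi> i {n i}"
    and bel_glb: "\<And>x. \<lbrakk>x \<in> carrier At; \<And>i. i \<in> {1..k} \<Longrightarrow> x \<sqsubseteq>\<^bsub>At\<^esub> \<phi> i {n i}\<rbrakk> \<Longrightarrow> x \<sqsubseteq>\<^bsub>At\<^esub> bel At \<phi> k n"
proof -
  have k: "\<phi> i {n i} \<in> carrier At" if "i \<in> {1..k}" for i
    using assms that by (simp add: admissible_def)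
  have 1: "1 \<le> k" using assms by (simp add: admissible_def)
  note * = bel_greatest[where \<phi> = \<phi> and n = n and k = k, OF k 1]
  show "bel At \<phi> k n \<in> carrier At" "\<And>i. i \<in> {1..k} \<Longrightarrow> bel At \<phi> k n \<sqsubseteq>\<^bsub>At\<^esub> \<phi> i {n i}"
    "\<And>x. \<lbrakk>x \<in> carrier At; \<And>i. i \<in> {1..k} \<Longrightarrow> x \<sqsubseteq>\<^bsub>At\<^esub> \<phi> i {n i}\<rbrakk> \<Longrightarrow> x \<sqsubseteq>\<^bsub>At\<^esub> bel At \<phi> k n"
    by (rule *; assumption)+
qed

text \<open>
  The principal ultrafilters at \<open>n 1, n 2, \<dots>\<close> combine to a homomorphism onto the two-element
  algebra that sends the generator to the top.
\<close>

lemma bel_nonzero: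
  assumes ad: "admissible k n"
  shows "bel At \<phi> k n \<noteq> \<bottom>\<^bsub>At\<^esub>"
proof -
  interpret A: boolean_lattice A by (rule At)
  fix u :: 'a
  let ?D = "powerset_algebra {u}"
  \<comment> \<open>Beyond \<open>k\<close> any ultrafilter serves; the one at \<open>1\<close> is a choice.\<close>
  define n' where "n' i = (if i \<in> {1..k} then n i else 1)" for i
  have n': "n' i \<in> Z0" for i using ad by (auto simp: n'_def admissible_def Z0_def)
  define \<psi> where "\<psi> i S = (if n' i \<in> S then {u} else {})" for i and S :: "int set"
  interpret D: boolean_lattice ?D by (rule powerset_algebra)
  note c = carrier_powerset_algebra
  have "bool_hom (powerset_algebra Z0) ?D (\<psi> i)" for i
    unfolding bool_hom_def c using n'[of i] by (auto simp: powerset_algebra \<psi>_def)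
  then have "\<exists>!f. f \<in> extensional (carrier A) \<and> bool_hom A ?D f
      \<and> (\<forall>i\<in>{1..}. \<forall>S\<in>carrier (powerset_algebra Z0). f (\<phi> i S) = \<psi> i S)"
    by (intro sum[unfolded bool_sum_def, THEN conjunct2, THEN conjunct2, THEN spec, THEN spec, THEN mp]
        conjI ballI D.boolean_lattice_axioms)
  then obtain f where f: "bool_hom A ?D f" "\<forall>i\<in>{1..}. \<forall>S\<in>Pow Z0. f (\<phi> i S) = \<psi> i S"
    unfolding c by (elim ex1E conjE)
  have k: "\<phi> i {n i} \<in> carrier A" if "i \<in> {1..k}" for i
    using ad \<phi>_in_sum that by (simp add: admissible_def)
  have k1: "1 \<le> k" using ad by (simp add: admissible_def)
  have fn: "f (\<phi> i {n i}) = {u}" if "i \<in> {1..k}" for i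
  proof -
    have "f (\<phi> i {n i}) = \<psi> i {n i}" using f(2) that ad by (auto simp: admissible_def)
    then show ?thesis using that by (simp add: \<psi>_def n'_def)
  qed
  have "{u} \<sqsubseteq>\<^bsub>?D\<^esub> bel ?D (\<lambda>i S. f (\<phi> i S)) k n"
    using k1 fn by (intro D.bel_greatest(3)) (auto simp: c powerset_algebra_def)
  then have "f (bel A \<phi> k n) \<noteq> {}"
    using bool_hom_bel[where \<phi> = \<phi> and n = n and k = k, OF At(3) D.boolean_lattice_axioms f(1) k k1] by (auto simp: powerset_algebra_def)
  moreover have "f \<bottom>\<^bsub>A\<^esub> = {}" using f(1) by (simp add: bool_hom_def powerset_algebra)
  moreover have "\<bottom>\<^bsub>A\<^esub> = \<bottom>\<^bsub>At\<^esub>" using incl by (simp add: bool_hom_def)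
  ultimately show ?thesis using bel_in_sum(2)[OF ad] by metis
qed

text \<open>
  The algebra of cylinder sets maps onto the sum, because its image contains all summands. A
  nonempty cylinder set depends on finitely many coordinates only, so it contains a box with
  singleton sides.
\<close>

lemma bel_dense:
  assumes x: "x \<in> carrier At" "x \<noteq> \<bottom>\<^bsub>At\<^esub>"
  obtains k n where "admissible k n" "bel At \<phi> k n \<sqsubseteq>\<^bsub>At\<^esub> x"
proof -
  interpret A: boolean_lattice A by (rule At)
  let ?C = cylinder_algebra
  interpret C: boolean_lattice ?C by (rule cylinder_algebra)
  obtain g where g: "bool_hom ?C A g"
    "\<And>i S. \<lbrakk>1 \<le> i; S \<subseteq> Z0\<rbrakk> \<Longrightarrow> g (cylinder i S) = \<phi> i S"
    using cylinder_algebra_universal[where \<psi> = \<phi>, OF At(3) \<phi>_hom] unfolding carrier_powerset_algebra atLeast_iff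
    by blast
  note cc = cylinder_algebra_carrier(1)
  have "bool_subalgebra A (g ` cylinder_sets)"
    unfolding bool_subalgebra_def
  proof (intro conjI ballI)
    show "g ` cylinder_sets \<subseteq> carrier A" using g(1) by (auto simp: bool_hom_def cc)
    show "\<bottom>\<^bsub>A\<^esub> \<in> g ` cylinder_sets" "\<top>\<^bsub>A\<^esub> \<in> g ` cylinder_sets"
      using g(1) cylinder_bot cylinder_top by (auto simp: bool_hom_def cylinder_algebra image_iff) metis+
  next
    fix a assume "a \<in> g ` cylinder_sets"
    then obtain a' where "a' \<in> cylinder_sets" "a = g a'" by blast
    then show "bcompl A a \<in> g ` cylinder_sets"
      using g(1) C.bcompl_closed[of a'] unfolding bool_hom_def cc by (auto simp: image_iff) metis
  next
    fix a b assume "a \<in> g ` cylinder_sets" "b \<in> g ` cylinder_sets"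
    then obtain a' b' where "a' \<in> cylinder_sets" "a = g a'" "b' \<in> cylinder_sets" "b = g b'" by blast
    then show "a \<sqinter>\<^bsub>A\<^esub> b \<in> g ` cylinder_sets" "a \<squnion>\<^bsub>A\<^esub> b \<in> g ` cylinder_sets"
      using g(1) C.meet_closed[of a' b'] C.join_closed[of a' b'] unfolding bool_hom_def cc
      by (auto simp: image_iff) metis+
  qed
  then have onto: "g ` cylinder_sets = carrier A"
    by (rule bool_sum_generated[OF sum])
      (use g(2)[symmetric] cylinder_sets.cyl in \<open>simp add: carrier_powerset_algebra\<close>)
  have bot: "\<bottom>\<^bsub>A\<^esub> = \<bottom>\<^bsub>At\<^esub>" using incl by (simp add: bool_hom_def)
  obtain a where a: "a \<in> carrier A" "a \<noteq> \<bottom>\<^bsub>A\<^esub>" "a \<sqsubseteq>\<^bsub>At\<^esub> x" "a \<in> carrier At"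
    using completion x unfolding bool_completion_def bot by blast
  then obtain y where y: "y \<in> cylinder_sets" "a = g y" using onto by blast
  moreover have "g {} = \<bottom>\<^bsub>A\<^esub>" using g(1) by (simp add: bool_hom_def cylinder_algebra)
  ultimately obtain z where z: "z \<in> y" using a(2) by (metis ex_in_conv)
  then have zt: "z \<in> topspace seqs" using cylinder_sets_sub y by blast
  obtain k where k: "1 \<le> k"
    "\<forall>z\<in>topspace seqs. \<forall>w\<in>topspace seqs. (\<forall>i\<in>{1..k}. z i = w i) \<longrightarrow> (z \<in> y \<longleftrightarrow> w \<in> y)"
    by (rule cylinder_sets_finite_dependence[OF y(1)])
  have zZ: "z i \<in> Z0" if "1 \<le> i" for i using zt that by (auto simp: topspace_seqs)
  then have ad: "admissible k z" using k(1) by (simp add: admissible_def)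
  have cyl: "cylinder i {z i} \<in> carrier ?C" if "i \<in> {1..k}" for i
    using cylinder_sets.cyl[of i "{z i}"] zZ that by (simp add: cc)
  let ?c = "bel ?C cylinder k z"
  note c = C.bel_greatest[where \<phi> = cylinder and n = z and k = k, OF cyl k(1)]
  have "?c \<subseteq> y"
  proof
    fix w assume w: "w \<in> ?c"
    have *: "w \<in> topspace seqs" "z i = w i" if "i \<in> {1..k}" for i
      using c(2)[OF _ that] w by (auto simp: cylinder_algebra_carrier cylinder_def)
    have "w \<in> topspace seqs" using *(1)[of 1] k(1) by simp
    then show "w \<in> y" using k(2) zt z *(2) by blast
  qed
  then have "?c \<sqinter>\<^bsub>?C\<^esub> y = ?c" using c(1) y(1) by (simp add: cc cylinder_algebra Int_absorb2)
  then have "g ?c = g ?c \<sqinter>\<^bsub>A\<^esub> a" using g(1) c(1) y unfolding bool_hom_def cc by metis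
  moreover have gc: "g ?c = bel A \<phi> k z"
  proof -
    have "g ?c = bel A (\<lambda>i S. g (cylinder i S)) k z"
      by (rule bool_hom_bel[where \<phi> = cylinder and n = z and k = k, OF C.boolean_lattice_axioms At(3) g(1) cyl k(1)])
    also have "\<dots> = bel A \<phi> k z"
      unfolding bel_def using g(2) zZ by (intro arg_cong[of _ _ "Lattice.inf A"] image_cong) auto
    finally show ?thesis .
  qed
  ultimately have "bel At \<phi> k z = bel At \<phi> k z \<sqinter>\<^bsub>At\<^esub> a"
    using bel_in_sum[OF ad] incl a(1) unfolding bool_hom_def by metis
  then have "bel At \<phi> k z \<sqsubseteq>\<^bsub>At\<^esub> a" using le_iff_join[OF bel_closed[OF ad] a(4)] by blast
  then have "bel At \<phi> k z \<sqsubseteq>\<^bsub>At\<^esub> x" using le_trans a bel_closed[OF ad] x by blast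
  then show thesis using that ad by blast
qed

lemma bel_mono:
  assumes "admissible k n" "admissible l n'" "k \<le> l" "\<And>i. i \<in> {1..k} \<Longrightarrow> n i = n' i"
  shows "bel At \<phi> l n' \<sqsubseteq>\<^bsub>At\<^esub> bel At \<phi> k n"
  using assms bel_lower[OF assms(2)] by (intro bel_glb bel_closed) auto

lemma bel_disjoint_iff:
  assumes ad: "admissible k n" "admissible l n'"
  shows "bel At \<phi> k n \<sqinter>\<^bsub>At\<^esub> bel At \<phi> l n' = \<bottom>\<^bsub>At\<^esub> \<longleftrightarrow> (\<exists>i\<in>{1..min k l}. n i \<noteq> n' i)"
proof
  assume dis: "bel At \<phi> k n \<sqinter>\<^bsub>At\<^esub> bel At \<phi> l n' = \<bottom>\<^bsub>At\<^esub>"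
  show "\<exists>i\<in>{1..min k l}. n i \<noteq> n' i"
  proof (rule ccontr)
    assume "\<not> ?thesis"
    then have eq: "n i = n' i" if "i \<in> {1..min k l}" for i using that by blast
    let ?x = "if k \<le> l then bel At \<phi> l n' else bel At \<phi> k n"
    have x: "?x \<in> carrier At" "?x \<noteq> \<bottom>\<^bsub>At\<^esub>" using ad bel_closed bel_nonzero by simp_all
    have "?x \<sqsubseteq>\<^bsub>At\<^esub> bel At \<phi> k n" "?x \<sqsubseteq>\<^bsub>At\<^esub> bel At \<phi> l n'"
      using bel_mono[OF ad] bel_mono[OF ad(2,1)] eq ad bel_closed by (auto simp: min_def)
    then have "?x \<sqsubseteq>\<^bsub>At\<^esub> \<bottom>\<^bsub>At\<^esub>"
      using meet_le[OF _ _ bel_closed[OF ad(1)] bel_closed[OF ad(2)] x(1)] unfolding dis by blast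
    then show False using x le_bottom_iff by blast
  qed
next
  assume "\<exists>i\<in>{1..min k l}. n i \<noteq> n' i"
  then obtain i where i: "i \<in> {1..k}" "i \<in> {1..l}" "n i \<noteq> n' i" by auto
  have Z: "n i \<in> Z0" "n' i \<in> Z0" using i ad by (auto simp: admissible_def)
  let ?b = "bel At \<phi> k n" and ?b' = "bel At \<phi> l n'"
  have c: "?b \<in> carrier At" "?b' \<in> carrier At" "\<phi> i {n i} \<in> carrier At" "\<phi> i {n' i} \<in> carrier At"
    using bel_closed ad Z i by simp_all
  have "\<phi> i {n i} \<sqinter>\<^bsub>At\<^esub> \<phi> i {n' i} = \<bottom>\<^bsub>At\<^esub>" using Z i by (intro \<phi>_disjoint) auto
  then have "?b \<sqinter>\<^bsub>At\<^esub> \<phi> i {n' i} = \<bottom>\<^bsub>At\<^esub>"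
    using meet_eq_bottom_mono[OF bel_lower[OF ad(1) i(1)]] c by blast
  then have "?b' \<sqinter>\<^bsub>At\<^esub> ?b = \<bottom>\<^bsub>At\<^esub>"
    using meet_eq_bottom_mono[OF bel_lower[OF ad(2) i(2)]] c meet_comm[of At ?b "\<phi> i {n' i}"] by simp
  then show "?b \<sqinter>\<^bsub>At\<^esub> ?b' = \<bottom>\<^bsub>At\<^esub>" using meet_comm[of At ?b ?b'] by simp
qed

lemma qel_parts:
  assumes "admissible k n"
  shows "bel At \<phi> k (n(k := zpred (n k))) \<in> carrier At" "bel At \<phi> k n \<in> carrier At"
    "\<phi> (k + 1) (Succs (int r)) \<in> carrier At" "\<phi> (k + 1) (Preds (- int r)) \<in> carrier At"
    "qel At \<phi> k n r \<in> carrier At"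
proof -
  have "admissible k (n(k := zpred (n k)))"
    using assms zpred_immediate(1) by (intro admissible_upd) (auto simp: admissible_def)
  then show 1: "bel At \<phi> k (n(k := zpred (n k))) \<in> carrier At" by (rule bel_closed)
  show 2: "bel At \<phi> k n \<in> carrier At" using assms by (rule bel_closed)
  show 3: "\<phi> (k + 1) (Succs (int r)) \<in> carrier At" by (rule \<phi>_closed) (auto simp: Succs_def)
  show 4: "\<phi> (k + 1) (Preds (- int r)) \<in> carrier At" by (rule \<phi>_closed) (auto simp: Preds_def)
  show "qel At \<phi> k n r \<in> carrier At" unfolding qel_def using 1 2 3 4 by simp
qed

text \<open>
  For \<open>l > k + 1\<close> the generator fixes the first \<open>k + 1\<close> coordinates, and these decide whether it lies in
  one of the two halves of \<^const>\<open>qel\<close> or misses both.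
\<close>

lemma bel_le_qel_iff:
  assumes ad: "admissible k n" "admissible l n'" and l: "k + 1 < l"
  shows "bel At \<phi> l n' \<sqsubseteq>\<^bsub>At\<^esub> qel At \<phi> k n r \<longleftrightarrow> touch_qb k n r l n'"
proof -
  let ?m = "n(k := zpred (n k))" and ?b' = "bel At \<phi> l n'"
  let ?S = "\<phi> (k + 1) (Succs (int r))" and ?P = "\<phi> (k + 1) (Preds (- int r))"
  note c = qel_parts[OF ad(1)]
  have b': "?b' \<in> carrier At" "?b' \<noteq> \<bottom>\<^bsub>At\<^esub>" using ad bel_closed bel_nonzero by simp_all
  have adm: "admissible k ?m"
    using ad zpred_immediate(1) by (intro admissible_upd) (auto simp: admissible_def)
  have k1: "1 \<le> k" and kl: "k + 1 \<in> {1..l}" using ad l by (auto simp: admissible_def)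
  have Z: "n' (k + 1) \<in> Z0" using ad kl by (auto simp: admissible_def)
  have sub: "Succs j \<subseteq> Z0" "Preds j \<subseteq> Z0" for j by (auto simp: Succs_def Preds_def)
  have low: "?b' \<sqsubseteq>\<^bsub>At\<^esub> \<phi> (k + 1) {n' (k + 1)}" using bel_lower[OF ad(2) kl] .
  have cl: "\<phi> (k + 1) {n' (k + 1)} \<in> carrier At" using Z by simp
  have part: "if (\<forall>i\<in>{1..k}. p i = n' i) \<and> n' (k + 1) \<in> W then ?b' \<sqsubseteq>\<^bsub>At\<^esub> bel At \<phi> k p \<sqinter>\<^bsub>At\<^esub> \<phi> (k + 1) W
      else ?b' \<sqinter>\<^bsub>At\<^esub> (bel At \<phi> k p \<sqinter>\<^bsub>At\<^esub> \<phi> (k + 1) W) = \<bottom>\<^bsub>At\<^esub>"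
    if p: "admissible k p" and W: "W \<subseteq> Z0" for p W
  proof -
    let ?p = "bel At \<phi> k p" and ?W = "\<phi> (k + 1) W"
    have pc: "?p \<in> carrier At" "?W \<in> carrier At" using bel_closed[OF p] W by simp_all
    consider "\<forall>i\<in>{1..k}. p i = n' i" "n' (k + 1) \<in> W" | "\<exists>i\<in>{1..k}. p i \<noteq> n' i" | "n' (k + 1) \<notin> W" by blast
    then show ?thesis
    proof cases
      case 1
      have "?b' \<sqsubseteq>\<^bsub>At\<^esub> ?p" using 1 l by (intro bel_mono p ad) auto
      moreover have "?b' \<sqsubseteq>\<^bsub>At\<^esub> ?W"
        using le_trans[OF low _ b'(1) cl pc(2)] \<phi>_mono[of "k + 1" "{n' (k + 1)}" W] 1 W by simp
      ultimately show ?thesis using 1 meet_le b'(1) pc by simp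
    next
      case 2
      then have "?p \<sqinter>\<^bsub>At\<^esub> ?b' = \<bottom>\<^bsub>At\<^esub>" using bel_disjoint_iff[OF p ad(2)] l by (auto simp: min_def)
      then have "(?p \<sqinter>\<^bsub>At\<^esub> ?W) \<sqinter>\<^bsub>At\<^esub> ?b' = \<bottom>\<^bsub>At\<^esub>"
        using meet_eq_bottom_mono[OF meet_left[of ?p ?W]] pc b'(1) by simp
      then show ?thesis using 2 meet_comm[of At ?b'] by auto
    next
      case 3
      have "\<phi> (k + 1) {n' (k + 1)} \<sqinter>\<^bsub>At\<^esub> ?W = \<bottom>\<^bsub>At\<^esub>" using 3 W Z by (intro \<phi>_disjoint) auto
      then have "?b' \<sqinter>\<^bsub>At\<^esub> ?W = \<bottom>\<^bsub>At\<^esub>"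
        using meet_eq_bottom_mono[OF low] b'(1) cl pc(2) by blast
      then have "(?p \<sqinter>\<^bsub>At\<^esub> ?W) \<sqinter>\<^bsub>At\<^esub> ?b' = \<bottom>\<^bsub>At\<^esub>"
        using meet_eq_bottom_mono[OF meet_right[of ?p ?W]] pc b'(1) meet_comm[of At ?b' ?W] by simp
      then show ?thesis using 3 meet_comm[of At ?b'] by auto
    qed
  qed
  let ?x = "bel At \<phi> k ?m \<sqinter>\<^bsub>At\<^esub> ?S" and ?y = "bel At \<phi> k n \<sqinter>\<^bsub>At\<^esub> ?P"
  have xy: "?x \<in> carrier At" "?y \<in> carrier At" using c by simp_all
  have q: "qel At \<phi> k n r = ?x \<squnion>\<^bsub>At\<^esub> ?y" by (simp add: qel_def)
  let ?X = "(\<forall>i\<in>{1..k}. ?m i = n' i) \<and> n' (k + 1) \<in> Succs (int r)"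
  let ?Y = "(\<forall>i\<in>{1..k}. n i = n' i) \<and> n' (k + 1) \<in> Preds (- int r)"
  have t: "touch_qb k n r l n' \<longleftrightarrow> ?X \<or> ?Y"
  proof -
    have *: "(\<forall>i\<in>{1..k}. f i = n' i) \<longleftrightarrow> (\<forall>i\<in>{1..<k}. f i = n' i) \<and> f k = n' k" for f
      using k1 by (auto simp: le_less)
    have "(\<forall>i\<in>{1..<k}. ?m i = n' i) \<longleftrightarrow> (\<forall>i\<in>{1..<k}. n i = n' i)" by simp
    moreover have "n' (k + 1) \<in> Succs (int r) \<longleftrightarrow> n' (k + 1) > int r"
      "n' (k + 1) \<in> Preds (- int r) \<longleftrightarrow> n' (k + 1) < - int r"
      using Z by (auto simp: Succs_def Preds_def)
    moreover have "touch_qb k n r l n' \<longleftrightarrow> (\<forall>i\<in>{1..<k}. n i = n' i)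
        \<and> ((n' (k + 1) > int r \<and> n' k = zpred (n k)) \<or> (n' (k + 1) < - int r \<and> n' k = n k))"
      unfolding touch_qb_def using l by simp
    ultimately show ?thesis
      unfolding *[of ?m] *[of n] fun_upd_same by (simp only: eq_commute[of "n' k"]) blast
  qed
  have X: "if ?X then ?b' \<sqsubseteq>\<^bsub>At\<^esub> ?x else ?b' \<sqinter>\<^bsub>At\<^esub> ?x = \<bottom>\<^bsub>At\<^esub>" by (rule part[OF adm sub(1)])
  have Y: "if ?Y then ?b' \<sqsubseteq>\<^bsub>At\<^esub> ?y else ?b' \<sqinter>\<^bsub>At\<^esub> ?y = \<bottom>\<^bsub>At\<^esub>" by (rule part[OF ad(1) sub(2)])
  show ?thesis
  proof (cases "?X \<or> ?Y")
    case True
    then have "?b' \<sqsubseteq>\<^bsub>At\<^esub> ?x \<or> ?b' \<sqsubseteq>\<^bsub>At\<^esub> ?y" using X Y by presburger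
    then have "?b' \<sqsubseteq>\<^bsub>At\<^esub> qel At \<phi> k n r"
      unfolding q using le_trans[OF _ join_left[OF xy]] le_trans[OF _ join_right[OF xy]] xy b'(1) by auto
    then show ?thesis using True t by blast
  next
    case False
    then have "?b' \<sqinter>\<^bsub>At\<^esub> ?x = \<bottom>\<^bsub>At\<^esub>" "?b' \<sqinter>\<^bsub>At\<^esub> ?y = \<bottom>\<^bsub>At\<^esub>" using X Y by presburger+
    then have "?b' \<sqinter>\<^bsub>At\<^esub> qel At \<phi> k n r = \<bottom>\<^bsub>At\<^esub>"
      unfolding q using meet_join_distrib[OF b'(1) xy] bottom_join_eq[of "\<bottom>\<^bsub>At\<^esub>"] by simp
    then have "\<not> ?b' \<sqsubseteq>\<^bsub>At\<^esub> qel At \<phi> k n r"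
      using le_iff_join[OF b'(1) c(5)] b'(2) by metis
    then show ?thesis using False t by blast
  qed
qed

end

section \<open>Local contact algebras of regular closed sets\<close>

lemma standard_lca_simps:
  "F \<in> carrier (standard_lca X) \<longleftrightarrow> F \<subseteq> topspace X \<and> F = X closure_of (X interior_of F)"
  "F \<in> bdd (standard_lca X) \<longleftrightarrow> F \<in> carrier (standard_lca X) \<and> compactin X F"
  "contact (standard_lca X) F G \<longleftrightarrow> F \<inter> G \<noteq> {}"
  "F \<sqsubseteq>\<^bsub>standard_lca X\<^esub> G \<longleftrightarrow> F \<subseteq> G"
  by (auto simp: standard_lca_def)

lemma standard_lca_regular:
  "F \<in> carrier (standard_lca X) \<Longrightarrow> X closure_of (X interior_of F) = F"
  unfolding standard_lca_simps by (erule conjunct2[THEN sym])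

lemma standard_lca_closedin: "F \<in> carrier (standard_lca X) \<Longrightarrow> closedin X F"
  unfolding standard_lca_simps by (metis closedin_closure_of)

lemma standard_lca_closure_open:
  "openin X U \<Longrightarrow> X closure_of U \<in> carrier (standard_lca X)"
  unfolding standard_lca_simps by (simp add: closure_of_open_regular closure_of_subset_topspace)

lemma standard_lca_neighbourhood:
  assumes "locally_compact_space X" "Hausdorff_space X" "openin X W" "x \<in> W"
  obtains F where "F \<in> bdd (standard_lca X)" "x \<in> X interior_of F" "F \<subseteq> W"
proof -
  have "neighbourhood_base_of (\<lambda>C. compactin X C \<and> closedin X C) X"
    using assms(1,2) locally_compact_space_neighbourhood_base_closedin by blast
  then obtain U V where UV: "openin X U" "compactin X V" "closedin X V" "x \<in> U" "U \<subseteq> V" "V \<subseteq> W"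
    using assms(3,4) unfolding neighbourhood_base_of by meson
  have sub: "X closure_of U \<subseteq> V" using UV by (simp add: closure_of_minimal)
  show thesis
  proof (rule that)
    show "X closure_of U \<in> bdd (standard_lca X)"
      using standard_lca_closure_open[OF UV(1)] closed_compactin[OF UV(2) sub]
      by (simp add: standard_lca_simps(2))
    show "x \<in> X interior_of (X closure_of U)"
      using UV closure_of_subset interior_of_maximal openin_subset by (metis subsetD)
    show "X closure_of U \<subseteq> W" using sub UV by blast
  qed
qed

lemma standard_lca_disjoint_compl_iff:
  assumes "F \<subseteq> topspace X" "G \<in> carrier (standard_lca X)"
  shows "F \<inter> bcompl (standard_lca X) G = {} \<longleftrightarrow> F \<subseteq> X interior_of G"
  using assms standard_lca_algebra(7)[OF assms(2)] closure_of_complement[of X G]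
  by (auto simp: standard_lca_simps(1))

text \<open>
  All three axioms on bounded elements come from small compact regular closed neighbourhoods of
  points: finitely many of them cover the compact set in the interpolation axiom, and one of them
  gives the bounded element in each of the other two.
\<close>

theorem standard_lca_complete:
  assumes X: "locally_compact_space X" "Hausdorff_space X"
  shows "complete_local_contact_algebra (standard_lca X)"
proof -
  let ?B = "standard_lca X"
  interpret boolean_lattice ?B by (rule standard_lca_algebra)
  interpret complete_lattice ?B by (rule standard_lca_algebra)
  note ops = standard_lca_algebra(3-7)[where X = X] and simps = standard_lca_simps
  have sub: "F \<subseteq> topspace X" if "F \<in> carrier ?B" for F
    using closedin_subset[OF standard_lca_closedin[OF that]] .
  have below: "F \<lless>\<^bsub>?B\<^esub> G \<longleftrightarrow> F \<subseteq> X interior_of G" if "F \<subseteq> topspace X" "G \<in> carrier ?B" for F G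
    using standard_lca_disjoint_compl_iff[OF that] unfolding strongly_below_def simps(3) by simp
  show ?thesis
  proof unfold_locales
    fix a b c assume "a \<in> carrier ?B" "b \<in> carrier ?B" "c \<in> carrier ?B"
    then show "contact ?B a (b \<squnion>\<^bsub>?B\<^esub> c) \<longleftrightarrow> contact ?B a b \<or> contact ?B a c"
      by (auto simp: simps(3) ops)
  next
    show "lattice_ideal ?B (bdd ?B)"
      unfolding lattice_ideal_def
    proof (intro conjI ballI impI)
      fix x y assume "x \<in> bdd ?B" "y \<in> bdd ?B"
      then show "x \<squnion>\<^bsub>?B\<^esub> y \<in> bdd ?B"
        using join_closed[of x y] by (simp add: simps(2) ops compactin_Un)
    next
      fix x y assume "x \<in> bdd ?B" "y \<in> carrier ?B" "y \<sqsubseteq>\<^bsub>?B\<^esub> x"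
      then show "y \<in> bdd ?B"
        using closed_compactin[of X x y] standard_lca_closedin[of y X] by (simp add: simps(2,4))
    qed (use bottom_closed in \<open>auto simp: simps(2) ops\<close>)
  next
    fix a c assume a: "a \<in> bdd ?B" and c: "c \<in> carrier ?B" and ac: "a \<lless>\<^bsub>?B\<^esub> c"
    have a': "a \<in> carrier ?B" "compactin X a" using a by (simp_all add: simps(2))
    have "\<exists>F. F \<in> bdd ?B \<and> x \<in> X interior_of F \<and> F \<subseteq> X interior_of c" if "x \<in> a" for x
      using standard_lca_neighbourhood[OF X openin_interior_of, of x c] ac below[OF sub[OF a'(1)] c] that
      by (metis subsetD)
    then obtain N where N: "\<And>x. x \<in> a \<Longrightarrow> N x \<in> bdd ?B \<and> x \<in> X interior_of N x \<and> N x \<subseteq> X interior_of c"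
      by metis
    have "\<exists>\<F>. finite \<F> \<and> \<F> \<subseteq> (\<lambda>x. X interior_of N x) ` a \<and> a \<subseteq> \<Union>\<F>"
    proof (rule compactinD[OF a'(2)])
      show "a \<subseteq> \<Union>((\<lambda>x. X interior_of N x) ` a)" using N by blast
    qed auto
    then obtain P where P: "finite P" "P \<subseteq> a" "a \<subseteq> (\<Union>x\<in>P. X interior_of N x)"
      by (metis finite_subset_image)
    have "(\<Union>x\<in>P. N x) \<in> bdd ?B" using P(1,2)
    proof (induction P)
      case empty
      show ?case using bottom_closed by (auto simp: simps(2) ops)
    next
      case (insert x P)
      then have "N x \<in> bdd ?B" "(\<Union>x\<in>P. N x) \<in> bdd ?B" using N by auto
      then have "N x \<squnion>\<^bsub>?B\<^esub> (\<Union>x\<in>P. N x) \<in> carrier ?B" "compactin X (N x \<union> (\<Union>x\<in>P. N x))"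
        by (simp_all add: simps(2) compactin_Un)
      then show ?case using \<open>N x \<in> bdd ?B\<close> \<open>(\<Union>x\<in>P. N x) \<in> bdd ?B\<close> by (simp add: simps(2) ops)
    qed
    moreover have "a \<subseteq> X interior_of (\<Union>x\<in>P. N x)"
    proof -
      have "X interior_of N x \<subseteq> X interior_of (\<Union>x\<in>P. N x)" if "x \<in> P" for x
        using that by (intro interior_of_mono) blast
      then show ?thesis using P(3) by blast
    qed
    moreover have "(\<Union>x\<in>P. N x) \<subseteq> X interior_of c" using N P by blast
    ultimately show "\<exists>b\<in>bdd ?B. a \<lless>\<^bsub>?B\<^esub> b \<and> b \<lless>\<^bsub>?B\<^esub> c"
      using below sub a'(1) c by (auto simp: simps(2) intro!: bexI[of _ "\<Union>x\<in>P. N x"])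
  next
    fix a b assume a: "a \<in> carrier ?B" and b: "b \<in> carrier ?B" and "contact ?B a b"
    then obtain x where x: "x \<in> a" "x \<in> b" by (auto simp: simps(3))
    then have xt: "x \<in> topspace X" using sub[OF a] by blast
    obtain c where c: "c \<in> bdd ?B" "x \<in> X interior_of c"
      by (rule standard_lca_neighbourhood[OF X openin_topspace xt])
    have c': "c \<in> carrier ?B" using c by (simp add: simps(2))
    have "x \<in> X closure_of (X interior_of b)" using x standard_lca_regular[OF b] by simp
    then have "x \<in> X closure_of (X interior_of c \<inter> X interior_of b)"
      using c(2) openin_Int_closure_of_subset[OF openin_interior_of, of X c "X interior_of b"] by blast
    then have "x \<in> c \<sqinter>\<^bsub>?B\<^esub> b" by (simp add: ops c' b interior_of_Int)
    then show "\<exists>c\<in>bdd ?B. contact ?B a (c \<sqinter>\<^bsub>?B\<^esub> b)"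
      using c(1) x(1) by (auto simp: simps(3))
  next
    fix a assume a: "a \<in> carrier ?B" "a \<noteq> \<bottom>\<^bsub>?B\<^esub>"
    have "X interior_of a \<noteq> {}" using a standard_lca_regular[OF a(1)] by (auto simp: ops)
    then obtain x where "x \<in> X interior_of a" by blast
    then obtain b where b: "b \<in> bdd ?B" "x \<in> X interior_of b" "b \<subseteq> X interior_of a"
      by (rule standard_lca_neighbourhood[OF X openin_interior_of])
    moreover have "b \<noteq> {}" using b(2) interior_of_subset by fastforce
    ultimately show "\<exists>b\<in>bdd ?B. b \<noteq> \<bottom>\<^bsub>?B\<^esub> \<and> b \<lless>\<^bsub>?B\<^esub> a"
      using below sub a(1) by (auto simp: simps(2) ops)
  qed (auto simp: simps(3) ops)
qed

lemma lca_isomorphic_complete: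
  assumes "boolean_lattice B" "complete_lattice B" and bdd: "bdd B \<subseteq> carrier B"
    and "complete_local_contact_algebra B'" and iso: "B \<cong>\<^sub>L\<^sub>C\<^sub>A B'"
  shows "complete_local_contact_algebra B"
proof -
  interpret boolean_lattice B by fact
  interpret complete_lattice B by fact
  interpret B': complete_local_contact_algebra B' by fact
  obtain h where h: "bool_iso B B' h"
    "\<And>a b. \<lbrakk>a \<in> carrier B; b \<in> carrier B\<rbrakk> \<Longrightarrow> contact B a b \<longleftrightarrow> contact B' (h a) (h b)"
    "\<And>a. a \<in> carrier B \<Longrightarrow> a \<in> bdd B \<longleftrightarrow> h a \<in> bdd B'"
    using iso unfolding lca_isomorphic_def by (elim exE conjE) simp
  have c: "h x \<in> carrier B'" if "x \<in> carrier B" for x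
    using h(1) that by (auto simp: bool_iso_def bool_hom_def)
  have surj: "\<exists>x\<in>carrier B. h x = y" if "y \<in> carrier B'" for y
    using bij_betw_imp_surj_on[of h "carrier B" "carrier B'"] h(1)[unfolded bool_iso_def, THEN conjunct2] that
    by (metis imageE)
  have meet: "h (x \<sqinter>\<^bsub>B\<^esub> y) = h x \<sqinter>\<^bsub>B'\<^esub> h y" and join: "h (x \<squnion>\<^bsub>B\<^esub> y) = h x \<squnion>\<^bsub>B'\<^esub> h y"
    if "x \<in> carrier B" "y \<in> carrier B" for x y
    using h(1) that by (auto simp: bool_iso_def bool_hom_def)
  have compl: "h (bcompl B x) = bcompl B' (h x)" if "x \<in> carrier B" for x
    using h(1) that by (auto simp: bool_iso_def bool_hom_def)
  have bot: "h \<bottom>\<^bsub>B\<^esub> = \<bottom>\<^bsub>B'\<^esub>" using h(1) by (auto simp: bool_iso_def bool_hom_def)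
  have bot_iff: "h x = \<bottom>\<^bsub>B'\<^esub> \<longleftrightarrow> x = \<bottom>\<^bsub>B\<^esub>" if "x \<in> carrier B" for x
  proof -
    have "inj_on h (carrier B)" using h(1) by (simp add: bool_iso_def bij_betw_def)
    then show ?thesis using inj_on_eq_iff[of h "carrier B" x "\<bottom>\<^bsub>B\<^esub>"] that bot by simp
  qed
  have below: "x \<lless>\<^bsub>B\<^esub> y \<longleftrightarrow> h x \<lless>\<^bsub>B'\<^esub> h y" if "x \<in> carrier B" "y \<in> carrier B" for x y
    using that h(2)[of x "bcompl B y"] by (simp add: strongly_below_def compl)
  note ord = bool_iso_order_iso[OF boolean_lattice_axioms B'.boolean_lattice_axioms h(1)]
  have ideal': "bdd B' \<subseteq> carrier B'" "\<bottom>\<^bsub>B'\<^esub> \<in> bdd B'"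
    "\<And>x y. \<lbrakk>x \<in> bdd B'; y \<in> bdd B'\<rbrakk> \<Longrightarrow> x \<squnion>\<^bsub>B'\<^esub> y \<in> bdd B'"
    "\<And>x y. \<lbrakk>x \<in> bdd B'; y \<in> carrier B'; y \<sqsubseteq>\<^bsub>B'\<^esub> x\<rbrakk> \<Longrightarrow> y \<in> bdd B'"
    using B'.bdd_ideal unfolding lattice_ideal_def by blast+
  have bc: "x \<in> carrier B" if "x \<in> bdd B" for x using bdd that by blast
  show ?thesis
  proof unfold_locales
    show "contact B a a" if "a \<in> carrier B" "a \<noteq> \<bottom>\<^bsub>B\<^esub>" for a
      using B'.contact_refl[of "h a"] that by (simp add: h(2) c bot_iff)
    show "a \<noteq> \<bottom>\<^bsub>B\<^esub> \<and> b \<noteq> \<bottom>\<^bsub>B\<^esub>" if "a \<in> carrier B" "b \<in> carrier B" "contact B a b" for a b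
      using B'.contact_nonzero[of "h a" "h b"] that by (simp add: h(2) c bot_iff)
    show "contact B b a" if "a \<in> carrier B" "b \<in> carrier B" "contact B a b" for a b
      using B'.contact_sym[of "h a" "h b"] that by (simp add: h(2) c)
    show "contact B a (b \<squnion>\<^bsub>B\<^esub> c') \<longleftrightarrow> contact B a b \<or> contact B a c'"
      if "a \<in> carrier B" "b \<in> carrier B" "c' \<in> carrier B" for a b c'
      using B'.contact_join[of "h a" "h b" "h c'"] that by (simp add: h(2) c join)
    show "lattice_ideal B (bdd B)"
      unfolding lattice_ideal_def
    proof (intro conjI ballI impI)
      show "\<bottom>\<^bsub>B\<^esub> \<in> bdd B" using ideal'(2) by (simp add: h(3) bot)
      show "x \<squnion>\<^bsub>B\<^esub> y \<in> bdd B" if "x \<in> bdd B" "y \<in> bdd B" for x y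
        using that bc[OF that(1)] bc[OF that(2)] ideal'(3) by (simp add: h(3) join)
      show "y \<in> bdd B" if "x \<in> bdd B" "y \<in> carrier B" "y \<sqsubseteq>\<^bsub>B\<^esub> x" for x y
        using that bc[OF that(1)] ideal'(4)[of "h x" "h y"] ord[of y x] c by (simp add: h(3))
    qed (rule bdd)
  next
    fix a e assume ae: "a \<in> bdd B" "e \<in> carrier B" "a \<lless>\<^bsub>B\<^esub> e"
    have a: "a \<in> carrier B" using bc ae(1) .
    then obtain b' where b': "b' \<in> bdd B'" "h a \<lless>\<^bsub>B'\<^esub> b'" "b' \<lless>\<^bsub>B'\<^esub> h e"
      using B'.BC1[of "h a" "h e"] ae c below h(3) by blast
    then obtain b where "b \<in> carrier B" "h b = b'" using surj ideal'(1) by blast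
    then show "\<exists>b\<in>bdd B. a \<lless>\<^bsub>B\<^esub> b \<and> b \<lless>\<^bsub>B\<^esub> e"
      using b' h(3) below a ae(2) by (intro bexI[of _ b]) auto
  next
    fix a b assume ab: "a \<in> carrier B" "b \<in> carrier B" "contact B a b"
    then obtain c' where c': "c' \<in> bdd B'" "contact B' (h a) (c' \<sqinter>\<^bsub>B'\<^esub> h b)"
      using B'.BC2[of "h a" "h b"] c h(2) by blast
    then obtain e where e: "e \<in> carrier B" "h e = c'" using surj ideal'(1) by blast
    then show "\<exists>c\<in>bdd B. contact B a (c \<sqinter>\<^bsub>B\<^esub> b)"
      using c' ab h(3) by (intro bexI[of _ e]) (simp_all add: h(2) meet)
  next
    fix a assume a: "a \<in> carrier B" "a \<noteq> \<bottom>\<^bsub>B\<^esub>"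
    then obtain b' where b': "b' \<in> bdd B'" "b' \<noteq> \<bottom>\<^bsub>B'\<^esub>" "b' \<lless>\<^bsub>B'\<^esub> h a"
      using B'.BC3[of "h a"] c bot_iff by blast
    then obtain b where "b \<in> carrier B" "h b = b'" using surj ideal'(1) by blast
    then show "\<exists>b\<in>bdd B. b \<noteq> \<bottom>\<^bsub>B\<^esub> \<and> b \<lless>\<^bsub>B\<^esub> a"
      using b' h(3) below bot_iff a by (intro bexI[of _ b]) auto
  qed
qed

lemma lca_isomorphic_trans:
  assumes "B \<cong>\<^sub>L\<^sub>C\<^sub>A B'" "B' \<cong>\<^sub>L\<^sub>C\<^sub>A B''"
  shows "B \<cong>\<^sub>L\<^sub>C\<^sub>A B''"
proof -
  obtain f where f: "bool_iso B B' f"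
    "\<And>a b. \<lbrakk>a \<in> carrier B; b \<in> carrier B\<rbrakk> \<Longrightarrow> contact B a b \<longleftrightarrow> contact B' (f a) (f b)"
    "\<And>a. a \<in> carrier B \<Longrightarrow> a \<in> bdd B \<longleftrightarrow> f a \<in> bdd B'"
    using assms(1) unfolding lca_isomorphic_def by blast
  obtain g where g: "bool_iso B' B'' g"
    "\<And>a b. \<lbrakk>a \<in> carrier B'; b \<in> carrier B'\<rbrakk> \<Longrightarrow> contact B' a b \<longleftrightarrow> contact B'' (g a) (g b)"
    "\<And>a. a \<in> carrier B' \<Longrightarrow> a \<in> bdd B' \<longleftrightarrow> g a \<in> bdd B''"
    using assms(2) unfolding lca_isomorphic_def by blast
  have fc: "f x \<in> carrier B'" if "x \<in> carrier B" for x
    using f(1) that by (auto simp: bool_iso_def bool_hom_def)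
  have gc: "g x \<in> carrier B''" if "x \<in> carrier B'" for x
    using g(1) that by (auto simp: bool_iso_def bool_hom_def)
  have "bool_hom B B'' (g \<circ> f)"
    using f(1) g(1) fc gc unfolding bool_iso_def bool_hom_def by simp
  moreover have "bij_betw (g \<circ> f) (carrier B) (carrier B'')"
    using f(1) g(1) by (auto simp: bool_iso_def intro: bij_betw_trans)
  ultimately have "bool_iso B B'' (g \<circ> f)" by (simp add: bool_iso_def)
  then show ?thesis
    unfolding lca_isomorphic_def using f(2,3) g(2,3) fc by (intro exI[of _ "g \<circ> f"]) simp
qed

section \<open>The space is determined by its local contact algebra\<close>

text \<open>
  The partner \<open>y\<close> of \<open>x\<close> lies in the images of all compact regular closed neighbourhoods of \<open>x\<close>.
  These images have the finite intersection property, because finitely many neighbourhoods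
  contain a smaller one, whose image is nonempty. Regularity of both spaces and preservation
  of disjointness then give the equivalence for all regular closed sets.
\<close>

lemma standard_lca_point:
  assumes X: "locally_compact_space X" "Hausdorff_space X"
    and Y: "locally_compact_space Y" "Hausdorff_space Y"
    and h: "bool_iso (standard_lca X) (standard_lca Y) h"
      "\<And>F G. \<lbrakk>F \<in> carrier (standard_lca X); G \<in> carrier (standard_lca X)\<rbrakk> \<Longrightarrow> F \<inter> G \<noteq> {} \<longleftrightarrow> h F \<inter> h G \<noteq> {}"
      "\<And>F. F \<in> carrier (standard_lca X) \<Longrightarrow> F \<in> bdd (standard_lca X) \<longleftrightarrow> h F \<in> bdd (standard_lca Y)"
    and x: "x \<in> topspace X"
  shows "\<exists>y\<in>topspace Y. \<forall>F\<in>carrier (standard_lca X). x \<in> F \<longleftrightarrow> y \<in> h F"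
proof -
  let ?X = "standard_lca X" and ?Y = "standard_lca Y"
  have ord: "h F \<subseteq> h G \<longleftrightarrow> F \<subseteq> G" if "F \<in> carrier ?X" "G \<in> carrier ?X" for F G
    using bool_iso_order_iso[OF standard_lca_algebra(1) standard_lca_algebra(1) h(1) that]
    by (simp add: standard_lca_simps(4))
  have hc: "h F \<in> carrier ?Y" if "F \<in> carrier ?X" for F
    using h(1) that by (auto simp: bool_iso_def bool_hom_def)
  have surj: "\<exists>F\<in>carrier ?X. G = h F" if "G \<in> carrier ?Y" for G
    using bij_betw_imp_surj_on[of h "carrier ?X" "carrier ?Y"] h(1)[unfolded bool_iso_def, THEN conjunct2] that
    by (metis imageE)
  define N where "N = {F \<in> bdd ?X. x \<in> X interior_of F}"
  have N: "F \<in> carrier ?X" "h F \<in> bdd ?Y" "x \<in> X interior_of F" if "F \<in> N" for F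
    using that h(3) by (auto simp: N_def standard_lca_simps(2))
  obtain F0 where F0: "F0 \<in> N"
    using standard_lca_neighbourhood[OF X openin_topspace x] unfolding N_def by blast
  have "h F0 \<inter> \<Inter>(h ` N) \<noteq> {}"
  proof -
    have "compactin Y (h F0)" using N(2)[OF F0] by (simp add: standard_lca_simps(2))
    moreover have "closedin Y C" if "C \<in> h ` N" for C
      using that N(1) hc standard_lca_closedin by blast
    moreover have "h F0 \<inter> \<Inter>\<F> \<noteq> {}" if \<F>: "finite \<F>" "\<F> \<subseteq> h ` N" for \<F>
    proof -
      obtain P where P: "finite P" "P \<subseteq> N" "\<F> = h ` P" using \<F> by (metis finite_subset_image)
      have "openin X (X interior_of F0 \<inter> (\<Inter>F\<in>P. X interior_of F))"
      proof (cases "P = {}")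
        case False
        then have "openin X (\<Inter>F\<in>P. X interior_of F)" using P(1) by (intro openin_Inter) auto
        then show ?thesis by (simp add: openin_Int)
      qed simp
      moreover have "x \<in> X interior_of F0 \<inter> (\<Inter>F\<in>P. X interior_of F)" using N(3) F0 P(2) by blast
      ultimately obtain G where G: "G \<in> bdd ?X" "x \<in> X interior_of G"
        "G \<subseteq> X interior_of F0 \<inter> (\<Inter>F\<in>P. X interior_of F)"
        by (rule standard_lca_neighbourhood[OF X])
      then have "G \<in> N" by (simp add: N_def)
      have "G \<subseteq> F" if "F \<in> insert F0 P" for F
        using G(3) that interior_of_subset[of X F] by blast
      then have sub: "h G \<subseteq> h F" if "F \<in> insert F0 P" for F
        using ord[OF N(1)[OF \<open>G \<in> N\<close>] N(1)] that F0 P(2) by blast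
      have "G \<noteq> {}" using G(2) interior_of_subset[of X G] by blast
      then have "h G \<noteq> {}" using h(2)[OF N(1)[OF \<open>G \<in> N\<close>] N(1)[OF \<open>G \<in> N\<close>]] by simp
      then show ?thesis using sub P(3) by blast
    qed
    ultimately show ?thesis
      using compactin_fip[THEN iffD1, THEN conjunct2, THEN spec, of Y "h F0" "h ` N"] by simp
  qed
  then obtain y where y: "y \<in> h F0" "\<And>F. F \<in> N \<Longrightarrow> y \<in> h F" by blast
  have yt: "y \<in> topspace Y" using y(1) hc[OF N(1)[OF F0]] by (auto simp: standard_lca_simps(1))
  have 1: "x \<in> F" if F: "F \<in> carrier ?X" "y \<in> h F" for F
  proof (rule ccontr)
    assume "x \<notin> F"
    then have "x \<in> topspace X - F" using x by simp
    with openin_diff[OF openin_topspace standard_lca_closedin[OF F(1)]] obtain G where G: "G \<in> bdd ?X" "x \<in> X interior_of G" "G \<subseteq> topspace X - F"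
      by (rule standard_lca_neighbourhood[OF X])
    then have GN: "G \<in> N" by (simp add: N_def)
    have "G \<inter> F = {}" using G(3) by blast
    then have "h G \<inter> h F = {}" using h(2)[OF N(1)[OF GN] F(1)] by blast
    then show False using y(2)[OF GN] F(2) by blast
  qed
  have 2: "y \<in> h F" if F: "F \<in> carrier ?X" "x \<in> F" for F
  proof (rule ccontr)
    assume "y \<notin> h F"
    then have "y \<in> topspace Y - h F" using yt by simp
    with openin_diff[OF openin_topspace standard_lca_closedin[OF hc[OF F(1)]]] obtain G where G: "G \<in> bdd ?Y" "y \<in> Y interior_of G" "G \<subseteq> topspace Y - h F"
      by (rule standard_lca_neighbourhood[OF Y])
    have "G \<in> carrier ?Y" using G(1) by (simp add: standard_lca_simps(2))
    then obtain G' where G': "G' \<in> carrier ?X" "G = h G'" using surj by blast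
    have "y \<in> h G'" using G(2) interior_of_subset[of Y G] G'(2) by blast
    then have "x \<in> G' \<inter> F" using 1[OF G'(1)] F(2) by blast
    then have "h G' \<inter> h F \<noteq> {}" using h(2)[OF G'(1) F(1)] by blast
    then show False using G(3) G'(2) by blast
  qed
  show ?thesis using yt 1 2 by blast
qed

text \<open>
  It suffices that regular closed sets have closed preimages: the complements of
  regular closed sets form a base of the topology.
\<close>

lemma standard_lca_continuous_map:
  assumes Y: "locally_compact_space Y" "Hausdorff_space Y"
    and f: "\<And>x. x \<in> topspace X \<Longrightarrow> f x \<in> topspace Y"
    and k: "\<And>G. G \<in> carrier (standard_lca Y) \<Longrightarrow> closedin X (k G)"
      "\<And>G x. \<lbrakk>G \<in> carrier (standard_lca Y); x \<in> topspace X\<rbrakk> \<Longrightarrow> x \<in> k G \<longleftrightarrow> f x \<in> G"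
  shows "continuous_map X Y f"
  unfolding continuous_map
proof (intro conjI allI impI)
  show "f ` topspace X \<subseteq> topspace Y" using f by blast
  fix V assume V: "openin Y V"
  show "openin X {x \<in> topspace X. f x \<in> V}"
    unfolding openin_subopen[of X "{x \<in> topspace X. f x \<in> V}"]
  proof
    fix x assume "x \<in> {x \<in> topspace X. f x \<in> V}"
    then have x: "x \<in> topspace X" "f x \<in> V" by simp_all
    obtain G where G: "G \<in> bdd (standard_lca Y)" "f x \<in> Y interior_of G" "G \<subseteq> V"
      by (rule standard_lca_neighbourhood[OF Y V x(2)])
    let ?C = "Y closure_of (topspace Y - G)"
    have Gc: "G \<in> carrier (standard_lca Y)" using G(1) by (simp add: standard_lca_simps(2))
    have C: "?C \<in> carrier (standard_lca Y)"
      using standard_lca_closedin[OF Gc] by (intro standard_lca_closure_open) blast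
    have CG: "topspace Y - G \<subseteq> ?C" by (simp add: closure_of_subset)
    have "f x \<notin> ?C" using G(2) by (simp add: closure_of_complement)
    then have "x \<in> topspace X - k ?C" using k(2)[OF C x(1)] x(1) by blast
    moreover have "openin X (topspace X - k ?C)" using k(1)[OF C] by blast
    moreover have "topspace X - k ?C \<subseteq> {x \<in> topspace X. f x \<in> V}"
      using k(2)[OF C] f CG G(3) by blast
    ultimately show "\<exists>T. openin X T \<and> x \<in> T \<and> T \<subseteq> {x \<in> topspace X. f x \<in> V}" by blast
  qed
qed

lemma standard_lca_separates:
  assumes X: "locally_compact_space X" "Hausdorff_space X"
    and xy: "x \<in> topspace X" "y \<in> topspace X"
    and same: "\<And>F. \<lbrakk>F \<in> carrier (standard_lca X); x \<in> F\<rbrakk> \<Longrightarrow> y \<in> F"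
  shows "x = y"
proof (rule ccontr)
  assume "x \<noteq> y"
  moreover have "closedin X {y}" using xy X(2) by (simp add: closedin_Hausdorff_singleton)
  ultimately have "openin X (topspace X - {y})" "x \<in> topspace X - {y}" using xy by auto
  then obtain F where F: "F \<in> bdd (standard_lca X)" "x \<in> X interior_of F" "F \<subseteq> topspace X - {y}"
    by (rule standard_lca_neighbourhood[OF X])
  then have "x \<in> F" using interior_of_subset[of X F] by blast
  then show False using same[of F] F(1,3) by (auto simp: standard_lca_simps(2))
qed

text \<open>
  The partners of points under the isomorphism and under its inverse give two continuous maps. They
  are mutually inverse, because a point is determined by the regular closed sets that contain it.
\<close>

theorem standard_lca_determines_space:
  assumes X: "locally_compact_space X" "Hausdorff_space X"
    and Y: "locally_compact_space Y" "Hausdorff_space Y"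
    and iso: "standard_lca X \<cong>\<^sub>L\<^sub>C\<^sub>A standard_lca Y"
  shows "X homeomorphic_space Y"
proof -
  let ?X = "standard_lca X" and ?Y = "standard_lca Y"
  obtain h where h: "bool_iso ?X ?Y h"
    "\<And>F G. \<lbrakk>F \<in> carrier ?X; G \<in> carrier ?X\<rbrakk> \<Longrightarrow> F \<inter> G \<noteq> {} \<longleftrightarrow> h F \<inter> h G \<noteq> {}"
    "\<And>F. F \<in> carrier ?X \<Longrightarrow> F \<in> bdd ?X \<longleftrightarrow> h F \<in> bdd ?Y"
    using iso unfolding lca_isomorphic_def standard_lca_simps(3) by (elim exE conjE) simp
  have bij: "bij_betw h (carrier ?X) (carrier ?Y)" using h(1) by (simp add: bool_iso_def)
  have hc: "h F \<in> carrier ?Y" if "F \<in> carrier ?X" for F using bij that by (auto simp: bij_betw_def)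
  define k where "k = inv_into (carrier ?X) h"
  have k: "k G \<in> carrier ?X" "h (k G) = G" if "G \<in> carrier ?Y" for G
    using bij that unfolding k_def by (auto simp: bij_betw_def inv_into_into f_inv_into_f)
  have kh: "k (h F) = F" if "F \<in> carrier ?X" for F
    using bij that unfolding k_def by (simp add: bij_betw_def)
  have k': "bool_iso ?Y ?X k"
  proof (rule order_iso_bool_iso[OF standard_lca_algebra(1) standard_lca_algebra(1)])
    show "bij_betw k (carrier ?Y) (carrier ?X)" unfolding k_def using bij by (rule bij_betw_inv_into)
    show "k F \<sqsubseteq>\<^bsub>?X\<^esub> k G \<longleftrightarrow> F \<sqsubseteq>\<^bsub>?Y\<^esub> G" if "F \<in> carrier ?Y" "G \<in> carrier ?Y" for F G
      using bool_iso_order_iso[OF standard_lca_algebra(1) standard_lca_algebra(1) h(1) k(1)[OF that(1)] k(1)[OF that(2)]]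
        k(2) that by simp
  qed
  have "\<exists>y\<in>topspace Y. \<forall>F\<in>carrier ?X. x \<in> F \<longleftrightarrow> y \<in> h F" if "x \<in> topspace X" for x
    using standard_lca_point[OF X Y h that] .
  then obtain f where f: "\<And>x. x \<in> topspace X \<Longrightarrow> f x \<in> topspace Y"
    "\<And>x F. \<lbrakk>x \<in> topspace X; F \<in> carrier ?X\<rbrakk> \<Longrightarrow> x \<in> F \<longleftrightarrow> f x \<in> h F" by metis
  have "\<exists>x\<in>topspace X. \<forall>G\<in>carrier ?Y. y \<in> G \<longleftrightarrow> x \<in> k G" if "y \<in> topspace Y" for y
  proof (rule standard_lca_point[OF Y X k' _ _ that])
    show "F \<inter> G \<noteq> {} \<longleftrightarrow> k F \<inter> k G \<noteq> {}" if "F \<in> carrier ?Y" "G \<in> carrier ?Y" for F G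
      using h(2)[OF k(1)[OF that(1)] k(1)[OF that(2)]] k(2) that by simp
    show "F \<in> bdd ?Y \<longleftrightarrow> k F \<in> bdd ?X" if "F \<in> carrier ?Y" for F
      using h(3)[OF k(1)[OF that]] k(2) that by simp
  qed
  then obtain g where g: "\<And>y. y \<in> topspace Y \<Longrightarrow> g y \<in> topspace X"
    "\<And>y G. \<lbrakk>y \<in> topspace Y; G \<in> carrier ?Y\<rbrakk> \<Longrightarrow> y \<in> G \<longleftrightarrow> g y \<in> k G" by metis
  have "continuous_map X Y f"
  proof (rule standard_lca_continuous_map[where k = k, OF Y f(1)])
    show "closedin X (k G)" if "G \<in> carrier ?Y" for G
      using standard_lca_closedin k(1) that by blast
    show "x \<in> k G \<longleftrightarrow> f x \<in> G" if "G \<in> carrier ?Y" "x \<in> topspace X" for G x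
      using that f(2)[OF _ k(1)] k(2) by simp
  qed
  moreover have "continuous_map Y X g"
  proof (rule standard_lca_continuous_map[where k = h, OF X g(1)])
    show "closedin Y (h F)" if "F \<in> carrier ?X" for F
      using standard_lca_closedin hc that by blast
    show "y \<in> h F \<longleftrightarrow> g y \<in> F" if "F \<in> carrier ?X" "y \<in> topspace Y" for F y
      using that g(2)[OF _ hc] kh by simp
  qed
  moreover have "g (f x) = x" if "x \<in> topspace X" for x
    using that f g hc kh by (intro sym[OF standard_lca_separates[OF X]]) metis+
  moreover have "f (g y) = y" if "y \<in> topspace Y" for y
    using that f g k by (intro sym[OF standard_lca_separates[OF Y]]) metis+
  ultimately have "homeomorphic_maps X Y f g" by (simp add: homeomorphic_maps_def)
  then show ?thesis unfolding homeomorphic_space_def by blast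
qed

section \<open>Nested subdivisions of the real line\<close>

text \<open>
  The nodes of a subdivision are numbered by all integers, but the intervals between them have
  labels in \<^const>\<open>Z0\<close>. The interval with label \<open>p\<close> lies between the nodes \<open>idx p\<close> and \<open>idx p + 1\<close>, so that
  neighbours in \<^const>\<open>Z0\<close> label adjacent intervals.
\<close>

definition idx :: "int \<Rightarrow> int" where
  "idx p = (if 0 < p then p - 1 else p)"

definition label :: "int \<Rightarrow> int" where
  "label j = (if 0 \<le> j then j + 1 else j)"

lemma label: "label j \<in> Z0" "idx (label j) = j"
  by (auto simp: label_def idx_def Z0_def)

lemma idx_simps:
  assumes "p \<in> Z0"
  shows "idx (zpred p) = idx p - 1" "idx (zsucc p) = idx p + 1" "q \<in> Z0 \<Longrightarrow> idx p = idx q \<longleftrightarrow> p = q"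
  using assms by (auto simp: idx_def zpred_def zsucc_def Z0_def)

lemma idx_bounds:
  assumes "p \<in> Z0" "1 \<le> r"
  shows "idx p \<le> - int r \<longleftrightarrow> p \<le> - int r" "idx p < - int r \<longleftrightarrow> p < - int r"
    "int r \<le> idx p \<longleftrightarrow> int r < p" "int r \<le> idx p + 1 \<longleftrightarrow> int r \<le> p"
  using assms by (auto simp: idx_def Z0_def)

text \<open>
  The nodes of the subdivision of the unit interval. They accumulate at both ends, so no part of the
  subdivision touches an end; and no step exceeds one half, so repeated subdivision shrinks lengths
  to zero.
\<close>

definition grid :: "int \<Rightarrow> real" where
  "grid j = (if 0 \<le> j then 1 - 1 / (of_int j + 2) else 1 / (2 - of_int j))"

lemma grid_bounds: "0 < grid j" "grid j < 1"
  by (auto simp: grid_def field_simps)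

lemma grid_step: "grid j < grid (j + 1)" "grid (j + 1) - grid j \<le> 1 / 2"
proof -
  consider "0 \<le> j" | "j = - 1" | "j < - 1" by linarith
  then have "grid j < grid (j + 1) \<and> grid (j + 1) - grid j \<le> 1 / 2"
  proof cases
    case 1
    then have "1 / (of_int j + 3) < 1 / (of_int j + 2 :: real)" "1 / (of_int j + 2) \<le> (1 / 2 :: real)"
      "0 < 1 / (of_int j + 3 :: real)"
      by (simp_all add: field_simps)
    moreover have "grid j = 1 - 1 / (of_int j + 2)" "grid (j + 1) = 1 - 1 / (of_int j + 3)"
      using 1 by (simp_all add: grid_def add.commute add.left_commute)
    ultimately show ?thesis by linarith
  next
    case 3
    then have "real_of_int j < - 1" by linarith
    then have "1 / (2 - of_int j) < 1 / (1 - of_int j :: real)" "1 / (1 - of_int j) \<le> (1 / 2 :: real)"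
      "0 < 1 / (2 - of_int j :: real)"
      by (simp_all add: field_simps)
    moreover have "grid j = 1 / (2 - of_int j)" "grid (j + 1) = 1 / (1 - of_int j)"
      using 3 by (simp_all add: grid_def)
    ultimately show ?thesis by linarith
  qed (simp add: grid_def)
  then show "grid j < grid (j + 1)" "grid (j + 1) - grid j \<le> 1 / 2" by blast+
qed

lemma strict_mono_int_step:
  fixes f :: "int \<Rightarrow> real"
  assumes "\<And>j. f j < f (j + 1)"
  shows "strict_mono f"
proof (rule strict_monoI)
  fix i j :: int assume "i < j"
  then show "f i < f j"
  proof (induction j rule: int_gr_induct)
    case (step j)
    then show ?case using assms[of j] by linarith
  qed (rule assms)
qed

lemma grid_strict_mono: "strict_mono grid"
  by (rule strict_mono_int_step) (rule grid_step)

lemma grid_floor: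
  assumes "0 < t" "t < 1"
  obtains j where "grid j \<le> t" "t < grid (j + 1)"
proof (cases "1 / 2 \<le> t")
  case True
  define s where "s = 1 / (1 - t)"
  have s: "2 \<le> s" "1 - 1 / s = t" using True assms by (simp_all add: s_def field_simps)
  define j where "j = \<lfloor>s\<rfloor> - 2"
  have j: "0 \<le> j" "of_int j + 2 \<le> s" "s < of_int j + 3" using s(1) unfolding j_def by linarith+
  have "1 / s \<le> 1 / (of_int j + 2)" "1 / (of_int j + 3) < 1 / s"
    using j s(1) by (simp_all add: field_simps)
  then show thesis
    using j(1) s(2) by (intro that[of j]) (simp_all add: grid_def add.commute add.left_commute)
next
  case False
  define s where "s = 1 / t"
  have s: "2 < s" "1 / s = t" using False assms by (simp_all add: s_def field_simps)
  define j where "j = 2 - \<lceil>s\<rceil>"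
  have j: "j < 0" "s \<le> 2 - of_int j" "1 - of_int j < s" using s(1) unfolding j_def by linarith+
  have 1: "1 / (2 - of_int j) \<le> t" using j s by (simp add: field_simps flip: s(2))
  have 2: "t < 1 / (1 - of_int j)" if "j \<noteq> - 1" using j that s by (simp add: field_simps flip: s(2))
  show thesis
  proof (rule that[of j])
    show "grid j \<le> t" using j(1) 1 by (simp add: grid_def)
    show "t < grid (j + 1)" using j(1) 2 False by (cases "j = - 1") (simp_all add: grid_def)
  qed
qed

text \<open>
  \<open>node k n\<close> numbers the subdivision of the interval with labels \<open>n 1, \<dots>, n k\<close>; for \<open>k = 0\<close> this
  is the whole line, subdivided at the integers.
\<close>

primrec node :: "nat \<Rightarrow> (nat \<Rightarrow> int) \<Rightarrow> int \<Rightarrow> real" where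
  "node 0 n j = of_int j"
| "node (Suc k) n j = node k n (idx (n (Suc k)))
     + (node k n (idx (n (Suc k)) + 1) - node k n (idx (n (Suc k)))) * grid j"

definition lo :: "nat \<Rightarrow> (nat \<Rightarrow> int) \<Rightarrow> real" where
  "lo k n = node (k - 1) n (idx (n k))"

definition hi :: "nat \<Rightarrow> (nat \<Rightarrow> int) \<Rightarrow> real" where
  "hi k n = node (k - 1) n (idx (n k) + 1)"

definition cell :: "nat \<Rightarrow> (nat \<Rightarrow> int) \<Rightarrow> real set" where
  "cell k n = {lo k n..hi k n}"

text \<open>
  The counterpart of \<^const>\<open>qel\<close>: a neighbourhood of the left endpoint of a cell. It ends at node \<open>r\<close> of the
  cell to the left and at node \<open>- r\<close> of the cell itself.
\<close>

definition collar :: "nat \<Rightarrow> (nat \<Rightarrow> int) \<Rightarrow> nat \<Rightarrow> real set" where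
  "collar k n r = {node k (n(k := zpred (n k))) (int r)..node k n (- int r)}"

lemma node_cong: "(\<And>i. i \<in> {1..k} \<Longrightarrow> n i = n' i) \<Longrightarrow> node k n = node k n'"
proof (induction k)
  case (Suc k)
  then have "node k n = node k n'" "n (Suc k) = n' (Suc k)" by simp_all
  then show ?case by (intro ext) simp
qed (simp add: fun_eq_iff)

lemma node_eq:
  assumes "1 \<le> k"
  shows "node k n j = lo k n + (hi k n - lo k n) * grid j"
  using assms by (cases k) (simp_all add: lo_def hi_def)

lemma lo_hi_cong:
  assumes "\<And>i. i \<in> {1..k} \<Longrightarrow> n i = n' i" "1 \<le> k"
  shows "lo k n = lo k n'" "hi k n = hi k n'"
proof -
  have "node (k - 1) n = node (k - 1) n'" "n k = n' k" using assms by (auto intro!: node_cong)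
  then show "lo k n = lo k n'" "hi k n = hi k n'" unfolding lo_def hi_def by simp_all
qed

lemma node_strict_mono: "strict_mono (node k n)"
proof (induction k)
  case 0
  show ?case by (rule strict_monoI) simp
next
  case (Suc k)
  then have "node k n (idx (n (Suc k))) < node k n (idx (n (Suc k)) + 1)" by (rule strict_monoD) simp
  then show ?case
    using grid_strict_mono by (intro strict_monoI) (simp add: strict_mono_less)
qed

lemmas node_less = strict_mono_less[OF node_strict_mono]
  and node_le = strict_mono_less_eq[OF node_strict_mono]

lemma lo_less_hi: "lo k n < hi k n"
  by (simp add: lo_def hi_def node_less)

lemma node_between:
  assumes "1 \<le> k" "k \<le> l"
  shows "lo k n < node l n j" "node l n j < hi k n"
proof -
  have *: "lo i n < node i n j" "node i n j < hi i n" if "1 \<le> i" for i j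
  proof -
    have "0 < (hi i n - lo i n) * grid j" "(hi i n - lo i n) * grid j < (hi i n - lo i n) * 1"
      using lo_less_hi[of i n] grid_bounds[of j] by (simp_all only: mult_strict_left_mono mult_pos_pos diff_gt_0_iff_gt)
    then show "lo i n < node i n j" "node i n j < hi i n" by (simp_all add: node_eq[OF that])
  qed
  have "\<forall>j. lo k n < node l n j \<and> node l n j < hi k n"
    using assms(2)
  proof (induction l rule: dec_induct)
    case base
    then show ?case using * assms(1) by blast
  next
    case (step l)
    have "lo k n < lo (Suc l) n" "hi (Suc l) n < hi k n" using step.IH by (simp_all add: lo_def hi_def)
    moreover have "lo (Suc l) n < node (Suc l) n j" "node (Suc l) n j < hi (Suc l) n" for j
      by (rule *; simp)+
    ultimately show ?case by (meson order_less_trans)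
  qed
  then show "lo k n < node l n j" "node l n j < hi k n" by blast+
qed

lemma cell_length:
  assumes "1 \<le> k"
  shows "hi k n - lo k n \<le> (1 / 2) ^ (k - 1)"
  using assms
proof (induction k rule: dec_induct)
  case base
  show ?case by (simp add: lo_def hi_def)
next
  case (step k)
  let ?j = "idx (n (Suc k))"
  have "hi (Suc k) n - lo (Suc k) n = (hi k n - lo k n) * (grid (?j + 1) - grid ?j)"
    unfolding lo_def[of "Suc k"] hi_def[of "Suc k"] by (simp add: node_eq[OF step(1)] algebra_simps)
  also have "\<dots> \<le> (1 / 2) ^ (k - 1) * (1 / 2)"
    using step.IH lo_less_hi[of k n] grid_step[of ?j] by (intro mult_mono) simp_all
  also have "\<dots> = (1 / 2) ^ (Suc k - 1)" using step(1) by (cases k) simp_all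
  finally show ?case .
qed

section \<open>Contact of the intervals\<close>

text \<open>
  A common bound for the cell and the collars with the labels \<open>n 1, \<dots>, n k\<close>. The right end is included
  because it belongs to the cell; the left end is not reached, although collars extend into the cell
  to the left. The seat lies in the interior of every cell that is named by fewer of these labels.
\<close>

definition seat :: "nat \<Rightarrow> (nat \<Rightarrow> int) \<Rightarrow> real set" where
  "seat k n = {node (k - 1) n (idx (n k) - 1)<..node (k - 1) n (idx (n k) + 1)}"

lemma collar_bounds:
  assumes "admissible k n"
  shows "node (k - 1) n (idx (n k) - 1) < node k (n(k := zpred (n k))) j"
    "node k (n(k := zpred (n k))) j < lo k n" "lo k n < node k n j" "node k n j < hi k n"
proof -
  let ?m = "n(k := zpred (n k))"
  have k: "1 \<le> k" "n k \<in> Z0" using assms by (auto simp: admissible_def)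
  have "node (k - 1) ?m = node (k - 1) n" by (rule node_cong) auto
  then have "lo k ?m = node (k - 1) n (idx (n k) - 1)" "hi k ?m = lo k n"
    by (simp_all add: lo_def hi_def idx_simps(1)[OF k(2)])
  then show "node (k - 1) n (idx (n k) - 1) < node k ?m j" "node k ?m j < lo k n"
    using node_between[OF k(1) order_refl, of ?m j] by simp_all
  show "lo k n < node k n j" "node k n j < hi k n" using node_between[OF k(1) order_refl] by blast+
qed

lemma seat_contains:
  assumes "admissible k n"
  shows "cell k n \<subseteq> seat k n" "collar k n r \<subseteq> seat k n" "lo k n \<in> cell k n" "lo k n \<in> collar k n r"
proof -
  note b = collar_bounds[OF assms]
  have "node (k - 1) n (idx (n k) - 1) < lo k n" by (simp add: lo_def node_less)
  then show "cell k n \<subseteq> seat k n" by (auto simp: cell_def seat_def hi_def)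
  show "collar k n r \<subseteq> seat k n"
    using b(1)[of "int r"] b(4)[of "- int r"] by (auto simp: collar_def seat_def hi_def)
  show "lo k n \<in> cell k n" using lo_less_hi[of k n] by (simp add: cell_def)
  show "lo k n \<in> collar k n r"
    using b(2)[of "int r"] b(3)[of "- int r"] by (simp add: collar_def)
qed

lemma seat_deep:
  assumes "1 \<le> i" "i < k"
  shows "seat k n \<subseteq> {lo i n<..<hi i n}"
proof -
  have "i \<le> k - 1" using assms(2) by simp
  note * = node_between[OF assms(1) this, of n]
  show ?thesis using *(1)[of "idx (n k) - 1"] *(2)[of "idx (n k) + 1"] by (auto simp: seat_def)
qed

lemma cell_open_disjoint:
  assumes "1 \<le> k" "\<And>i. i \<in> {1..<k} \<Longrightarrow> n i = n' i" "n k \<in> Z0" "n' k \<in> Z0" "n k \<noteq> n' k"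
  shows "cell k n \<inter> {lo k n'<..<hi k n'} = {}"
proof -
  have N: "node (k - 1) n' = node (k - 1) n" using assms(2) by (intro node_cong) auto
  have "idx (n k) \<noteq> idx (n' k)" using assms idx_simps(3) by blast
  then have "idx (n k) + 1 \<le> idx (n' k) \<or> idx (n' k) + 1 \<le> idx (n k)" by linarith
  then have "hi k n \<le> lo k n' \<or> hi k n' \<le> lo k n"
    unfolding lo_def hi_def N node_le .
  then show ?thesis by (auto simp: cell_def)
qed

lemma first_difference:
  assumes "i \<in> {1..k}" "n i \<noteq> n' i"
  obtains j :: nat where "j \<in> {1..k}" "n j \<noteq> n' j" "\<And>m. m \<in> {1..<j} \<Longrightarrow> n m = n' m"
proof -
  define j where "j = (LEAST j. j \<in> {1..k} \<and> n j \<noteq> n' j)"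
  have j: "j \<in> {1..k}" "n j \<noteq> n' j"
    using LeastI[of "\<lambda>j. j \<in> {1..k} \<and> n j \<noteq> n' j" i] assms unfolding j_def by blast+
  moreover have "n m = n' m" if "m \<in> {1..<j}" for m
    using not_less_Least[of m "\<lambda>j. j \<in> {1..k} \<and> n j \<noteq> n' j"] that j(1) unfolding j_def by auto
  ultimately show thesis using that by blast
qed

text \<open>
  At the first difference the labels name two cells with disjoint interiors. Both intervals belong
  to deeper levels, so each of them lies in the interior of its cell.
\<close>

lemma seat_disjoint:
  assumes "admissible k n" "admissible l n'" "k \<le> l" "i \<in> {1..<k}" "n i \<noteq> n' i"
  shows "seat k n \<inter> seat l n' = {}"
proof -
  have "i \<in> {1..k - 1}" using assms(4) by auto
  then obtain j where j: "j \<in> {1..k - 1}" "n j \<noteq> n' j" and eq: "\<And>m. m \<in> {1..<j} \<Longrightarrow> n m = n' m"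
    using assms(5) by (rule first_difference) blast
  have less: "1 \<le> j" "j < k" "j < l" using j(1) assms(3) by auto
  have "cell j n \<inter> {lo j n'<..<hi j n'} = {}"
    using assms(1-3) j eq by (intro cell_open_disjoint) (auto simp: admissible_def)
  moreover have "seat k n \<subseteq> cell j n" "seat l n' \<subseteq> {lo j n'<..<hi j n'}"
    using seat_deep[OF less(1,2), of n] seat_deep[OF less(1,3), of n'] by (auto simp: cell_def)
  ultimately show ?thesis by blast
qed

lemma cell_meets_deep:
  assumes ad: "admissible k n" "admissible l n'" and kl: "k < l" and G: "G \<subseteq> seat l n'" "G \<noteq> {}"
  shows "cell k n \<inter> G \<noteq> {} \<longleftrightarrow> (\<forall>i\<in>{1..k}. n i = n' i)"
proof -
  have k: "1 \<le> k" using ad by (simp add: admissible_def)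
  have deep: "G \<subseteq> {lo k n'<..<hi k n'}" using G(1) seat_deep[OF k kl] by blast
  consider "\<forall>i\<in>{1..k}. n i = n' i" | i where "i \<in> {1..<k}" "n i \<noteq> n' i"
    | "\<forall>i\<in>{1..<k}. n i = n' i" "n k \<noteq> n' k"
    by (metis atLeastAtMost_iff atLeastLessThan_iff le_neq_implies_less)
  then show ?thesis
  proof cases
    case 1
    then have "G \<subseteq> cell k n" using deep lo_hi_cong[of k n n'] k by (auto simp: cell_def)
    then show ?thesis using 1 G(2) by blast
  next
    case 2
    then have "cell k n \<inter> G = {}" using seat_disjoint[OF ad _ 2] seat_contains(1)[OF ad(1)] G(1) kl by force
    then show ?thesis using 2 by auto
  next
    case 3
    then have "cell k n \<inter> {lo k n'<..<hi k n'} = {}"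
      using ad k kl by (intro cell_open_disjoint) (auto simp: admissible_def)
    then show ?thesis using 3(2) deep k by auto
  qed
qed

theorem cells_meet_iff:
  assumes ad: "admissible k n" "admissible l n'" and kl: "k \<le> l"
  shows "cell k n \<inter> cell l n' \<noteq> {} \<longleftrightarrow> touch_bb k n l n'"
proof (cases "k = l")
  case False
  have "(\<forall>i\<in>{1..k}. n i = n' i) \<longleftrightarrow> (\<forall>i\<in>{1..<k}. n i = n' i) \<and> n' k = n k"
    using ad(1) by (auto simp: admissible_def le_less)
  then show ?thesis
    using cell_meets_deep[OF ad _ seat_contains(1)[OF ad(2)]] seat_contains(3)[OF ad(2)] False kl
    by (auto simp: touch_bb_def)
next
  case True
  show ?thesis
  proof (cases "\<forall>i\<in>{1..<k}. n i = n' i")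
    case False
    then obtain i where "i \<in> {1..<k}" "n i \<noteq> n' i" by blast
    then have "cell k n \<inter> cell l n' = {}"
      using seat_disjoint[OF ad kl] seat_contains(1)[OF ad(1)] seat_contains(1)[OF ad(2)] by blast
    then show ?thesis using False by (simp add: touch_bb_def)
  next
    case agree: True
    then have N: "node (k - 1) n' = node (k - 1) n" by (intro node_cong) auto
    have Z: "n k \<in> Z0" "n' k \<in> Z0" using ad True by (auto simp: admissible_def)
    have "cell k n \<inter> cell l n' \<noteq> {} \<longleftrightarrow> lo k n \<le> hi k n' \<and> lo k n' \<le> hi k n"
      using lo_less_hi[of k n] lo_less_hi[of k n'] True by (auto simp: cell_def)
    also have "\<dots> \<longleftrightarrow> idx (n k) \<le> idx (n' k) + 1 \<and> idx (n' k) \<le> idx (n k) + 1"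
      unfolding lo_def hi_def N node_le ..
    also have "\<dots> \<longleftrightarrow> idx (n' k) = idx (n k) - 1 \<or> idx (n' k) = idx (n k) \<or> idx (n' k) = idx (n k) + 1"
      by linarith
    also have "\<dots> \<longleftrightarrow> n' k \<in> {zpred (n k), n k, zsucc (n k)}"
      using idx_simps(3)[OF Z(2)] idx_simps(1,2)[OF Z(1)] Z(1) zpred_immediate(1) zsucc_immediate(1)
      by (metis insert_iff singletonD)
    finally show ?thesis using True agree by (simp add: touch_bb_def)
  qed
qed

text \<open>
  A collar meets just two cells of its own level, each in a one-sided neighbourhood of the common
  endpoint.
\<close>

lemma collar_meets_deep:
  assumes ad: "admissible k n" "admissible l n'" and kl: "k < l" and G: "G \<subseteq> seat l n'"
  shows "collar k n r \<inter> G \<noteq> {} \<longleftrightarrow> (\<forall>i\<in>{1..<k}. n i = n' i)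
    \<and> ((n' k = n k \<and> (\<exists>x\<in>G. x \<le> node k n' (- int r)))
      \<or> (n' k = zpred (n k) \<and> (\<exists>x\<in>G. node k n' (int r) \<le> x)))"
proof -
  let ?m = "n(k := zpred (n k))"
  have k: "1 \<le> k" "n k \<in> Z0" "n' k \<in> Z0" using ad kl by (auto simp: admissible_def)
  have deep: "G \<subseteq> {lo k n'<..<hi k n'}" using G seat_deep[OF k(1) kl] by blast
  note b = collar_bounds[OF ad(1)]
  have split: "zpred (n k) \<noteq> n k" using zpred_immediate(2)[OF k(2)] by simp
  show ?thesis
  proof (cases "\<forall>i\<in>{1..<k}. n i = n' i")
    case False
    then obtain i where i: "i \<in> {1..<k}" "n i \<noteq> n' i" by blast
    have "collar k n r \<inter> G = {}"
      using seat_disjoint[OF ad _ i] seat_contains(2)[OF ad(1), of r] G kl by force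
    then show ?thesis using False by simp
  next
    case agree: True
    then have N: "node (k - 1) n' = node (k - 1) n" by (intro node_cong) auto
    consider "n' k = n k" | "n' k = zpred (n k)" | "n' k \<noteq> n k" "n' k \<noteq> zpred (n k)" by blast
    then show ?thesis
    proof cases
      case 1
      then have "i \<in> {1..k} \<Longrightarrow> n i = n' i" for i using agree by (cases "i = k") auto
      then have M: "node k n' = node k n" "lo k n' = lo k n" using node_cong lo_hi_cong k(1) by metis+
      have "x \<in> collar k n r \<longleftrightarrow> x \<le> node k n' (- int r)" if "x \<in> G" for x
        using deep that b(2)[of "int r"] unfolding collar_def M by force
      then show ?thesis using agree 1 split by auto
    next
      case 2
      then have "i \<in> {1..k} \<Longrightarrow> ?m i = n' i" for i using agree by (cases "i = k") auto
      then have M: "node k ?m = node k n'" by (rule node_cong)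
      have "hi k n' = lo k n" by (simp add: hi_def lo_def N 2 idx_simps(1)[OF k(2)] del: One_nat_def)
      then have "x \<in> collar k n r \<longleftrightarrow> node k n' (int r) \<le> x" if "x \<in> G" for x
        using deep that b(3)[of "- int r"] unfolding collar_def M by force
      then show ?thesis using agree 2 split by auto
    next
      case 3
      have "idx (n' k) \<noteq> idx (n k)" "idx (n' k) \<noteq> idx (n k) - 1"
        using 3 k idx_simps(3)[OF k(3)] idx_simps(1)[OF k(2)] zpred_immediate(1)[OF k(2)] by metis+
      then have "idx (n k) + 1 \<le> idx (n' k) \<or> idx (n' k) + 1 \<le> idx (n k) - 1" by linarith
      then have "hi k n \<le> lo k n' \<or> hi k n' \<le> node (k - 1) n (idx (n k) - 1)"
        unfolding lo_def hi_def N node_le .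
      then have "collar k n r \<inter> G = {}"
        using deep b(1)[of "int r"] b(4)[of "- int r"] by (force simp: collar_def)
      then show ?thesis using 3 by simp
    qed
  qed
qed

text \<open>
  At least two levels down an interval lies in the open interval between two consecutive nodes of
  level \<open>k\<close>. It cannot touch the end of a collar from outside, hence the strict inequalities.
\<close>

lemma seat_deeper:
  assumes ad: "admissible l n'" and l: "k + 1 < l" and r: "1 \<le> r" and G: "G \<subseteq> seat l n'" "G \<noteq> {}"
  shows "(\<exists>x\<in>G. x \<le> node k n' (- int r)) \<longleftrightarrow> n' (k + 1) < - int r"
    "(\<exists>x\<in>G. node k n' (int r) \<le> x) \<longleftrightarrow> n' (k + 1) > int r"
    "n' (k + 1) < - int r \<Longrightarrow> G \<subseteq> {..node k n' (- int r)}"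
    "n' (k + 1) > int r \<Longrightarrow> G \<subseteq> {node k n' (int r)..}"
proof -
  have Z: "n' (k + 1) \<in> Z0" using ad l by (auto simp: admissible_def)
  let ?a = "idx (n' (k + 1))"
  have deep: "G \<subseteq> {node k n' ?a<..<node k n' (?a + 1)}"
    using G(1) seat_deep[of "k + 1" l n'] l by (simp add: lo_def hi_def)
  have 1: "?a < - int r" if "x \<in> G" "x \<le> node k n' (- int r)" for x
  proof -
    have "node k n' ?a < node k n' (- int r)" using deep that by force
    then show ?thesis by (simp add: node_less)
  qed
  have 2: "int r \<le> ?a" if "x \<in> G" "node k n' (int r) \<le> x" for x
  proof -
    have "node k n' (int r) < node k n' (?a + 1)" using deep that by force
    then show ?thesis by (simp add: node_less)
  qed
  have 3: "G \<subseteq> {..node k n' (- int r)}" if "?a < - int r"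
  proof -
    have "node k n' (?a + 1) \<le> node k n' (- int r)" using that by (simp add: node_le)
    then show ?thesis using deep by force
  qed
  have 4: "G \<subseteq> {node k n' (int r)..}" if "int r \<le> ?a"
  proof -
    have "node k n' (int r) \<le> node k n' ?a" using that by (simp add: node_le)
    then show ?thesis using deep by force
  qed
  note i = idx_bounds[OF Z r]
  show "(\<exists>x\<in>G. x \<le> node k n' (- int r)) \<longleftrightarrow> n' (k + 1) < - int r"
    "(\<exists>x\<in>G. node k n' (int r) \<le> x) \<longleftrightarrow> n' (k + 1) > int r"
    using 1 2 3 4 i G(2) by blast+
  show "n' (k + 1) < - int r \<Longrightarrow> G \<subseteq> {..node k n' (- int r)}"
    "n' (k + 1) > int r \<Longrightarrow> G \<subseteq> {node k n' (int r)..}" using 3 4 i by blast+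
qed

theorem collar_meets_cell_iff:
  assumes ad: "admissible k n" "admissible l n'" and r: "1 \<le> r"
  shows "collar k n r \<inter> cell l n' \<noteq> {} \<longleftrightarrow> touch_qb k n r l n'"
proof -
  note b = collar_bounds[OF ad(1)] and s = seat_contains(1)[OF ad(2)]
  have k: "1 \<le> k" using ad by (auto simp: admissible_def)
  consider "l < k" | "l = k" | "l = k + 1" | "k + 1 < l" by linarith
  then show ?thesis
  proof cases
    case 1
    have "collar k n r \<noteq> {}" using seat_contains(4)[OF ad(1)] by blast
    then have "cell l n' \<inter> collar k n r \<noteq> {} \<longleftrightarrow> (\<forall>i\<in>{1..l}. n' i = n i)"
      by (rule cell_meets_deep[OF ad(2,1) 1 seat_contains(2)[OF ad(1)]])
    then show ?thesis
      using 1 by (simp add: touch_qb_def Int_commute eq_commute[of "n _"])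
  next
    case 2
    show ?thesis
    proof (cases "\<forall>i\<in>{1..<k}. n i = n' i")
      case False
      then obtain i where i: "i \<in> {1..<k}" "n i \<noteq> n' i" by blast
      have "collar k n r \<inter> cell l n' = {}"
        using seat_disjoint[OF ad _ i] seat_contains(2)[OF ad(1), of r] s 2 by force
      then show ?thesis using False 2 by (simp add: touch_qb_def)
    next
      case agree: True
      then have N: "node (k - 1) n' = node (k - 1) n" by (intro node_cong) auto
      have Z: "n k \<in> Z0" "n' k \<in> Z0" using ad 2 by (auto simp: admissible_def)
      let ?a = "idx (n k)" and ?a' = "idx (n' k)"
      have "collar k n r \<inter> cell l n' \<noteq> {} \<longleftrightarrow> ?a' = ?a - 1 \<or> ?a' = ?a"
      proof (cases "?a' = ?a - 1 \<or> ?a' = ?a")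
        case True
        then have "lo k n = lo k n' \<or> lo k n = hi k n'" unfolding lo_def hi_def N by auto
        then have "lo k n \<in> cell l n'" using lo_less_hi[of k n'] 2 by (auto simp: cell_def)
        then show ?thesis using seat_contains(4)[OF ad(1), of r] True by blast
      next
        case False
        then have "?a + 1 \<le> ?a' \<or> ?a' + 1 \<le> ?a - 1" by linarith
        then have "hi k n \<le> lo k n' \<or> hi k n' \<le> node (k - 1) n (?a - 1)"
          unfolding lo_def hi_def N node_le .
        then have "collar k n r \<inter> cell l n' = {}"
          using b(1)[of "int r"] b(4)[of "- int r"] 2 by (force simp: collar_def cell_def)
        then show ?thesis using False by simp
      qed
      also have "\<dots> \<longleftrightarrow> n' k \<in> {zpred (n k), n k}"
        using idx_simps(3)[OF Z(2)] idx_simps(1)[OF Z(1)] Z(1) zpred_immediate(1)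
        by (metis insert_iff singletonD)
      finally show ?thesis using agree 2 by (simp add: touch_qb_def)
    qed
  next
    case 3
    let ?a = "idx (n' (k + 1))"
    have Z: "n' (k + 1) \<in> Z0" using ad 3 by (auto simp: admissible_def)
    have c: "cell l n' = {node k n' ?a..node k n' (?a + 1)}" by (simp add: 3 cell_def lo_def hi_def)
    have "node k n' ?a < node k n' (?a + 1)" by (simp add: node_less)
    then have "(\<exists>x\<in>cell l n'. x \<le> node k n' (- int r)) \<longleftrightarrow> node k n' ?a \<le> node k n' (- int r)"
      "(\<exists>x\<in>cell l n'. node k n' (int r) \<le> x) \<longleftrightarrow> node k n' (int r) \<le> node k n' (?a + 1)"
      unfolding c by force+
    then have "(\<exists>x\<in>cell l n'. x \<le> node k n' (- int r)) \<longleftrightarrow> n' (k + 1) \<le> - int r"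
      "(\<exists>x\<in>cell l n'. node k n' (int r) \<le> x) \<longleftrightarrow> n' (k + 1) \<ge> int r"
      unfolding node_le idx_bounds[OF Z r] .
    then show ?thesis
      using collar_meets_deep[OF ad _ s, of r] 3 by (auto simp: touch_qb_def)
  next
    case 4
    have "cell l n' \<noteq> {}" using seat_contains(3)[OF ad(2)] by blast
    note d = seat_deeper[OF ad(2) 4 r s this]
    show ?thesis
      using collar_meets_deep[OF ad _ s, of r] 4 by (auto simp: touch_qb_def d(1,2))
  qed
qed

theorem collars_meet_iff:
  assumes ad: "admissible k n" "admissible l n'" and r: "1 \<le> r" "1 \<le> r'" and kl: "k \<le> l"
  shows "collar k n r \<inter> collar l n' r' \<noteq> {} \<longleftrightarrow> touch_qq k n r l n'"
proof -
  note b = collar_bounds[OF ad(1)] and b' = collar_bounds[OF ad(2)]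
    and s = seat_contains(2)[OF ad(2), of r'] and mem = seat_contains(4)[OF ad(2), of r']
  consider "l = k" | "l = k + 1" | "k + 1 < l" using kl by linarith
  then show ?thesis
  proof cases
    case 1
    show ?thesis
    proof (cases "\<forall>i\<in>{1..<k}. n i = n' i")
      case False
      then obtain i where i: "i \<in> {1..<k}" "n i \<noteq> n' i" by blast
      have "collar k n r \<inter> collar l n' r' = {}"
        using seat_disjoint[OF ad kl i] seat_contains(2)[OF ad(1), of r] s by blast
      then show ?thesis using False by (simp add: touch_qq_def)
    next
      case agree: True
      have Z: "n k \<in> Z0" "n' k \<in> Z0" "1 \<le> k" using ad 1 by (auto simp: admissible_def)
      have apart: "collar k p t \<inter> collar k p' t' = {}"
        if p: "admissible k p" "admissible k p'" "\<forall>i\<in>{1..<k}. p i = p' i" "1 \<le> t"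
          and less: "idx (p k) < idx (p' k)" for p p' t t'
      proof -
        have N: "node (k - 1) p' = node (k - 1) p" using p(3) by (intro node_cong) auto
        have "node k p (- int t) < node k (p'(k := zpred (p' k))) (int t')"
        proof (cases "idx (p' k) = idx (p k) + 1")
          case True
          have Zp: "p k \<in> Z0" "p' k \<in> Z0" using p(1,2) Z(3) by (auto simp: admissible_def)
          have "idx (p k) = idx (zpred (p' k))" using True idx_simps(1)[OF Zp(2)] by linarith
          then have "zpred (p' k) = p k" using idx_simps(3)[OF Zp(1) zpred_immediate(1)[OF Zp(2)]] by simp
          then have "node k (p'(k := zpred (p' k))) = node k p" using p(3) by (intro node_cong) auto
          then show ?thesis using p(4) by (simp add: node_less)
        next
          case False
          then have "hi k p \<le> node (k - 1) p' (idx (p' k) - 1)" using less by (simp add: hi_def N node_le del: One_nat_def)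
          then show ?thesis
            using collar_bounds(4)[OF p(1), of "- int t"] collar_bounds(1)[OF p(2), of "int t'"] by linarith
        qed
        then show ?thesis by (force simp: collar_def)
      qed
      have "collar k n r \<inter> collar l n' r' \<noteq> {} \<longleftrightarrow> n' k = n k"
      proof (cases "n' k = n k")
        case True
        then have "lo k n = lo l n'" using lo_hi_cong(1)[of k n n'] agree Z(3) 1 by (metis atLeastAtMost_iff atLeastLessThan_iff le_neq_implies_less)
        then show ?thesis using seat_contains(4)[OF ad(1), of r] mem True by auto
      next
        case False
        then have "idx (n k) < idx (n' k) \<or> idx (n' k) < idx (n k)"
          using idx_simps(3)[OF Z(1,2)] by linarith
        then have "collar k n r \<inter> collar k n' r' = {}"
          using apart[of n n' r r'] apart[of n' n r' r] ad r agree 1 by fastforce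
        then show ?thesis using False 1 by simp
      qed
      then show ?thesis using agree 1 by (simp add: touch_qq_def)
    qed
  next
    case 2
    let ?a = "idx (n' (k + 1))"
    have Z: "n' (k + 1) \<in> Z0" using ad 2 by (auto simp: admissible_def)
    have lo: "lo l n' = node k n' ?a" by (simp add: 2 lo_def)
    have up: "collar l n' r' \<subseteq> {node k n' (?a - 1)<..<node k n' (?a + 1)}"
      using b'(1)[of "int r'"] b'(4)[of "- int r'"] by (force simp: 2 collar_def hi_def)
    have "(\<exists>x\<in>collar l n' r'. x \<le> node k n' (- int r)) \<longleftrightarrow> ?a \<le> - int r"
    proof
      assume "\<exists>x\<in>collar l n' r'. x \<le> node k n' (- int r)"
      then have "node k n' (?a - 1) < node k n' (- int r)" using up by force
      then show "?a \<le> - int r" by (simp add: node_less)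
    next
      assume "?a \<le> - int r"
      then show "\<exists>x\<in>collar l n' r'. x \<le> node k n' (- int r)"
        using mem unfolding lo by (intro bexI[of _ "node k n' ?a"]) (simp_all add: node_le)
    qed
    moreover have "(\<exists>x\<in>collar l n' r'. node k n' (int r) \<le> x) \<longleftrightarrow> int r \<le> ?a"
    proof
      assume "\<exists>x\<in>collar l n' r'. node k n' (int r) \<le> x"
      then have "node k n' (int r) < node k n' (?a + 1)" using up by force
      then show "int r \<le> ?a" by (simp add: node_less)
    next
      assume "int r \<le> ?a"
      then show "\<exists>x\<in>collar l n' r'. node k n' (int r) \<le> x"
        using mem unfolding lo by (intro bexI[of _ "node k n' ?a"]) (simp_all add: node_le)
    qed
    ultimately have "(\<exists>x\<in>collar l n' r'. x \<le> node k n' (- int r)) \<longleftrightarrow> n' (k + 1) \<le> - int r"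
      "(\<exists>x\<in>collar l n' r'. node k n' (int r) \<le> x) \<longleftrightarrow> n' (k + 1) > int r"
      unfolding idx_bounds[OF Z r(1)] by blast+
    then show ?thesis
      using collar_meets_deep[OF ad _ s, of r] 2 by (simp add: touch_qq_def)
  next
    case 3
    have "collar l n' r' \<noteq> {}" using mem by blast
    note d = seat_deeper[OF ad(2) 3 r(1) s this]
    show ?thesis
      using collar_meets_deep[OF ad _ s, of r] 3 by (auto simp: touch_qq_def d(1,2))
  qed
qed

text \<open>On the deep levels the cells behave towards collars as \<open>bel_le_qel_iff\<close> says for the generators.\<close>

lemma cell_subset_collar_iff:
  assumes ad: "admissible k n" "admissible l n'" and r: "1 \<le> r" and l: "k + 1 < l"
  shows "cell l n' \<subseteq> collar k n r \<longleftrightarrow> touch_qb k n r l n'"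
proof
  assume "cell l n' \<subseteq> collar k n r"
  then show "touch_qb k n r l n'"
    using collar_meets_cell_iff[OF ad r] seat_contains(3)[OF ad(2)] by blast
next
  assume t: "touch_qb k n r l n'"
  have k: "1 \<le> k" "n k \<in> Z0" using ad by (auto simp: admissible_def)
  note b = collar_bounds[OF ad(1)] and s = seat_contains(1)[OF ad(2)]
  have ne: "cell l n' \<noteq> {}" using seat_contains(3)[OF ad(2)] by blast
  have deep: "cell l n' \<subseteq> {lo k n'<..<hi k n'}" using s seat_deep[of k l n'] k(1) l by auto
  note d = seat_deeper[OF ad(2) l r s ne]
  let ?m = "n(k := zpred (n k))"
  have agree: "\<forall>i\<in>{1..<k}. n i = n' i" and c: "(n' (k + 1) > int r \<and> n' k = zpred (n k)) \<or> (n' (k + 1) < - int r \<and> n' k = n k)"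
    using t l by (auto simp: touch_qb_def)
  have N: "node (k - 1) n' = node (k - 1) n" using agree by (intro node_cong) auto
  show "cell l n' \<subseteq> collar k n r"
    using c
  proof (elim disjE conjE)
    assume 1: "n' (k + 1) > int r" "n' k = zpred (n k)"
    then have "node k ?m = node k n'" using agree by (intro node_cong) auto
    moreover have "hi k n' = lo k n" by (simp add: hi_def lo_def N 1(2) idx_simps(1)[OF k(2)] del: One_nat_def)
    ultimately show ?thesis
      using d(4)[OF 1(1)] deep b(3)[of "- int r"] by (force simp: collar_def)
  next
    assume 1: "n' (k + 1) < - int r" "n' k = n k"
    then have "node k n = node k n'" using agree by (intro node_cong) (auto simp: le_less)
    moreover have "lo k n' = lo k n" by (simp add: lo_def N 1(2) del: One_nat_def)
    ultimately show ?thesis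
      using d(3)[OF 1(1)] deep b(2)[of "int r"] by (force simp: collar_def)
  qed
qed

section \<open>Cells and collars form a base\<close>

lemma cell_around:
  assumes "\<And>k n. admissible k n \<Longrightarrow> x \<noteq> lo k n" "1 \<le> k"
  shows "\<exists>n. admissible k n \<and> lo k n < x \<and> x < hi k n"
  using assms(2)
proof (induction k rule: dec_induct)
  case base
  let ?n = "\<lambda>_ :: nat. label \<lfloor>x\<rfloor>"
  have "admissible 1 ?n" using label by (simp add: admissible_def)
  moreover from this have "x \<noteq> lo 1 ?n" by (rule assms(1))
  moreover have "lo 1 ?n \<le> x" "x < hi 1 ?n" by (simp_all add: lo_def hi_def label)
  ultimately show ?case by (intro exI[of _ ?n] conjI) simp_all
next
  case (step k)
  then obtain n where n: "admissible k n" "lo k n < x" "x < hi k n" by blast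
  then obtain j where j: "grid j \<le> (x - lo k n) / (hi k n - lo k n)" "(x - lo k n) / (hi k n - lo k n) < grid (j + 1)"
    using grid_floor[of "(x - lo k n) / (hi k n - lo k n)"] by (auto simp: field_simps)
  let ?n = "n(Suc k := label j)"
  have ad: "admissible (Suc k) ?n" using n(1) label by (auto simp: admissible_def)
  have N: "node k ?n = node k n" by (rule node_cong) simp
  have len: "0 < hi k n - lo k n" using n by simp
  have "lo (Suc k) ?n \<le> x" "x < hi (Suc k) ?n"
    using j len unfolding lo_def[of "Suc k"] hi_def[of "Suc k"]
    by (simp_all add: label N node_eq[OF step(1)] field_simps)
  moreover have "x \<noteq> lo (Suc k) ?n" using ad by (rule assms(1))
  ultimately show ?case using ad by (intro exI[of _ ?n] conjI) linarith+
qed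

text \<open>
  An endpoint of a cell has its collars as neighbourhoods. Any other point is interior to a cell of
  each level, and lengths tend to zero.
\<close>

theorem cell_or_collar_neighbourhood:
  assumes "0 < \<epsilon>"
  obtains k n where "admissible k n" "x \<in> {lo k n<..<hi k n}" "cell k n \<subseteq> {x - \<epsilon><..<x + \<epsilon>}"
  | k n r where "admissible k n" "1 \<le> r" "x \<in> interior (collar k n r)" "collar k n r \<subseteq> {x - \<epsilon><..<x + \<epsilon>}"
proof (cases "\<exists>k n. admissible k n \<and> x = lo k n")
  case True
  then obtain k n where ad: "admissible k n" and x: "x = lo k n" by blast
  let ?m = "n(k := zpred (n k))"
  have k: "1 \<le> k" "n k \<in> Z0" using ad by (auto simp: admissible_def)
  have "node (k - 1) ?m = node (k - 1) n" by (rule node_cong) auto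
  then have him: "hi k ?m = x" by (simp add: x lo_def hi_def idx_simps(1)[OF k(2)])
  \<comment> \<open>The collar with parameter \<open>r\<close> reaches at most \<open>D / (r + 2)\<close> to either side of \<open>x\<close>.\<close>
  define D where "D = max (hi k n - lo k n) (hi k ?m - lo k ?m)"
  have D: "hi k n - lo k n \<le> D" "hi k ?m - lo k ?m \<le> D" by (simp_all add: D_def)
  obtain r :: nat where r: "D / \<epsilon> < real r" using reals_Archimedean2 by blast
  have "D / \<epsilon> < real r + 2" using r by linarith
  then have small: "D / (real r + 2) < \<epsilon>" using assms by (simp add: field_simps)
  define R where "R = max r 1"
  have R: "1 \<le> R" "r \<le> R" by (simp_all add: R_def)
  have "0 \<le> D" using lo_less_hi[of k n] D(1) by linarith
  then have "D / (real R + 2) \<le> D / (real r + 2)" using R(2) by (intro divide_left_mono) auto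
  then have small': "D / (real R + 2) < \<epsilon>" using small by linarith
  have g: "grid (int R) = 1 - 1 / (real R + 2)" "grid (- int R) = 1 / (real R + 2)"
    using R(1) by (auto simp: grid_def)
  have "node k ?m (int R) = x - (hi k ?m - lo k ?m) / (real R + 2)"
    by (simp add: node_eq[OF k(1)] g right_diff_distrib flip: him)
  moreover have "(hi k ?m - lo k ?m) / (real R + 2) \<le> D / (real R + 2)"
    using D(2) by (intro divide_right_mono) auto
  moreover have "node k n (- int R) = x + (hi k n - lo k n) / (real R + 2)"
    by (simp add: node_eq[OF k(1)] g x)
  moreover have "(hi k n - lo k n) / (real R + 2) \<le> D / (real R + 2)"
    using D(1) by (intro divide_right_mono) auto
  ultimately have "collar k n R \<subseteq> {x - \<epsilon><..<x + \<epsilon>}"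
    using small' by (auto simp: collar_def)
  moreover have "x \<in> interior (collar k n R)"
    using collar_bounds(2)[OF ad, of "int R"] collar_bounds(3)[OF ad, of "- int R"] x
    by (simp add: collar_def interior_atLeastAtMost_real)
  ultimately show thesis using that(2) ad R(1) by blast
next
  case False
  obtain k where k: "(1 / 2 :: real) ^ k < \<epsilon>" using real_arch_pow_inv[OF assms, of "1 / 2"] by auto
  obtain n where n: "admissible (Suc k) n" "lo (Suc k) n < x" "x < hi (Suc k) n"
    using cell_around[of x "Suc k"] False by auto
  have "hi (Suc k) n - lo (Suc k) n < \<epsilon>" using cell_length[of "Suc k" n] k by simp
  then have "cell (Suc k) n \<subseteq> {x - \<epsilon><..<x + \<epsilon>}" using n by (auto simp: cell_def)
  then show thesis using that(1) n by auto
qed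

lemma deep_cell_subset:
  assumes ad: "admissible k n"
  obtains l n' where "admissible l n'" "m < l" "cell l n' \<subseteq> cell k n"
proof -
  define n' where "n' i = (if i \<le> k then n i else 1)" for i
  define l where "l = max (k + 1) (m + 1)"
  have k: "1 \<le> k" using ad by (simp add: admissible_def)
  have ad': "admissible l n'" using ad by (auto simp: admissible_def n'_def l_def Z0_def)
  have "k < l" by (simp add: l_def)
  then have "cell l n' \<subseteq> {lo k n'<..<hi k n'}"
    using seat_contains(1)[OF ad'] seat_deep[of k l n'] k by blast
  moreover have "lo k n' = lo k n" "hi k n' = hi k n"
    using lo_hi_cong[of k n' n] k by (auto simp: n'_def)
  ultimately have "cell l n' \<subseteq> cell k n" by (auto simp: cell_def)
  then show thesis using that[OF ad'] by (auto simp: l_def)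
qed

theorem deep_cell_in_open:
  assumes "open U" "U \<noteq> {}"
  obtains l n where "admissible l n" "m < l" "cell l n \<subseteq> U"
proof -
  obtain x where x: "x \<in> U" using assms(2) by blast
  obtain \<epsilon> where \<epsilon>: "0 < \<epsilon>" "ball x \<epsilon> \<subseteq> U" using assms(1) x openE by blast
  have "\<exists>k n. admissible k n \<and> cell k n \<subseteq> {x - \<epsilon><..<x + \<epsilon>}"
  proof (rule cell_or_collar_neighbourhood[OF \<epsilon>(1), of x])
    fix k n r assume q: "admissible k n" "1 \<le> r" "collar k n r \<subseteq> {x - \<epsilon><..<x + \<epsilon>}"
    \<comment> \<open>A label below \<open>- r\<close> leads into the right half of the collar.\<close>
    define n' where "n' = (\<lambda>i. if i \<le> k then n i else - int r - 1)"
    have ad': "admissible (k + 2) n'" using q(1) by (auto simp: admissible_def n'_def Z0_def)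
    have "touch_qb k n r (k + 2) n'" by (simp add: touch_qb_def n'_def)
    then have "cell (k + 2) n' \<subseteq> collar k n r" using cell_subset_collar_iff[OF q(1) ad' q(2)] by simp
    then show ?thesis using ad' q(3) by blast
  qed blast
  then obtain k n where kn: "admissible k n" "cell k n \<subseteq> {x - \<epsilon><..<x + \<epsilon>}" by blast
  obtain l n' where "admissible l n'" "m < l" "cell l n' \<subseteq> cell k n"
    using deep_cell_subset[OF kn(1)] by blast
  moreover have "{x - \<epsilon><..<x + \<epsilon>} = ball x \<epsilon>" by (simp add: ball_eq_greaterThanLessThan)
  ultimately show thesis using that kn(2) \<epsilon>(2) by blast
qed

definition basic_intervals :: "real set set" where
  "basic_intervals = {cell k n | k n. admissible k n} \<union> {collar k n r | k n r. admissible k n \<and> 1 \<le> r}"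

lemma compact_cover_basic_intervals:
  assumes "compact K" "open U" "K \<subseteq> U"
  obtains \<C> where "finite \<C>" "\<C> \<subseteq> basic_intervals" "K \<subseteq> \<Union>\<C>" "\<Union>\<C> \<subseteq> U"
proof -
  have "\<exists>G\<in>basic_intervals. x \<in> interior G \<and> G \<subseteq> U" if x: "x \<in> K" for x
  proof -
    obtain \<epsilon> where \<epsilon>: "0 < \<epsilon>" "ball x \<epsilon> \<subseteq> U" using assms(2,3) x openE by blast
    have b: "{x - \<epsilon><..<x + \<epsilon>} = ball x \<epsilon>" by (simp add: ball_eq_greaterThanLessThan)
    show ?thesis
    proof (rule cell_or_collar_neighbourhood[OF \<epsilon>(1), of x])
      fix k n assume "admissible k n" "x \<in> {lo k n<..<hi k n}" "cell k n \<subseteq> {x - \<epsilon><..<x + \<epsilon>}"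
      then show ?thesis
        using \<epsilon>(2) b by (intro bexI[of _ "cell k n"]) (auto simp: basic_intervals_def cell_def interior_atLeastAtMost_real)
    next
      fix k n and r :: nat
      assume "admissible k n" "1 \<le> r" "x \<in> interior (collar k n r)" "collar k n r \<subseteq> {x - \<epsilon><..<x + \<epsilon>}"
      then show ?thesis
        using \<epsilon>(2) b by (intro bexI[of _ "collar k n r"]) (auto simp: basic_intervals_def)
    qed
  qed
  then obtain G where G: "\<And>x. x \<in> K \<Longrightarrow> G x \<in> basic_intervals \<and> x \<in> interior (G x) \<and> G x \<subseteq> U" by metis
  obtain P where P: "P \<subseteq> K" "finite P" "K \<subseteq> (\<Union>x\<in>P. interior (G x))"
    using compactE_image[OF assms(1), of K "\<lambda>x. interior (G x)"] G by blast
  show thesis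
  proof (rule that[of "G ` P"])
    show "K \<subseteq> \<Union>(G ` P)" using P(3) interior_subset by blast
  qed (use P G in auto)
qed

text \<open>
  The clause of the contact relation for bounded elements, seen on the line: disjoint compact sets
  have disjoint open neighbourhoods, and each set is covered by finitely many cells and collars
  inside its neighbourhood.
\<close>

theorem disjoint_compact_covers:
  assumes "compact K" "compact K'" "K \<inter> K' = {}"
  obtains \<C> \<D> where "finite \<C>" "\<C> \<noteq> {}" "\<C> \<subseteq> basic_intervals" "K \<subseteq> \<Union>\<C>"
    "finite \<D>" "\<D> \<noteq> {}" "\<D> \<subseteq> basic_intervals" "K' \<subseteq> \<Union>\<D>" "\<Union>\<C> \<inter> \<Union>\<D> = {}"
proof -
  \<comment> \<open>Two points outside both sets keep the covers nonempty.\<close>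
  have "bounded (K \<union> K')" using assms by (simp add: compact_imp_bounded)
  then obtain B where B: "\<And>x. x \<in> K \<union> K' \<Longrightarrow> \<bar>x\<bar> \<le> B" by (auto simp: bounded_iff)
  have notin: "B + 1 \<notin> K \<union> K'" "B + 2 \<notin> K \<union> K'" using B[of "B + 1"] B[of "B + 2"] by (auto simp: abs_le_iff)
  let ?K = "insert (B + 1) K" and ?K' = "insert (B + 2) K'"
  have c: "compact ?K" "compact ?K'" using assms by simp_all
  have "?K \<inter> ?K' = {}" using assms(3) notin by auto
  then obtain U V where UV: "open U" "open V" "?K \<subseteq> U" "?K' \<subseteq> V" "U \<inter> V = {}"
    using separation_normal[OF compact_imp_closed[OF c(1)] compact_imp_closed[OF c(2)]] by metis
  obtain \<C> where C: "finite \<C>" "\<C> \<subseteq> basic_intervals" "?K \<subseteq> \<Union>\<C>" "\<Union>\<C> \<subseteq> U"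
    by (rule compact_cover_basic_intervals[OF c(1) UV(1,3)])
  obtain \<D> where D: "finite \<D>" "\<D> \<subseteq> basic_intervals" "?K' \<subseteq> \<Union>\<D>" "\<Union>\<D> \<subseteq> V"
    by (rule compact_cover_basic_intervals[OF c(2) UV(2,4)])
  show thesis
  proof (rule that[of \<C> \<D>])
    show "\<Union>\<C> \<inter> \<Union>\<D> = {}" using C(4) D(4) UV(5) by blast
  qed (use C D in auto)
qed

section \<open>Intervals as a dense family\<close>

lemma standard_lca_real:
  "F \<in> carrier (standard_lca euclideanreal) \<longleftrightarrow> closure (interior F) = F"
  "F \<in> bdd (standard_lca euclideanreal) \<longleftrightarrow> closure (interior F) = F \<and> compact F"
  by (auto simp: standard_lca_simps)

lemma interval_regular: "(a :: real) < b \<Longrightarrow> {a..b} \<in> bdd (standard_lca euclideanreal)"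
  by (simp add: standard_lca_real)

lemma cell_bdd: "cell k n \<in> bdd (standard_lca euclideanreal)"
  unfolding cell_def by (rule interval_regular) (rule lo_less_hi)

lemma collar_bdd:
  assumes "admissible k n"
  shows "collar k n r \<in> bdd (standard_lca euclideanreal)"
  unfolding collar_def using collar_bounds[OF assms] by (intro interval_regular) (meson less_trans)

lemma open_cell_mono:
  assumes "1 \<le> i" "i \<le> k"
  shows "{lo k n<..<hi k n} \<subseteq> {lo i n<..<hi i n}"
proof (cases "i = k")
  case False
  then have "i \<le> k - 1" using assms(2) by simp
  then show ?thesis
    using node_between[OF assms(1), of "k - 1" n] unfolding lo_def[of k] hi_def[of k]
    by (meson greaterThanLessThan_subseteq_greaterThanLessThan less_imp_le)
qed simp

lemma open_cells_disjoint_iff: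
  assumes ad: "admissible k n" "admissible l n'"
  shows "{lo k n<..<hi k n} \<inter> {lo l n'<..<hi l n'} = {} \<longleftrightarrow> (\<exists>i\<in>{1..min k l}. n i \<noteq> n' i)"
proof -
  have *: "{lo k n<..<hi k n} \<inter> {lo l n'<..<hi l n'} = {} \<longleftrightarrow> (\<exists>i\<in>{1..k}. n i \<noteq> n' i)"
    if ad: "admissible k n" "admissible l n'" and kl: "k \<le> l" for k l n n'
  proof
    assume dis: "{lo k n<..<hi k n} \<inter> {lo l n'<..<hi l n'} = {}"
    have k: "1 \<le> k" using ad by (simp add: admissible_def)
    show "\<exists>i\<in>{1..k}. n i \<noteq> n' i"
    proof (rule ccontr)
      assume "\<not> ?thesis"
      then have "lo k n = lo k n'" "hi k n = hi k n'" using lo_hi_cong[of k n n'] k by auto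
      then have "{lo l n'<..<hi l n'} \<subseteq> {lo k n<..<hi k n}" using open_cell_mono[OF k kl, of n'] by simp
      then have "{lo l n'<..<hi l n'} = {}" using dis by blast
      then show False using lo_less_hi[of l n'] by (simp add: greaterThanLessThan_empty_iff)
    qed
  next
    assume "\<exists>i\<in>{1..k}. n i \<noteq> n' i"
    then obtain i where i: "i \<in> {1..k}" "n i \<noteq> n' i" by blast
    then obtain j where j: "j \<in> {1..k}" "n j \<noteq> n' j" and eq: "\<And>m. m \<in> {1..<j} \<Longrightarrow> n m = n' m"
      by (rule first_difference) blast
    have "cell j n \<inter> {lo j n'<..<hi j n'} = {}"
      using ad kl j eq by (intro cell_open_disjoint) (auto simp: admissible_def)
    moreover have "{lo k n<..<hi k n} \<subseteq> cell j n"
      using open_cell_mono[of j k n] j(1) unfolding cell_def by auto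
    moreover have "{lo l n'<..<hi l n'} \<subseteq> {lo j n'<..<hi j n'}"
      using j(1) kl by (intro open_cell_mono) auto
    ultimately show "{lo k n<..<hi k n} \<inter> {lo l n'<..<hi l n'} = {}" by blast
  qed
  show ?thesis
  proof (cases "k \<le> l")
    case True
    then show ?thesis using *[OF ad] by (simp add: min_def)
  next
    case False
    then have "{lo l n'<..<hi l n'} \<inter> {lo k n<..<hi k n} = {} \<longleftrightarrow> (\<exists>i\<in>{1..l}. n' i \<noteq> n i)"
      using *[OF ad(2,1)] by simp
    then show ?thesis using False by (simp add: min_def Int_commute eq_commute[of "n _"])
  qed
qed

lemma cells_dense_family:
  "dense_family (standard_lca euclideanreal) {(k, n). admissible k n} (\<lambda>(k, n). cell k n)"
  unfolding dense_family_def standard_lca_algebra(5)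
proof (intro conjI ballI impI)
  fix t :: "nat \<times> (nat \<Rightarrow> int)"
  show "(case t of (k, n) \<Rightarrow> cell k n) \<in> carrier (standard_lca euclideanreal)"
    using cell_bdd by (auto simp: standard_lca_simps(2) split: prod.split)
  show "(case t of (k, n) \<Rightarrow> cell k n) \<noteq> {}"
    using lo_less_hi less_imp_le by (auto simp: cell_def split: prod.split)
next
  fix F assume F: "F \<in> carrier (standard_lca euclideanreal)" "F \<noteq> {}"
  then have "interior F \<noteq> {}" by (auto simp: standard_lca_real)
  then obtain l n where "admissible l n" "0 < l" "cell l n \<subseteq> interior F"
    using deep_cell_in_open[OF open_interior] by metis
  then show "\<exists>t\<in>{(k, n). admissible k n}. (case t of (k, n) \<Rightarrow> cell k n) \<sqsubseteq>\<^bsub>standard_lca euclideanreal\<^esub> F"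
    using interior_subset by (intro bexI[of _ "(l, n)"]) (auto simp: standard_lca_simps(4))
qed

lemma cells_disjoint_iff:
  assumes "admissible k n" "admissible l n'"
  shows "cell k n \<sqinter>\<^bsub>standard_lca euclideanreal\<^esub> cell l n' = {} \<longleftrightarrow> (\<exists>i\<in>{1..min k l}. n i \<noteq> n' i)"
proof -
  have c: "cell k n \<in> carrier (standard_lca euclideanreal)" for k n
    using cell_bdd by (simp add: standard_lca_simps(2))
  have "cell k n \<sqinter>\<^bsub>standard_lca euclideanreal\<^esub> cell l n' = closure ({lo k n<..<hi k n} \<inter> {lo l n'<..<hi l n'})"
    using standard_lca_algebra(3)[OF c c] by (simp add: cell_def)
  then show ?thesis
    using open_cells_disjoint_iff[OF assms] by (simp add: closure_eq_empty)
qed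

text \<open>
  If \<open>F\<close> were not contained in \<open>G\<close>, the open set \<open>interior F - G\<close> would contain a cell of a deep level.
\<close>

lemma regular_closed_eq_if_deep_cells:
  assumes F: "F \<in> carrier (standard_lca euclideanreal)" and G: "G \<in> carrier (standard_lca euclideanreal)"
    and cells: "\<And>l n. \<lbrakk>admissible l n; m < l\<rbrakk> \<Longrightarrow> cell l n \<subseteq> F \<longleftrightarrow> cell l n \<subseteq> G"
  shows "F = G"
proof -
  have sub: "F \<subseteq> G"
    if FG: "F \<in> carrier (standard_lca euclideanreal)" "G \<in> carrier (standard_lca euclideanreal)"
      and cells: "\<And>l n. \<lbrakk>admissible l n; m < l; cell l n \<subseteq> F\<rbrakk> \<Longrightarrow> cell l n \<subseteq> G" for F G
  proof -
    have cl: "closed G" using standard_lca_closedin[OF FG(2)] by simp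
    have "interior F - G = {}"
    proof (rule ccontr)
      assume ne: "interior F - G \<noteq> {}"
      have "open (interior F - G)" using cl by (simp add: open_Diff)
      then obtain l n where ln: "admissible l n" "m < l" "cell l n \<subseteq> interior F - G"
        using ne by (rule deep_cell_in_open)
      then have "cell l n \<subseteq> G" using cells interior_subset by blast
      then show False using ln seat_contains(3)[OF ln(1)] by blast
    qed
    then have "closure (interior F) \<subseteq> G" using cl by (intro closure_minimal) auto
    then show ?thesis using FG(1) by (simp add: standard_lca_real)
  qed
  show ?thesis using sub[OF F G] sub[OF G F] cells by blast
qed

section \<open>The contact relation is determined\<close>

text \<open>The record only gains fields, so all operations that are defined from the order stay the same.\<close>

lemma lca_tilde_ops:
  "carrier (lca_tilde L \<phi> \<sigma>) = carrier L" "eq (lca_tilde L \<phi> \<sigma>) = (=)" "le (lca_tilde L \<phi> \<sigma>) = le L"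
  "contact (lca_tilde L \<phi> \<sigma>) = \<sigma>" "bdd (lca_tilde L \<phi> \<sigma>) = bdd_tilde L \<phi>"
  "Upper (lca_tilde L \<phi> \<sigma>) = Upper L" "Lower (lca_tilde L \<phi> \<sigma>) = Lower L"
  "least (lca_tilde L \<phi> \<sigma>) = least L" "greatest (lca_tilde L \<phi> \<sigma>) = greatest L"
  "join (lca_tilde L \<phi> \<sigma>) = join L" "meet (lca_tilde L \<phi> \<sigma>) = meet L"
  "bottom (lca_tilde L \<phi> \<sigma>) = bottom L" "top (lca_tilde L \<phi> \<sigma>) = top L"
  "bcompl (lca_tilde L \<phi> \<sigma>) = bcompl L"
proof -
  let ?L = "lca_tilde L \<phi> \<sigma>"
  show 1: "carrier ?L = carrier L" "eq ?L = (=)" "le ?L = le L" "contact ?L = \<sigma>" "bdd ?L = bdd_tilde L \<phi>"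
    by (simp_all add: lca_tilde_def)
  show 2: "Upper ?L = Upper L" "Lower ?L = Lower L" by (simp_all add: fun_eq_iff Upper_def Lower_def 1)
  show 3: "least ?L = least L" "greatest ?L = greatest L"
    by (simp_all add: fun_eq_iff least_def greatest_def 1)
  show 4: "join ?L = join L" "meet ?L = meet L"
    by (simp_all add: fun_eq_iff join_def meet_def Lattice.sup_def Lattice.inf_def 2 3)
  show 5: "bottom ?L = bottom L" "top ?L = top L" by (simp_all add: bottom_def top_def 1 3)
  show "bcompl ?L = bcompl L" by (simp add: fun_eq_iff bcompl_def 1 4 5)
qed

lemma lca_tilde_lattice:
  assumes "boolean_lattice L" "complete_lattice L"
  shows "boolean_lattice (lca_tilde L \<phi> \<sigma>)" "complete_lattice (lca_tilde L \<phi> \<sigma>)"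
proof -
  let ?L = "lca_tilde L \<phi> \<sigma>"
  interpret boolean_lattice L by fact
  interpret C: complete_lattice L by fact
  interpret P: partial_order ?L
    by standard (auto simp: lca_tilde_ops intro: le_antisym, meson le_trans)
  show "boolean_lattice ?L"
    by standard (use sup_of_two_exists inf_of_two_exists bottom_exists top_exists meet_join_distrib
        complemented in \<open>simp_all add: lca_tilde_ops\<close>)
  show "complete_lattice ?L"
    by standard (use C.sup_exists C.inf_exists in \<open>simp_all add: lca_tilde_ops\<close>)
qed

context sum_completion
begin

lemma gens_closed: "gens0 At \<phi> \<union> gens1 At \<phi> \<subseteq> carrier At"
  using bel_closed qel_parts(5) by (auto simp: gens0_def gens1_def)

lemma bdd_tilde_closed: "bdd_tilde At \<phi> \<subseteq> carrier At"
proof -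
  have "lattice_ideal At (carrier At)" by (simp add: lattice_ideal_def)
  then show ?thesis using gens_closed unfolding bdd_tilde_def generated_ideal_def by blast
qed

text \<open>
  The first clauses fix the relation on the generators, the clause for bounded elements extends it to
  the ideal, and the last clause to the whole algebra.
\<close>

lemma sigma_tilde_unique:
  assumes \<sigma>: "sigma_tilde At \<phi> \<sigma>" and \<tau>: "sigma_tilde At \<phi> \<tau>"
    and ab: "a \<in> carrier At" "b \<in> carrier At"
  shows "\<sigma> a b \<longleftrightarrow> \<tau> a b"
proof -
  interpret \<sigma>: sigma_tilde At \<phi> \<sigma> by fact
  interpret \<tau>: sigma_tilde At \<phi> \<tau> by fact
  let ?G = "gens0 At \<phi> \<union> gens1 At \<phi>"
  have bb: "\<sigma> (bel At \<phi> k n) (bel At \<phi> l n') \<longleftrightarrow> \<tau> (bel At \<phi> k n) (bel At \<phi> l n')"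
    if "admissible k n" "admissible l n'" for k n l n'
    using that \<sigma>.clause_bb \<tau>.clause_bb \<sigma>.symmetric \<tau>.symmetric bel_closed by (metis nle_le)
  have qq: "\<sigma> (qel At \<phi> k n r) (qel At \<phi> l n' r') \<longleftrightarrow> \<tau> (qel At \<phi> k n r) (qel At \<phi> l n' r')"
    if "admissible k n" "admissible l n'" "1 \<le> r" "1 \<le> r'" for k n r l n' r'
    using that \<sigma>.clause_qq \<tau>.clause_qq \<sigma>.symmetric \<tau>.symmetric qel_parts(5) by (metis nle_le)
  have qb: "\<sigma> (qel At \<phi> k n r) (bel At \<phi> l n') \<longleftrightarrow> \<tau> (qel At \<phi> k n r) (bel At \<phi> l n')"
    if "admissible k n" "admissible l n'" "1 \<le> r" for k n r l n'
    using that \<sigma>.clause_qb \<tau>.clause_qb by simp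
  have gens: "\<sigma> x y \<longleftrightarrow> \<tau> x y" if xy: "x \<in> ?G" "y \<in> ?G" for x y
  proof -
    have c: "x \<in> carrier At" "y \<in> carrier At" using xy gens_closed by blast+
    show ?thesis
      using xy bb qq qb \<sigma>.symmetric[OF c] \<tau>.symmetric[OF c] unfolding gens0_def gens1_def
      by (elim UnE CollectE exE conjE) simp_all
  qed
  have bounded: "\<sigma> c d \<longleftrightarrow> \<tau> c d" if cd: "c \<in> bdd_tilde At \<phi>" "d \<in> bdd_tilde At \<phi>" for c d
  proof -
    have eq: "(\<forall>x\<in>C. \<forall>y\<in>D. \<not> \<sigma> x y) \<longleftrightarrow> (\<forall>x\<in>C. \<forall>y\<in>D. \<not> \<tau> x y)" if "C \<subseteq> ?G" "D \<subseteq> ?G" for C D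
      using gens that by blast
    have "\<not> \<sigma> c d \<longleftrightarrow> \<not> \<tau> c d"
      unfolding \<sigma>.clause_bounded[OF cd] \<tau>.clause_bounded[OF cd] by (intro ex_cong1 conj_cong HOL.refl eq)
    then show ?thesis by blast
  qed
  show ?thesis
    unfolding \<sigma>.clause_general[OF ab] \<tau>.clause_general[OF ab] using bounded by blast
qed

end

section \<open>The algebra as the regular closed sets of the line\<close>

locale line_model = sum_completion +
  fixes h :: "'a \<Rightarrow> real set"
  assumes h: "bool_iso At (standard_lca euclideanreal) h"
    and h_bel: "admissible k n \<Longrightarrow> h (bel At \<phi> k n) = cell k n"
begin

abbreviation "RC \<equiv> standard_lca euclideanreal"

lemma h_bij: "bij_betw h (carrier At) (carrier RC)"
  using h by (simp add: bool_iso_def)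

lemma h_closed: "x \<in> carrier At \<Longrightarrow> h x \<in> carrier RC"
  using h_bij bij_betw_apply by metis

lemma h_le: "\<lbrakk>x \<in> carrier At; y \<in> carrier At\<rbrakk> \<Longrightarrow> h x \<subseteq> h y \<longleftrightarrow> x \<sqsubseteq>\<^bsub>At\<^esub> y"
  using bool_iso_order_iso[OF At(1) standard_lca_algebra(1) h] by (simp add: standard_lca_simps(4))

lemma h_surj:
  assumes "F \<in> carrier RC"
  obtains x where "x \<in> carrier At" "h x = F"
  using h_bij assms by (metis bij_betw_imp_surj_on imageE)

lemma h_join: "\<lbrakk>x \<in> carrier At; y \<in> carrier At\<rbrakk> \<Longrightarrow> h (x \<squnion>\<^bsub>At\<^esub> y) = h x \<union> h y"
  using h standard_lca_algebra(4)[OF h_closed h_closed] by (simp add: bool_iso_def bool_hom_def)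

lemma h_bottom: "h \<bottom>\<^bsub>At\<^esub> = {}"
  using h by (simp add: bool_iso_def bool_hom_def standard_lca_algebra(5))

text \<open>Both sides contain the same cells of the levels beyond \<open>k + 1\<close>.\<close>

lemma h_qel:
  assumes ad: "admissible k n" and r: "1 \<le> r"
  shows "h (qel At \<phi> k n r) = collar k n r"
proof (rule regular_closed_eq_if_deep_cells[where m = "k + 1"])
  show "h (qel At \<phi> k n r) \<in> carrier RC" by (rule h_closed[OF qel_parts(5)[OF ad]])
  show "collar k n r \<in> carrier RC" using collar_bdd[OF ad] by (simp add: standard_lca_simps(2))
  fix l n' assume l: "admissible l n'" "k + 1 < l"
  have "cell l n' \<subseteq> h (qel At \<phi> k n r) \<longleftrightarrow> bel At \<phi> l n' \<sqsubseteq>\<^bsub>At\<^esub> qel At \<phi> k n r"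
    using h_le[OF bel_closed[OF l(1)] qel_parts(5)[OF ad]] h_bel[OF l(1)] by simp
  also have "\<dots> \<longleftrightarrow> cell l n' \<subseteq> collar k n r"
    using bel_le_qel_iff[OF ad l] cell_subset_collar_iff[OF ad l(1) r l(2)] by simp
  finally show "cell l n' \<subseteq> h (qel At \<phi> k n r) \<longleftrightarrow> cell l n' \<subseteq> collar k n r" .
qed

lemma h_gens: "h ` (gens0 At \<phi> \<union> gens1 At \<phi>) = basic_intervals"
proof -
  have "h ` gens0 At \<phi> = {cell k n | k n. admissible k n}"
    unfolding gens0_def using h_bel by (auto simp: image_iff) metis+
  moreover have "h ` gens1 At \<phi> = {collar k n r | k n r. admissible k n \<and> 1 \<le> r}"
    unfolding gens1_def using h_qel by (auto simp: image_iff) metis+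
  ultimately show ?thesis unfolding basic_intervals_def image_Un by simp
qed

text \<open>
  The element \<open>z\<close> is the join of \<open>C\<close>. It is described by the ideals that contain it, because the
  generated ideal is an intersection of ideals.
\<close>

lemma h_finite_union:
  assumes "finite C" "C \<subseteq> carrier At"
  shows "\<exists>z\<in>carrier At. h z = \<Union>(h ` C) \<and> (\<forall>I. lattice_ideal At I \<longrightarrow> C \<subseteq> I \<longrightarrow> z \<in> I)"
  using assms
proof (induction C)
  case empty
  then show ?case using h_bottom by (intro bexI[of _ "\<bottom>\<^bsub>At\<^esub>"]) (auto simp: lattice_ideal_def)
next
  case (insert x C)
  then obtain z where z: "z \<in> carrier At" "h z = \<Union>(h ` C)"
    "\<forall>I. lattice_ideal At I \<longrightarrow> C \<subseteq> I \<longrightarrow> z \<in> I" by auto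
  then show ?case
    using insert.prems h_join[of x z] by (intro bexI[of _ "x \<squnion>\<^bsub>At\<^esub> z"]) (auto simp: lattice_ideal_def)
qed

lemma le_Sup_iff:
  assumes "finite C" "C \<subseteq> carrier At" "x \<in> carrier At"
  shows "x \<sqsubseteq>\<^bsub>At\<^esub> \<Squnion>\<^bsub>At\<^esub> C \<longleftrightarrow> h x \<subseteq> \<Union>(h ` C)"
proof -
  interpret complete_lattice At by (rule At)
  obtain z where z: "z \<in> carrier At" "h z = \<Union>(h ` C)" using h_finite_union[OF assms(1,2)] by blast
  have c: "\<Squnion>\<^bsub>At\<^esub> C \<in> carrier At" using assms(2) by simp
  have "\<Squnion>\<^bsub>At\<^esub> C \<sqsubseteq>\<^bsub>At\<^esub> z"
  proof (rule sup_least[OF assms(2) z(1)])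
    fix y assume "y \<in> C"
    then show "y \<sqsubseteq>\<^bsub>At\<^esub> z" using h_le[of y z] z assms(2) by blast
  qed
  moreover have "h y \<subseteq> h (\<Squnion>\<^bsub>At\<^esub> C)" if "y \<in> C" for y
    using h_le[OF _ c] sup_upper[OF assms(2) that] that assms(2) by blast
  then have "h z \<subseteq> h (\<Squnion>\<^bsub>At\<^esub> C)" unfolding z(2) by blast
  ultimately have "h (\<Squnion>\<^bsub>At\<^esub> C) = \<Union>(h ` C)" using h_le[OF c z(1)] z(2) by blast
  then show ?thesis using h_le[OF assms(3) c] by simp
qed

lemma basic_interval_compact: "G \<in> basic_intervals \<Longrightarrow> compact G"
  using cell_bdd collar_bdd by (auto simp: basic_intervals_def standard_lca_real)

lemma gens_subset_image:
  assumes "finite \<C>" "\<C> \<subseteq> basic_intervals"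
  obtains C where "finite C" "C \<subseteq> gens0 At \<phi> \<union> gens1 At \<phi>" "h ` C = \<C>"
  using assms finite_subset_image[of \<C> h "gens0 At \<phi> \<union> gens1 At \<phi>"] unfolding h_gens by blast

text \<open>Compact sets are covered by finitely many basic intervals, and these are compact.\<close>

lemma bdd_tilde_iff: "c \<in> bdd_tilde At \<phi> \<longleftrightarrow> c \<in> carrier At \<and> compact (h c)"
proof
  let ?I = "{c \<in> carrier At. compact (h c)}"
  have "lattice_ideal At ?I"
    unfolding lattice_ideal_def
  proof (intro conjI ballI impI)
    fix x y assume x: "x \<in> ?I" and y: "y \<in> carrier At" and le: "y \<sqsubseteq>\<^bsub>At\<^esub> x"
    have "closed (h y)" using standard_lca_closedin[OF h_closed[OF y]] by simp
    moreover have "h y \<subseteq> h x" using h_le[OF y] x le by blast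
    ultimately show "y \<in> ?I" using x y by (metis (mono_tags) compact_Int_closed inf.absorb_iff2 mem_Collect_eq)
  qed (auto simp: h_bottom h_join compact_Un)
  moreover have "gens0 At \<phi> \<union> gens1 At \<phi> \<subseteq> ?I"
    using gens_closed h_gens basic_interval_compact by blast
  moreover assume "c \<in> bdd_tilde At \<phi>"
  ultimately show "c \<in> carrier At \<and> compact (h c)"
    unfolding bdd_tilde_def generated_ideal_def by blast
next
  assume c: "c \<in> carrier At \<and> compact (h c)"
  then have "compact (h c)" by simp
  then obtain \<C> where C': "finite \<C>" "\<C> \<subseteq> basic_intervals" "h c \<subseteq> \<Union>\<C>"
    by (rule compact_cover_basic_intervals[OF _ open_UNIV subset_UNIV])
  obtain C where C: "finite C" "C \<subseteq> gens0 At \<phi> \<union> gens1 At \<phi>" "h ` C = \<C>"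
    by (rule gens_subset_image[OF C'(1,2)])
  obtain z where z: "z \<in> carrier At" "h z = \<Union>(h ` C)"
    "\<forall>I. lattice_ideal At I \<longrightarrow> C \<subseteq> I \<longrightarrow> z \<in> I"
    using h_finite_union[OF C(1)] C(2) gens_closed by blast
  have "c \<sqsubseteq>\<^bsub>At\<^esub> z" using h_le[of c z] z(1,2) C(3) C'(3) c by simp
  show "c \<in> bdd_tilde At \<phi>"
    unfolding bdd_tilde_def generated_ideal_def
  proof (intro InterI, elim CollectE conjE)
    fix I assume I: "lattice_ideal At I" "gens0 At \<phi> \<union> gens1 At \<phi> \<subseteq> I"
    then have "z \<in> I" using z(3) C(2) by (meson subset_trans)
    then show "c \<in> I" using I(1) c \<open>c \<sqsubseteq>\<^bsub>At\<^esub> z\<close> by (simp add: lattice_ideal_def)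
  qed
qed

definition real_contact :: "'a \<Rightarrow> 'a \<Rightarrow> bool" where
  "real_contact a b \<longleftrightarrow> h a \<inter> h b \<noteq> {}"

text \<open>
  The generator clauses are the intersection patterns of cells and collars. The clause for bounded
  elements is the separation of disjoint compact sets by basic intervals, and the general clause
  expresses that a common point of two regular closed sets lies in compact parts of both.
\<close>

theorem sigma_tilde_real_contact: "sigma_tilde At \<phi> real_contact"
proof
  show "real_contact a b \<longleftrightarrow> real_contact b a" for a b
    by (auto simp: real_contact_def)
  show "real_contact (bel At \<phi> k n) (bel At \<phi> l n') \<longleftrightarrow> touch_bb k n l n'"
    if "admissible k n" "admissible l n'" "k \<le> l" for k n l n'
    using cells_meet_iff[OF that] that by (simp add: real_contact_def h_bel)
  show "real_contact (qel At \<phi> k n r) (qel At \<phi> l n' r') \<longleftrightarrow> touch_qq k n r l n'"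
    if "admissible k n" "admissible l n'" "1 \<le> r" "1 \<le> r'" "k \<le> l" for k n l n' r r'
    using collars_meet_iff[OF that] that by (simp add: real_contact_def h_qel)
  show "real_contact (qel At \<phi> k n r) (bel At \<phi> l n') \<longleftrightarrow> touch_qb k n r l n'"
    if "admissible k n" "admissible l n'" "1 \<le> r" for k n l n' r
    using collar_meets_cell_iff[OF that] that by (simp add: real_contact_def h_bel h_qel)
next
  let ?G = "gens0 At \<phi> \<union> gens1 At \<phi>"
  fix c d assume c: "c \<in> bdd_tilde At \<phi>" and d: "d \<in> bdd_tilde At \<phi>"
  have c': "c \<in> carrier At" "compact (h c)" and d': "d \<in> carrier At" "compact (h d)"
    using c d bdd_tilde_iff by blast+
  have le: "x \<sqsubseteq>\<^bsub>At\<^esub> \<Squnion>\<^bsub>At\<^esub> C \<longleftrightarrow> h x \<subseteq> \<Union>(h ` C)" if "finite C" "C \<subseteq> ?G" "x \<in> carrier At" for x C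
    using le_Sup_iff[OF that(1) _ that(3)] that(2) gens_closed by blast
  show "\<not> real_contact c d \<longleftrightarrow> (\<exists>C D. finite C \<and> C \<noteq> {} \<and> C \<subseteq> ?G \<and> finite D \<and> D \<noteq> {} \<and> D \<subseteq> ?G
      \<and> c \<sqsubseteq>\<^bsub>At\<^esub> \<Squnion>\<^bsub>At\<^esub> C \<and> d \<sqsubseteq>\<^bsub>At\<^esub> \<Squnion>\<^bsub>At\<^esub> D \<and> (\<forall>x\<in>C. \<forall>y\<in>D. \<not> real_contact x y))"
  proof
    assume "\<not> real_contact c d"
    then have "h c \<inter> h d = {}" by (simp add: real_contact_def)
    with c'(2) d'(2) obtain \<C> \<D> where
      CC: "finite \<C>" "\<C> \<noteq> {}" "\<C> \<subseteq> basic_intervals" "h c \<subseteq> \<Union>\<C>" and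
      DD: "finite \<D>" "\<D> \<noteq> {}" "\<D> \<subseteq> basic_intervals" "h d \<subseteq> \<Union>\<D>" and dis: "\<Union>\<C> \<inter> \<Union>\<D> = {}"
      by (rule disjoint_compact_covers)
    obtain C where C: "finite C" "C \<subseteq> ?G" "h ` C = \<C>" by (rule gens_subset_image[OF CC(1,3)])
    obtain D where D: "finite D" "D \<subseteq> ?G" "h ` D = \<D>" by (rule gens_subset_image[OF DD(1,3)])
    have "\<forall>x\<in>C. \<forall>y\<in>D. \<not> real_contact x y" using dis C(3) D(3) unfolding real_contact_def by blast
    moreover have "c \<sqsubseteq>\<^bsub>At\<^esub> \<Squnion>\<^bsub>At\<^esub> C" "d \<sqsubseteq>\<^bsub>At\<^esub> \<Squnion>\<^bsub>At\<^esub> D"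
      using le[OF C(1,2) c'(1)] le[OF D(1,2) d'(1)] C(3) D(3) CC(4) DD(4) by simp_all
    ultimately show "\<exists>C D. finite C \<and> C \<noteq> {} \<and> C \<subseteq> ?G \<and> finite D \<and> D \<noteq> {} \<and> D \<subseteq> ?G
      \<and> c \<sqsubseteq>\<^bsub>At\<^esub> \<Squnion>\<^bsub>At\<^esub> C \<and> d \<sqsubseteq>\<^bsub>At\<^esub> \<Squnion>\<^bsub>At\<^esub> D \<and> (\<forall>x\<in>C. \<forall>y\<in>D. \<not> real_contact x y)"
      using C D CC(2) DD(2) by (intro exI[of _ C] exI[of _ D]) auto
  next
    assume "\<exists>C D. finite C \<and> C \<noteq> {} \<and> C \<subseteq> ?G \<and> finite D \<and> D \<noteq> {} \<and> D \<subseteq> ?G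
      \<and> c \<sqsubseteq>\<^bsub>At\<^esub> \<Squnion>\<^bsub>At\<^esub> C \<and> d \<sqsubseteq>\<^bsub>At\<^esub> \<Squnion>\<^bsub>At\<^esub> D \<and> (\<forall>x\<in>C. \<forall>y\<in>D. \<not> real_contact x y)"
    then obtain C D where CD: "finite C" "C \<subseteq> ?G" "finite D" "D \<subseteq> ?G" "c \<sqsubseteq>\<^bsub>At\<^esub> \<Squnion>\<^bsub>At\<^esub> C" "d \<sqsubseteq>\<^bsub>At\<^esub> \<Squnion>\<^bsub>At\<^esub> D"
      "\<forall>x\<in>C. \<forall>y\<in>D. \<not> real_contact x y" by (elim exE conjE)
    then have "h c \<subseteq> \<Union>(h ` C)" "h d \<subseteq> \<Union>(h ` D)"
      using le[OF CD(1,2) c'(1)] le[OF CD(3,4) d'(1)] by blast+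
    moreover have "\<Union>(h ` C) \<inter> \<Union>(h ` D) = {}" using CD(7) unfolding real_contact_def by blast
    ultimately show "\<not> real_contact c d" unfolding real_contact_def by blast
  qed
next
  fix a b assume a: "a \<in> carrier At" and b: "b \<in> carrier At"
  interpret R: complete_local_contact_algebra RC
    by (rule standard_lca_complete) (simp_all add: locally_compact_space_euclidean)
  have shrink: "\<exists>c\<in>bdd_tilde At \<phi>. c \<sqsubseteq>\<^bsub>At\<^esub> b \<and> F \<inter> h c \<noteq> {}"
    if F: "F \<in> carrier RC" "F \<inter> h b \<noteq> {}" and b: "b \<in> carrier At" for F b
  proof -
    obtain K where K: "K \<in> bdd RC" "F \<inter> (K \<sqinter>\<^bsub>RC\<^esub> h b) \<noteq> {}"
      using R.BC2[OF F(1) h_closed[OF b]] F(2) unfolding standard_lca_simps(3) by blast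
    have Kc: "K \<in> carrier RC" using K(1) by (simp add: standard_lca_simps(2))
    note m = R.meet_closed[OF Kc h_closed[OF b]] R.meet_left[OF Kc h_closed[OF b]] R.meet_right[OF Kc h_closed[OF b]]
    have "K \<sqinter>\<^bsub>RC\<^esub> h b \<in> bdd RC"
      using R.bdd_ideal K(1) m(1,2) unfolding lattice_ideal_def by blast
    then have cpt: "compact (K \<sqinter>\<^bsub>RC\<^esub> h b)" by (simp add: standard_lca_simps(2))
    obtain c where c: "c \<in> carrier At" "h c = K \<sqinter>\<^bsub>RC\<^esub> h b" by (rule h_surj[OF m(1)])
    then have "c \<sqsubseteq>\<^bsub>At\<^esub> b" using h_le[OF c(1) b] m(3) by (simp add: standard_lca_simps(4))
    then show ?thesis using c K(2) cpt bdd_tilde_iff by (intro bexI[of _ c]) auto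
  qed
  show "real_contact a b \<longleftrightarrow>
      (\<exists>c\<in>bdd_tilde At \<phi>. \<exists>d\<in>bdd_tilde At \<phi>. c \<sqsubseteq>\<^bsub>At\<^esub> a \<and> d \<sqsubseteq>\<^bsub>At\<^esub> b \<and> real_contact c d)"
  proof
    assume "real_contact a b"
    then obtain d where d: "d \<in> bdd_tilde At \<phi>" "d \<sqsubseteq>\<^bsub>At\<^esub> b" "h a \<inter> h d \<noteq> {}"
      using shrink[OF h_closed[OF a] _ b] unfolding real_contact_def by blast
    have "d \<in> carrier At" using d(1) bdd_tilde_iff by blast
    then obtain c where "c \<in> bdd_tilde At \<phi>" "c \<sqsubseteq>\<^bsub>At\<^esub> a" "h d \<inter> h c \<noteq> {}"
      using shrink[OF h_closed _ a, of d] d(3) by (auto simp: Int_commute)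
    then show "\<exists>c\<in>bdd_tilde At \<phi>. \<exists>d\<in>bdd_tilde At \<phi>. c \<sqsubseteq>\<^bsub>At\<^esub> a \<and> d \<sqsubseteq>\<^bsub>At\<^esub> b \<and> real_contact c d"
      using d(1,2) unfolding real_contact_def by blast
  next
    assume "\<exists>c\<in>bdd_tilde At \<phi>. \<exists>d\<in>bdd_tilde At \<phi>. c \<sqsubseteq>\<^bsub>At\<^esub> a \<and> d \<sqsubseteq>\<^bsub>At\<^esub> b \<and> real_contact c d"
    then show "real_contact a b"
    proof (elim bexE conjE)
      fix c d assume cd: "c \<in> bdd_tilde At \<phi>" "d \<in> bdd_tilde At \<phi>" "c \<sqsubseteq>\<^bsub>At\<^esub> a" "d \<sqsubseteq>\<^bsub>At\<^esub> b" "real_contact c d"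
      have "h c \<subseteq> h a" "h d \<subseteq> h b"
        using h_le[of c a] h_le[of d b] a b cd(3,4) subsetD[OF bdd_tilde_closed] cd(1,2) by simp_all
      then show "real_contact a b" using cd(5) unfolding real_contact_def by blast
    qed
  qed
qed

lemma lca_tilde_isomorphic:
  assumes "sigma_tilde At \<phi> \<sigma>"
  shows "lca_tilde At \<phi> \<sigma> \<cong>\<^sub>L\<^sub>C\<^sub>A RC"
  unfolding lca_isomorphic_def
proof (intro exI[of _ h] conjI ballI)
  show "bool_iso (lca_tilde At \<phi> \<sigma>) RC h"
    using h by (simp add: bool_iso_def bool_hom_def lca_tilde_ops)
  show "contact (lca_tilde At \<phi> \<sigma>) a b \<longleftrightarrow> contact RC (h a) (h b)"
    if "a \<in> carrier (lca_tilde At \<phi> \<sigma>)" "b \<in> carrier (lca_tilde At \<phi> \<sigma>)" for a b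
    using sigma_tilde_unique[OF assms sigma_tilde_real_contact, of a b] that
    by (simp add: lca_tilde_ops real_contact_def standard_lca_simps(3))
  show "a \<in> bdd (lca_tilde At \<phi> \<sigma>) \<longleftrightarrow> h a \<in> bdd RC" if "a \<in> carrier (lca_tilde At \<phi> \<sigma>)" for a
    using that h_closed[of a] by (simp add: lca_tilde_ops bdd_tilde_iff standard_lca_simps(2))
qed

end

text \<open>Generators and cells are disjoint under the same condition on their labels.\<close>

lemma (in sum_completion) line_model_exists:
  obtains h where "line_model A At \<phi> h"
proof -
  let ?T = "{(k, n). admissible k n}"
  have d: "dense_family At ?T (\<lambda>(k, n). bel At \<phi> k n)"
    unfolding dense_family_def
  proof (intro conjI ballI impI)
    fix x assume "x \<in> carrier At" "x \<noteq> \<bottom>\<^bsub>At\<^esub>"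
    then obtain k n where "admissible k n" "bel At \<phi> k n \<sqsubseteq>\<^bsub>At\<^esub> x" by (rule bel_dense)
    then show "\<exists>t\<in>?T. (case t of (k, n) \<Rightarrow> bel At \<phi> k n) \<sqsubseteq>\<^bsub>At\<^esub> x" by (intro bexI[of _ "(k, n)"]) simp_all
  qed (auto simp: bel_closed bel_nonzero)
  have "\<exists>h. bool_iso At (standard_lca euclideanreal) h \<and> (\<forall>(k, n)\<in>?T. h (bel At \<phi> k n) = cell k n)"
  proof (rule dense_families_bool_iso[OF At(1,2) standard_lca_algebra(1,2) d cells_dense_family])
    fix s t assume st: "s \<in> ?T" "t \<in> ?T"
    obtain k n l n' where *: "s = (k, n)" "t = (l, n')" by (metis surj_pair)
    show "(case s of (k, n) \<Rightarrow> bel At \<phi> k n) \<sqinter>\<^bsub>At\<^esub> (case t of (k, n) \<Rightarrow> bel At \<phi> k n) = \<bottom>\<^bsub>At\<^esub> \<longleftrightarrow>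
      (case s of (k, n) \<Rightarrow> cell k n) \<sqinter>\<^bsub>standard_lca euclideanreal\<^esub> (case t of (k, n) \<Rightarrow> cell k n)
        = \<bottom>\<^bsub>standard_lca euclideanreal\<^esub>"
      using st bel_disjoint_iff[of k n l n'] cells_disjoint_iff[of k n l n']
      by (simp add: * standard_lca_algebra(5))
  qed auto
  then obtain h where "bool_iso At (standard_lca euclideanreal) h"
    "\<And>k n. admissible k n \<Longrightarrow> h (bel At \<phi> k n) = cell k n" by auto
  then have "line_model A At \<phi> h" by unfold_locales
  then show thesis by (rule that)
qed

theorem theorem4p3:
  fixes A :: "'a gorder" and At :: "'a gorder" and \<phi> :: "nat \<Rightarrow> int set \<Rightarrow> 'a"
  assumes "bool_sum {1..} (\<lambda>i. powerset_algebra Z0) A \<phi>"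
    and "bool_completion A At"
  shows "(\<exists>\<sigma>. sigma_tilde At \<phi> \<sigma>)
    \<and> (\<forall>\<sigma>. sigma_tilde At \<phi> \<sigma> \<longrightarrow>
          complete_local_contact_algebra (lca_tilde At \<phi> \<sigma>)
        \<and> lca_tilde At \<phi> \<sigma> \<cong>\<^sub>L\<^sub>C\<^sub>A standard_lca euclideanreal
        \<and> (\<forall>Y :: 'y topology. locally_compact_space Y \<and> Hausdorff_space Y
              \<and> standard_lca Y \<cong>\<^sub>L\<^sub>C\<^sub>A lca_tilde At \<phi> \<sigma>
              \<longrightarrow> Y homeomorphic_space euclideanreal))"
proof -
  interpret sum_completion A At \<phi> by unfold_locales fact+
  obtain h where "line_model A At \<phi> h" by (rule line_model_exists)
  then interpret line_model A At \<phi> h .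
  have R: "locally_compact_space euclideanreal" "Hausdorff_space euclideanreal"
    by (simp_all add: locally_compact_space_euclidean)
  show ?thesis
  proof (intro conjI allI impI)
    show "\<exists>\<sigma>. sigma_tilde At \<phi> \<sigma>" using sigma_tilde_real_contact by blast
  next
    fix \<sigma> assume \<sigma>: "sigma_tilde At \<phi> \<sigma>"
    show iso: "lca_tilde At \<phi> \<sigma> \<cong>\<^sub>L\<^sub>C\<^sub>A standard_lca euclideanreal" by (rule lca_tilde_isomorphic[OF \<sigma>])
    show "complete_local_contact_algebra (lca_tilde At \<phi> \<sigma>)"
      using bdd_tilde_closed
      by (intro lca_isomorphic_complete[OF lca_tilde_lattice[OF At(1,2)] _ standard_lca_complete[OF R] iso])
        (simp add: lca_tilde_ops)
    fix Y :: "'y topology"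
    assume "locally_compact_space Y \<and> Hausdorff_space Y \<and> standard_lca Y \<cong>\<^sub>L\<^sub>C\<^sub>A lca_tilde At \<phi> \<sigma>"
    then show "Y homeomorphic_space euclideanreal"
      using standard_lca_determines_space[OF _ _ R] lca_isomorphic_trans[OF _ iso] by blast
  qed
qed

end
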